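(* Consider an arbitrary prior $\Pi$ on $\eta=(\eta^a,\eta^b,\eta^f)$. Assume that there exist measurable sets $\mathcal H_n$ of functions such that $$\Pi(\eta\in\mathcal H_n\mid X^{(n)})\to^{P_0}1,\qquad \sup_{b=\Psi(\eta^b):\,\eta\in\mathcal H_n}\|b-b_0\|_{L^2(F_0)}\to0,$$ $$\sup_{f=e^{\eta^f}/\int e^{\eta^f}dz:\,\eta\in\mathcal H_n}\|f-f_0\|_{L^1}\to0,\qquad \sup_{b=\Psi(\eta^b):\,\eta\in\mathcal H_n}\bigl|\mathbb G_n[b-b_0]\bigr|\to^{P_0}0,$$ and also $$\sup_{b=\Psi(\eta^b),\,f=e^{\eta^f}/\int e^{\eta^f}dz:\,\eta\in\mathcal H_n}\Bigl|\sqrt n\int(b-b_0)(f-f_0)\,dz\Bigr|\to0 .$$ For $t\in\mathbb R$ and $\xi_0^f=b_0-\int b_0\,dF_0$, let $$\eta_t(\eta)=\Bigl(\eta^a,\ \eta^b-\frac{t}{\sqrt n}a_0,\ \eta^f-\frac{t}{\sqrt n}\xi_0^f-\log\int e^{\eta^f-t\xi_0^f/\sqrt n}\,dz\Bigr).$$ If for every $t\in\mathbb R$ $$\frac{\int_{\mathcal H_n}\prod_{i=1}^np_{\eta_t(\eta)}(X_i)\,d\Pi(\eta)}{\int_{\mathcal H_n}\prod_{i=1}^np_{\eta}(X_i)\,d\Pi(\eta)}\to^{P_0}1,$$ then the posterior distribution of $\chi(\eta)=\int bf\,dz$ satisfies the semiparametric Bernstein--von Mises theorem.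
   Context: Model. One observes $X^{(n)}=(X_1,\dots,X_n)$, i.i.d. copies of $X=(Z,R,RY)$, where $Z$ takes values in a measurable space $\mathcal Z$, $R,Y\in\{0,1\}$, and $R,Y$ are conditionally independent given $Z$. Parameters: $f$ = density of the law $F$ of $Z$ with respect to a fixed dominating measure written $dz$ (Lebesgue measure if $\mathcal Z=[0,1]^d$), $1/a(z)=P(R=1\mid Z=z)$, $b(z)=P(Y=1\mid Z=z)$. With $\Psi(x)=1/(1+e^{-x})$ set $\eta^a=\Psi^{-1}(1/a)$, $\eta^b=\Psi^{-1}(b)$, $\eta^f=\log f$ (an unnormalized function $\eta^f$ is identified with the density $f=e^{\eta^f}/\int e^{\eta^f}dz$). The density of $X$ is $p_\eta(x)=(1/a(z))^r(1-1/a(z))^{1-r}b(z)^{ry}(1-b(z))^{r(1-y)}f(z)$. The posterior has density proportional to $\prod_{i=1}^np_\eta(X_i)$ with respect to $\Pi$. The true parameters are $(a_0,b_0,f_0)$, $F_0$ has density $f_0$; $P_0$ denotes the corresponding law of the data, and $\to^{P_0}$ convergence in $P_0$-probability (outer probability if needed). Standing assumption: $1/a_0$ and $b_0$ are bounded away from $0$ and $1$, and $f_0$ is bounded away from $0$ and $\infty$. For $h$ a function of $X$ (or of $Z$), $\mathbb G_n[h]=\sqrt n\bigl(n^{-1}\sum_{i=1}^n h(X_i)-P_0h\bigr)$. $L^1$ is with respect to $dz$. Semiparametric Bernstein--von Mises theorem. Let $\chi=\int bf\,dz$, $\chi_0=\int b_0f_0\,dz$, $\widetilde\chi_0(X)=Ra_0(Z)(Y-b_0(Z))+b_0(Z)-\chi_0$,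 $V_0=P_0\widetilde\chi_0^2=\int a_0b_0(1-b_0)\,dF_0+\int b_0^2\,dF_0-\chi_0^2$, and let $\widehat\chi_n$ be any random sequence with $\widehat\chi_n=\chi_0+n^{-1}\sum_{i=1}^n\widetilde\chi_0(X_i)+o_{P_0}(n^{-1/2})$. The posterior satisfies the semiparametric Bernstein--von Mises theorem if $d_{BL}\bigl(\mathcal L(\sqrt n(\chi-\widehat\chi_n)\mid X^{(n)}),N(0,V_0)\bigr)\to^{P_0}0$, where $\mathcal L(\cdot\mid X^{(n)})$ is the posterior law and $d_{BL}$ is the bounded Lipschitz distance between probability measures on $\mathbb R$. *)

theory Defs
  imports "HOL-Probability.Probability"
begin

text \<open>
  A parameter is a triple of functions (first, second, third component: the functions
  \<open>\<eta>\<^sup>a, \<eta>\<^sup>b, \<eta>\<^sup>f\<close>). An observation is a triple \<open>(z, r, w)\<close>, where \<open>w\<close> is the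
  value of the product \<open>R Y\<close>; the binary variables are natural numbers in \<open>{0, 1}\<close>.
\<close>

type_synonym 'z param = "('z \<Rightarrow> real) \<times> ('z \<Rightarrow> real) \<times> ('z \<Rightarrow> real)"
type_synonym 'z obs = "'z \<times> nat \<times> nat"

definition Psi :: "real \<Rightarrow> real" where
  "Psi x = 1 / (1 + exp (- x))"

definition par_a :: "'z param \<Rightarrow> 'z \<Rightarrow> real" where
  "par_a \<eta> z = 1 / Psi (fst \<eta> z)"

definition par_b :: "'z param \<Rightarrow> 'z \<Rightarrow> real" where
  "par_b \<eta> z = Psi (fst (snd \<eta>) z)"

definition par_f :: "'z measure \<Rightarrow> 'z param \<Rightarrow> 'z \<Rightarrow> real" where
  "par_f N \<eta> z = exp (snd (snd \<eta>) z) / (\<integral>u. exp (snd (snd \<eta>) u) \<partial>N)"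


subsection \<open>Law of the data\<close>

text \<open>Throughout, \<open>N\<close> is the dominating measure \<open>dz\<close> on the sample space of \<open>Z\<close>.\<close>

definition obs_space :: "'z measure \<Rightarrow> 'z obs measure" where
  "obs_space N = N \<Otimes>\<^sub>M (count_space {0, 1} \<Otimes>\<^sub>M count_space {0, 1})"

text \<open>The law of \<open>(Z, R, Y)\<close>: the product form in \<open>r\<close> and \<open>y\<close> is the conditional
  independence of \<open>R\<close> and \<open>Y\<close> given \<open>Z\<close>.\<close>

definition full_law ::
  "'z measure \<Rightarrow> ('z \<Rightarrow> real) \<Rightarrow> ('z \<Rightarrow> real) \<Rightarrow> ('z \<Rightarrow> real) \<Rightarrow> ('z \<times> nat \<times> nat) measure" where
  "full_law N a b f =
     density (N \<Otimes>\<^sub>M (count_space {0, 1} \<Otimes>\<^sub>M count_space {0, 1}))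
       (\<lambda>(z, r, y). ennreal
          ((1 / a z) ^ r * (1 - 1 / a z) ^ (1 - r) * (b z ^ y * (1 - b z) ^ (1 - y)) * f z))"

definition obs_law ::
  "'z measure \<Rightarrow> ('z \<Rightarrow> real) \<Rightarrow> ('z \<Rightarrow> real) \<Rightarrow> ('z \<Rightarrow> real) \<Rightarrow> 'z obs measure" where
  "obs_law N a b f = distr (full_law N a b f) (obs_space N) (\<lambda>(z, r, y). (z, r, r * y))"

text \<open>The i.i.d. sequence is realised as the coordinate sequence on the infinite product, so
  that outer probabilities refer to the law of the data itself.\<close>

definition data_law ::
  "'z measure \<Rightarrow> ('z \<Rightarrow> real) \<Rightarrow> ('z \<Rightarrow> real) \<Rightarrow> ('z \<Rightarrow> real) \<Rightarrow> (nat \<Rightarrow> 'z obs) measure" where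
  "data_law N a b f = PiM UNIV (\<lambda>_. obs_law N a b f)"

text \<open>The density of \<open>(Z, R, RY)\<close>. As \<open>w = r y\<close>, the exponent \<open>r (1 - y)\<close> is \<open>r - w\<close>
  (the point \<open>(r, w) = (0, 1)\<close> does not occur).\<close>

definition p_dens :: "'z measure \<Rightarrow> 'z param \<Rightarrow> 'z obs \<Rightarrow> real" where
  "p_dens N \<eta> = (\<lambda>(z, r, w).
     (1 / par_a \<eta> z) ^ r * (1 - 1 / par_a \<eta> z) ^ (1 - r)
       * par_b \<eta> z ^ w * (1 - par_b \<eta> z) ^ (r - w) * par_f N \<eta> z)"

definition regular_truth ::
  "'z measure \<Rightarrow> ('z \<Rightarrow> real) \<Rightarrow> ('z \<Rightarrow> real) \<Rightarrow> ('z \<Rightarrow> real) \<Rightarrow> bool" where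
  "regular_truth N a0 b0 f0 \<longleftrightarrow>
     a0 \<in> borel_measurable N \<and> b0 \<in> borel_measurable N \<and> f0 \<in> borel_measurable N \<and>
     has_bochner_integral N f0 1 \<and>
     (\<exists>\<delta>>0. AE z in N. \<delta> \<le> 1 / a0 z \<and> 1 / a0 z \<le> 1 - \<delta>) \<and>
     (\<exists>\<delta>>0. AE z in N. \<delta> \<le> b0 z \<and> b0 z \<le> 1 - \<delta>) \<and>
     (\<exists>\<delta>>0. \<exists>K. AE z in N. \<delta> \<le> f0 z \<and> f0 z \<le> K)"


subsection \<open>Prior and posterior\<close>

text \<open>The sigma-algebra on the parameter set is arbitrary, subject to joint measurability of
  the evaluation maps, which makes the posterior given by Bayes' formula well defined.
  Integrability of \<open>exp \<eta>\<^sup>f\<close> is what allows normalising it to a density.\<close>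

definition is_prior :: "'z measure \<Rightarrow> 'z param measure \<Rightarrow> bool" where
  "is_prior N Prior \<longleftrightarrow>
     prob_space Prior \<and>
     (\<lambda>(\<eta>, z). fst \<eta> z) \<in> borel_measurable (Prior \<Otimes>\<^sub>M N) \<and>
     (\<lambda>(\<eta>, z). fst (snd \<eta>) z) \<in> borel_measurable (Prior \<Otimes>\<^sub>M N) \<and>
     (\<lambda>(\<eta>, z). snd (snd \<eta>) z) \<in> borel_measurable (Prior \<Otimes>\<^sub>M N) \<and>
     (\<forall>\<eta>\<in>space Prior. integrable N (\<lambda>z. exp (snd (snd \<eta>) z)))"

definition likelihood :: "'z measure \<Rightarrow> nat \<Rightarrow> (nat \<Rightarrow> 'z obs) \<Rightarrow> 'z param \<Rightarrow> real" where
  "likelihood N n x \<eta> = (\<Prod>i<n. p_dens N \<eta> (x i))"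

text \<open>The normalising constant is positive, and finite for almost every \<open>x\<close>; on the
  exceptional null set it is \<open>0\<close> by convention and the posterior is the null measure.\<close>

definition posterior ::
  "'z measure \<Rightarrow> 'z param measure \<Rightarrow> nat \<Rightarrow> (nat \<Rightarrow> 'z obs) \<Rightarrow> 'z param measure" where
  "posterior N Prior n x =
     density Prior (\<lambda>\<eta>. ennreal (likelihood N n x \<eta> / (\<integral>\<eta>'. likelihood N n x \<eta>' \<partial>Prior)))"


subsection \<open>Modes of convergence\<close>

definition tendsto_outer_prob ::
  "'a measure \<Rightarrow> (nat \<Rightarrow> 'a \<Rightarrow> real) \<Rightarrow> real \<Rightarrow> bool" where
  "tendsto_outer_prob M T c \<longleftrightarrow>
     (\<forall>\<epsilon>>0. (\<lambda>n. outer_measure_of M {x \<in> space M. \<bar>T n x - c\<bar> > \<epsilon>}) \<longlonglongrightarrow> 0)"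

definition bl_dist :: "real measure \<Rightarrow> real measure \<Rightarrow> real" where
  "bl_dist \<mu> \<nu> =
     (SUP h\<in>{h :: real \<Rightarrow> real. (\<forall>x. \<bar>h x\<bar> \<le> 1) \<and> 1-lipschitz_on UNIV h}.
        \<bar>(\<integral>x. h x \<partial>\<mu>) - (\<integral>x. h x \<partial>\<nu>)\<bar>)"

text \<open>In the hypotheses on the sets \<open>H\<^sub>n\<close> these norms, and the empirical process, are taken under
  real suprema. Each supremum is over a bounded set (\<open>b\<close> and \<open>b\<^sub>0\<close> take values in \<open>[0, 1]\<close> almost
  everywhere, \<open>f\<close> and \<open>f\<^sub>0\<close> are probability densities), and \<open>H\<^sub>n\<close> is nonempty for all large \<open>n\<close>
  as its posterior mass tends to one.\<close>

definition l2_norm :: "'a measure \<Rightarrow> ('a \<Rightarrow> real) \<Rightarrow> real" where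
  "l2_norm M h = sqrt (\<integral>x. (h x)\<^sup>2 \<partial>M)"

definition l1_norm :: "'a measure \<Rightarrow> ('a \<Rightarrow> real) \<Rightarrow> real" where
  "l1_norm M h = (\<integral>x. \<bar>h x\<bar> \<partial>M)"

definition emp_process :: "'a measure \<Rightarrow> nat \<Rightarrow> ('a \<Rightarrow> real) \<Rightarrow> (nat \<Rightarrow> 'a) \<Rightarrow> real" where
  "emp_process P n h x = sqrt (real n) * ((\<Sum>i<n. h (x i)) / real n - (\<integral>u. h u \<partial>P))"


subsection \<open>The functional and its efficient influence function\<close>

definition chi :: "'z measure \<Rightarrow> ('z \<Rightarrow> real) \<Rightarrow> ('z \<Rightarrow> real) \<Rightarrow> real" where
  "chi N b f = (\<integral>z. b z * f z \<partial>N)"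

text \<open>As \<open>w = r y\<close> with \<open>r\<close> binary, \<open>r (w - b\<^sub>0)\<close> equals \<open>r (y - b\<^sub>0)\<close>.\<close>

definition chi_tilde ::
  "'z measure \<Rightarrow> ('z \<Rightarrow> real) \<Rightarrow> ('z \<Rightarrow> real) \<Rightarrow> ('z \<Rightarrow> real) \<Rightarrow> 'z obs \<Rightarrow> real" where
  "chi_tilde N a0 b0 f0 =
     (\<lambda>(z, r, w). real r * a0 z * (real w - b0 z) + b0 z - chi N b0 f0)"

definition eff_var ::
  "'z measure \<Rightarrow> ('z \<Rightarrow> real) \<Rightarrow> ('z \<Rightarrow> real) \<Rightarrow> ('z \<Rightarrow> real) \<Rightarrow> real" where
  "eff_var N a0 b0 f0 = (\<integral>x. (chi_tilde N a0 b0 f0 x)\<^sup>2 \<partial>(obs_law N a0 b0 f0))"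

definition xi_f ::
  "'z measure \<Rightarrow> ('z \<Rightarrow> real) \<Rightarrow> ('z \<Rightarrow> real) \<Rightarrow> 'z \<Rightarrow> real" where
  "xi_f N b0 f0 z = b0 z - (\<integral>u. b0 u \<partial>(density N (\<lambda>u. ennreal (f0 u))))"

definition eta_t ::
  "'z measure \<Rightarrow> ('z \<Rightarrow> real) \<Rightarrow> ('z \<Rightarrow> real) \<Rightarrow> ('z \<Rightarrow> real) \<Rightarrow> nat \<Rightarrow> real \<Rightarrow> 'z param \<Rightarrow> 'z param"
where
  "eta_t N a0 b0 f0 n t \<eta> = (case \<eta> of (\<eta>a, \<eta>b, \<eta>f) \<Rightarrow>
     (\<eta>a,
      \<lambda>z. \<eta>b z - t / sqrt (real n) * a0 z,
      \<lambda>z. \<eta>f z - t / sqrt (real n) * xi_f N b0 f0 z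
           - ln (\<integral>u. exp (\<eta>f u - t * xi_f N b0 f0 u / sqrt (real n)) \<partial>N)))"

definition asymp_efficient ::
  "'z measure \<Rightarrow> ('z \<Rightarrow> real) \<Rightarrow> ('z \<Rightarrow> real) \<Rightarrow> ('z \<Rightarrow> real)
     \<Rightarrow> (nat \<Rightarrow> (nat \<Rightarrow> 'z obs) \<Rightarrow> real) \<Rightarrow> bool" where
  "asymp_efficient N a0 b0 f0 chihat \<longleftrightarrow>
     (\<forall>n. chihat n \<in> borel_measurable (data_law N a0 b0 f0)) \<and>
     tendsto_outer_prob (data_law N a0 b0 f0)
       (\<lambda>n x. sqrt (real n) *
          (chihat n x - (chi N b0 f0 + (\<Sum>i<n. chi_tilde N a0 b0 f0 (x i)) / real n))) 0"

definition semiparametric_BvM ::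
  "'z measure \<Rightarrow> ('z \<Rightarrow> real) \<Rightarrow> ('z \<Rightarrow> real) \<Rightarrow> ('z \<Rightarrow> real) \<Rightarrow> 'z param measure
     \<Rightarrow> (nat \<Rightarrow> (nat \<Rightarrow> 'z obs) \<Rightarrow> real) \<Rightarrow> bool" where
  "semiparametric_BvM N a0 b0 f0 Prior chihat \<longleftrightarrow>
     tendsto_outer_prob (data_law N a0 b0 f0)
       (\<lambda>n x. bl_dist
          (distr (posterior N Prior n x) borel
             (\<lambda>\<eta>. sqrt (real n) * (chi N (par_b \<eta>) (par_f N \<eta>) - chihat n x)))
          (density lborel (\<lambda>u. ennreal (normal_density 0 (sqrt (eff_var N a0 b0 f0)) u)))) 0"

end

theory Submission
  imports Defs "HOL-Complex_Analysis.Complex_Analysis" "HOL-Real_Asymp.Real_Asymp"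
begin

text \<open>
  Along the perturbation \<open>\<eta>\<^sub>t\<close> the log likelihood ratio equals
  \<open>t \<surd>n (\<chi>(\<eta>) - \<chi>\<^sub>n) - t\<^sup>2 V\<^sub>0 / 2\<close> up to a remainder that vanishes uniformly over \<open>H\<^sub>n\<close>.
  Hence the ratio hypothesis says that the Laplace transform of the posterior law of
  \<open>\<surd>n (\<chi>(\<eta>) - \<chi>\<^sub>n)\<close>, conditioned on \<open>H\<^sub>n\<close>, converges to \<open>exp (t\<^sup>2 V\<^sub>0 / 2)\<close>, and pointwise
  convergence of Laplace transforms implies weak convergence.

  The remainder contains the empirical process at \<open>R a\<^sub>0 (b - b\<^sub>0)\<close> and the empirical mean of
  \<open>(b - b\<^sub>0)\<^sup>2\<close>, while only the process at \<open>b - b\<^sub>0\<close> is assumed to be small. Symmetrization passes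
  to random signs; the contraction principle then inserts the bounded multiplier \<open>R a\<^sub>0\<close>, and the
  Paley--Zygmund inequality recovers \<open>\<Sum> (b - b\<^sub>0)\<^sup>2\<close> from the smallness of most sign sums.
  Essential suprema under the prior take the place of suprema over \<open>H\<^sub>n\<close>, because they are measurable.
\<close>

subsection \<open>Random signs\<close>

text \<open>No entropy or size condition on \<open>H n\<close> is available: all that is known is
  that one empirical process is small, and only in outer probability. Expectations of its supremum
  need not converge, so every comparison is made between probabilities, and each remainder is
  bounded by an absolute multiple of the single probability \<open>tau\<close>. Measurability
  matters because symmetrization rests on Fubini's theorem; passing to essential suprema is
  harmless, since they are at most the suprema and the posterior ignores prior null sets. Signs are
  coded as subsets of the index set, so that statements about them are counts and null sets merge
  over finitely many patterns. In the limit theorem the posterior laws are random and the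
  exceptional events possibly nonmeasurable. A compactness argument therefore first turns
  convergence of Laplace transforms into a deterministic implication with finitely many
  \<open>t\<close>; after that, finite unions of events of vanishing outer probability
  suffice.\<close>

definition sgn_in :: "'i set \<Rightarrow> 'i \<Rightarrow> real" where
  "sgn_in A i = (if i \<in> A then 1 else -1)"

lemma abs_sgn_in [simp]: "\<bar>sgn_in A i\<bar> = 1"
  by (simp add: sgn_in_def)

text \<open>A layer-cake argument: a nonnegative weight is a positive combination of indicators of
  its upper level sets, with coefficients adding up to its maximum. The induction peels off the
  lowest layer.\<close>

lemma abs_sum_weights_le:
  fixes c w :: "'i \<Rightarrow> real"
  assumes "finite S" and "\<And>i. i \<in> S \<Longrightarrow> 0 \<le> c i" and "\<And>i. i \<in> S \<Longrightarrow> c i \<le> m"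
    and "0 \<le> m"
    and "\<And>u. 0 < u \<Longrightarrow> \<bar>\<Sum>i\<in>{i\<in>S. u \<le> c i}. w i\<bar> \<le> t"
  shows "\<bar>\<Sum>i\<in>S. c i * w i\<bar> \<le> m * t"
  using assms
proof (induction "card {i\<in>S. 0 < c i}" arbitrary: c m rule: less_induct)
  case less
  define P where "P = {i\<in>S. 0 < c i}"
  have t0: "0 \<le> t" using less.prems(5)[of 1] by linarith
  have finP: "finite P" using less.prems(1) by (simp add: P_def)
  have sumP: "(\<Sum>i\<in>S. c i * w i) = (\<Sum>i\<in>P. c i * w i)"
    by (rule sum.mono_neutral_right) (use less.prems(1,2) in \<open>force simp: P_def\<close>)+
  show ?case
  proof (cases "P = {}")
    case True
    then show ?thesis using sumP t0 less.prems(4) by simp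
  next
    case False
    define d where "d = Min (c ` P)"
    have d: "d \<in> c ` P" using False finP by (simp add: d_def)
    then obtain j where j: "j \<in> P" "c j = d" by auto
    have d0: "0 < d" using j by (auto simp: P_def)
    have dle: "d \<le> c i" if "i \<in> P" for i using that finP by (simp add: d_def)
    have dm: "d \<le> m" using j less.prems(3) by (auto simp: P_def)
    \<comment> \<open>Lowering the weight by its least positive value \<open>d\<close> turns level
      \<open>u\<close> of \<open>c'\<close> into level \<open>u + d\<close> of \<open>c\<close> and
      lowers the bound to \<open>m - d\<close>. The removed layer contributes \<open>d\<close> times
      the sum over \<open>P\<close>, itself a level set.\<close>
    define c' where "c' i = max 0 (c i - d)" for i
    have c'pos: "{i\<in>S. 0 < c' i} \<subset> {i\<in>S. 0 < c i}"
    proof -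
      have "j \<in> {i\<in>S. 0 < c i}" "j \<notin> {i\<in>S. 0 < c' i}"
        using j by (auto simp: P_def c'_def)
      moreover have "{i\<in>S. 0 < c' i} \<subseteq> {i\<in>S. 0 < c i}" using d0 by (auto simp: c'_def)
      ultimately show ?thesis by blast
    qed
    have "\<bar>\<Sum>i\<in>S. c' i * w i\<bar> \<le> (m - d) * t"
    proof (rule less.hyps)
      show "card {i\<in>S. 0 < c' i} < card {i\<in>S. 0 < c i}"
        using c'pos less.prems(1) by (intro psubset_card_mono) auto
      show "c' i \<le> m - d" if "i \<in> S" for i using that less.prems(3) dm by (simp add: c'_def)
      show "\<bar>\<Sum>i\<in>{i\<in>S. u \<le> c' i}. w i\<bar> \<le> t" if "0 < u" for u
      proof -
        have "{i\<in>S. u \<le> c' i} = {i\<in>S. u + d \<le> c i}" using that by (auto simp: c'_def)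
        then show ?thesis using less.prems(5)[of "u + d"] that d0 by simp
      qed
    qed (use dm less.prems(1) in \<open>auto simp: c'_def\<close>)
    moreover have "(\<Sum>i\<in>S. c' i * w i) = (\<Sum>i\<in>P. c' i * w i)"
    proof (rule sum.mono_neutral_right)
      show "\<forall>i\<in>S - P. c' i * w i = 0" using less.prems(2) d0 by (force simp: P_def c'_def)
    qed (use less.prems(1) in \<open>auto simp: P_def\<close>)
    moreover have "(\<Sum>i\<in>P. c i * w i) = (\<Sum>i\<in>P. c' i * w i) + d * (\<Sum>i\<in>P. w i)"
      unfolding sum_distrib_left sum.distrib[symmetric]
      by (rule sum.cong) (use dle in \<open>auto simp: c'_def algebra_simps\<close>)
    moreover have "\<bar>\<Sum>i\<in>P. w i\<bar> \<le> t"
    proof -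
      have "P = {i\<in>S. d \<le> c i}" using dle d0 by (force simp: P_def)
      then show ?thesis using less.prems(5)[OF d0] by simp
    qed
    then have "\<bar>d * (\<Sum>i\<in>P. w i)\<bar> \<le> d * t"
      using d0 by (simp add: abs_mult)
    ultimately show ?thesis unfolding sumP by (simp add: algebra_simps)
  qed
qed

text \<open>
  Levy's reflection argument: at the largest threshold whose level set of \<open>c\<close> violates the bound,
  flip all signs outside that level set.
\<close>

lemma sign_contraction:
  fixes c :: "'i \<Rightarrow> real" and v :: "'i \<Rightarrow> 'a \<Rightarrow> real"
  assumes S: "finite S" and c: "\<And>i. i \<in> S \<Longrightarrow> 0 \<le> c i \<and> c i \<le> m" and m: "0 \<le> m" and t: "0 \<le> t"
  shows "card {A\<in>Pow S. \<not> (AE y in \<Theta>. \<bar>\<Sum>i\<in>S. sgn_in A i * (c i * v i y)\<bar> \<le> m * t)}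
    \<le> 2 * card {A\<in>Pow S. \<not> (AE y in \<Theta>. \<bar>\<Sum>i\<in>S. sgn_in A i * v i y\<bar> \<le> t)}"
    (is "card ?E \<le> 2 * card ?G")
proof -
  define L where "L u = {i\<in>S. u \<le> c i}" for u
  define bad where "bad A u \<longleftrightarrow> \<not> (AE y in \<Theta>. \<bar>\<Sum>i\<in>L u. sgn_in A i * v i y\<bar> \<le> t)" for A u
  \<comment> \<open>Only the positive values attained by \<open>c\<close> matter as thresholds; they
    are finitely many, so the AE bounds can be combined.\<close>
  define C where "C = {u\<in>c ` S. 0 < u}"
  have finC: "finite C" using S by (simp add: C_def)
  define E' where "E' = {A\<in>Pow S. \<exists>u\<in>C. bad A u}"
  define top where "top A = Max {u\<in>C. bad A u}" for A
  define refl where "refl A = (if \<exists>u\<in>C. bad A u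
      then (A \<inter> L (top A)) \<union> ((S - A) - L (top A)) else A)" for A
  have EE': "?E \<subseteq> E'"
  proof (rule subsetI, rule ccontr)
    fix A assume A: "A \<in> ?E" and nA: "A \<notin> E'"
    then have good: "\<And>u. u \<in> C \<Longrightarrow> AE y in \<Theta>. \<bar>\<Sum>i\<in>L u. sgn_in A i * v i y\<bar> \<le> t"
      by (auto simp: E'_def bad_def)
    from good have "AE y in \<Theta>. \<forall>u\<in>C. \<bar>\<Sum>i\<in>L u. sgn_in A i * v i y\<bar> \<le> t"
      using finC by (intro AE_finite_allI) auto
    then have "AE y in \<Theta>. \<bar>\<Sum>i\<in>S. sgn_in A i * (c i * v i y)\<bar> \<le> m * t"
    proof eventually_elim
      case (elim y)
      have "\<bar>\<Sum>i\<in>{i\<in>S. u \<le> c i}. sgn_in A i * v i y\<bar> \<le> t" if u: "0 < u" for u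
      proof (cases "L u = {}")
        case True
        then have "(\<Sum>i\<in>{i\<in>S. u \<le> c i}. sgn_in A i * v i y) = 0" unfolding L_def by (simp only: sum.empty)
        then show ?thesis using t by simp
      next
        case False
        \<comment> \<open>Rounding the threshold up to the least weight in the level set leaves the
          set unchanged and lands in \<open>C\<close>.\<close>
        define u' where "u' = Min (c ` L u)"
        have finL: "finite (L u)" using S by (simp add: L_def)
        have "u' \<in> c ` L u" using False finL by (simp add: u'_def)
        then have "u' \<in> C" "u \<le> u'" using u by (auto simp: C_def L_def)
        moreover have "L u' = L u"
        proof
          show "L u' \<subseteq> L u" using \<open>u \<le> u'\<close> by (auto simp: L_def)
          show "L u \<subseteq> L u'"
          proof
            fix i assume i: "i \<in> L u"
            then have "u' \<le> c i" using finL by (simp add: u'_def)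
            then show "i \<in> L u'" using i by (simp add: L_def)
          qed
        qed
        ultimately show ?thesis using elim by (auto simp flip: L_def)
      qed
      then have "\<bar>\<Sum>i\<in>S. c i * (sgn_in A i * v i y)\<bar> \<le> m * t"
        using c by (intro abs_sum_weights_le[OF S _ _ m]) auto
      then show ?case by (simp add: mult.left_commute)
    qed
    with A show False by simp
  qed
  have topC: "top A \<in> C \<and> bad A (top A) \<and> (\<forall>u\<in>C. bad A u \<longrightarrow> u \<le> top A)"
    if "\<exists>u\<in>C. bad A u" for A
  proof -
    have "finite {u\<in>C. bad A u}" "{u\<in>C. bad A u} \<noteq> {}" using that finC by auto
    from Max_in[OF this] Max_ge[OF this(1)] show ?thesis unfolding top_def by auto
  qed
  have bad_cong: "bad A u = bad B u" if "\<And>i. i \<in> L u \<Longrightarrow> i \<in> A \<longleftrightarrow> i \<in> B" for A B u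
  proof -
    have "(\<Sum>i\<in>L u. sgn_in A i * v i y) = (\<Sum>i\<in>L u. sgn_in B i * v i y)" for y
      using that by (intro sum.cong) (auto simp: sgn_in_def)
    then show ?thesis by (simp add: bad_def)
  qed
  have refl: "refl A \<in> Pow S \<and> top (refl A) = top A \<and> (\<exists>u\<in>C. bad (refl A) u)"
    if A: "A \<in> Pow S" "\<exists>u\<in>C. bad A u" for A
  proof -
    \<comment> \<open>At and above \<open>top A\<close> the level sets lie inside
      \<open>L (top A)\<close>, where no sign is flipped. Badness there, and with it
      \<open>top\<close>, is invariant, which makes \<open>refl\<close> an involution.\<close>
    have same: "bad (refl A) u = bad A u" if "top A \<le> u" for u
      using A that by (intro bad_cong) (auto simp: refl_def L_def)
    have t: "top A \<in> C" "bad A (top A)" "\<And>u. u \<in> C \<Longrightarrow> bad A u \<Longrightarrow> u \<le> top A"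
      using topC[OF A(2)] by auto
    have ex: "\<exists>u\<in>C. bad (refl A) u" using t same by auto
    have "top (refl A) = top A"
    proof (rule antisym)
      show "top A \<le> top (refl A)" using topC[OF ex] t same by auto
      then show "top (refl A) \<le> top A" using topC[OF ex] t same by auto
    qed
    then show ?thesis using ex A by (auto simp: refl_def)
  qed
  have inj: "inj_on refl (Pow S)"
  proof (rule inj_on_inverseI[where g = refl])
    fix A assume A: "A \<in> Pow S"
    show "refl (refl A) = A"
    proof (cases "\<exists>u\<in>C. bad A u")
      case True
      note r = refl[OF A True]
      have "refl (refl A) = (refl A \<inter> L (top A)) \<union> ((S - refl A) - L (top A))"
        unfolding refl_def[of "refl A"] using r by auto
      also have "\<dots> = A"
        unfolding refl_def[of A] using A True by (auto simp: L_def)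
      finally show ?thesis .
    next
      case False
      then show ?thesis by (simp add: refl_def)
    qed
  qed
  \<comment> \<open>The signs of \<open>A\<close> and \<open>refl A\<close> agree on
    \<open>L (top A)\<close> and are opposite elsewhere, so adding the two full sums gives twice the
    level sum. If neither full sum were bad, the level sum could not be.\<close>
  have cover: "A \<in> ?G \<or> refl A \<in> ?G" if A: "A \<in> E'" for A
  proof (rule ccontr)
    have bad: "\<exists>u\<in>C. bad A u" and AS: "A \<in> Pow S" using A by (auto simp: E'_def)
    assume "\<not> ?thesis"
    then have "AE y in \<Theta>. \<bar>\<Sum>i\<in>S. sgn_in A i * v i y\<bar> \<le> t"
      "AE y in \<Theta>. \<bar>\<Sum>i\<in>S. sgn_in (refl A) i * v i y\<bar> \<le> t"
      using AS refl[OF AS bad] by auto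
    then have "AE y in \<Theta>. \<bar>\<Sum>i\<in>L (top A). sgn_in A i * v i y\<bar> \<le> t"
    proof eventually_elim
      case (elim y)
      have "(\<Sum>i\<in>S. sgn_in A i * v i y) + (\<Sum>i\<in>S. sgn_in (refl A) i * v i y)
        = (\<Sum>i\<in>S. if i \<in> L (top A) then 2 * (sgn_in A i * v i y) else 0)"
        unfolding sum.distrib[symmetric]
        by (rule sum.cong) (use bad AS in \<open>auto simp: refl_def sgn_in_def\<close>)
      also have "\<dots> = (\<Sum>i\<in>L (top A). 2 * (sgn_in A i * v i y))"
        by (subst sum.inter_restrict[OF S, symmetric]) (rule sum.cong, auto simp: L_def)
      finally show ?case using elim by (simp add: sum_distrib_left[symmetric])
    qed
    then show False using topC[OF bad] by (simp add: bad_def)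
  qed
  have finG: "finite ?G" and finE': "finite E'" using S by (auto simp: E'_def)
  \<comment> \<open>Injectivity of \<open>refl\<close> bounds the patterns covered through it by
    \<open>card ?G\<close>; this is the factor 2.\<close>
  have "card E' \<le> card (?G \<union> {A\<in>E'. refl A \<in> ?G})"
    using cover finG finE' by (intro card_mono) auto
  also have "\<dots> \<le> card ?G + card {A\<in>E'. refl A \<in> ?G}" by (rule card_Un_le)
  also have "card {A\<in>E'. refl A \<in> ?G} \<le> card ?G"
    using finG inj by (intro card_inj_on_le[where f = refl]) (auto simp: E'_def inj_on_def)
  finally show ?thesis using card_mono[OF finE' EE'] by simp
qed

lemma sum_Pow_insert:
  fixes g :: "'i set \<Rightarrow> 'b::comm_monoid_add"
  assumes "finite S" "j \<notin> S"
  shows "(\<Sum>A\<in>Pow (insert j S). g A) = (\<Sum>A\<in>Pow S. g A + g (insert j A))"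
proof -
  have "(\<Sum>A\<in>Pow (insert j S). g A) = (\<Sum>A\<in>Pow S. g A) + (\<Sum>A\<in>insert j ` Pow S. g A)"
    unfolding Pow_insert using assms by (intro sum.union_disjoint) auto
  also have "(\<Sum>A\<in>insert j ` Pow S. g A) = (\<Sum>A\<in>Pow S. g (insert j A))"
    using assms by (subst sum.reindex) (auto simp: inj_on_def)
  finally show ?thesis by (simp add: sum.distrib)
qed

text \<open>Khinchine's inequality for exponents 2 and 4. Adding an index pairs \<open>A\<close>
  with \<open>insert j A\<close>, and the terms odd in \<open>u j\<close> cancel in each
  pair.\<close>

lemma sign_sum_moments:
  fixes u :: "'i \<Rightarrow> real"
  assumes "finite S"
  shows "(\<Sum>A\<in>Pow S. (\<Sum>i\<in>S. sgn_in A i * u i)\<^sup>2) = 2 ^ card S * (\<Sum>i\<in>S. (u i)\<^sup>2)"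
    and "(\<Sum>A\<in>Pow S. (\<Sum>i\<in>S. sgn_in A i * u i) ^ 4) \<le> 3 * 2 ^ card S * (\<Sum>i\<in>S. (u i)\<^sup>2)\<^sup>2"
  using assms
proof (induction S rule: finite_induct)
  case empty
  { case 1 show ?case by simp }
  { case 2 show ?case by simp }
next
  case (insert j S)
  define X where "X A = (\<Sum>i\<in>S. sgn_in A i * u i)" for A
  have X: "(\<Sum>i\<in>insert j S. sgn_in A i * u i) = X A - u j"
    "(\<Sum>i\<in>insert j S. sgn_in (insert j A) i * u i) = X A + u j" if "A \<in> Pow S" for A
  proof -
    have "j \<notin> A" using that insert by auto
    then show "(\<Sum>i\<in>insert j S. sgn_in A i * u i) = X A - u j"
      using insert by (simp add: X_def sgn_in_def)
    have "(\<Sum>i\<in>S. sgn_in (insert j A) i * u i) = X A"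
      unfolding X_def using insert by (intro sum.cong) (auto simp: sgn_in_def)
    then show "(\<Sum>i\<in>insert j S. sgn_in (insert j A) i * u i) = X A + u j"
      using insert by (simp add: sgn_in_def)
  qed
  have c: "real (card (Pow S)) = 2 ^ card S" using insert by (simp add: card_Pow)
  { case 1
    have "(\<Sum>A\<in>Pow (insert j S). (\<Sum>i\<in>insert j S. sgn_in A i * u i)\<^sup>2)
      = (\<Sum>A\<in>Pow S. (X A - u j)\<^sup>2 + (X A + u j)\<^sup>2)"
      using insert.hyps by (subst sum_Pow_insert) (auto intro!: sum.cong simp del: sum.insert simp: X)
    also have "\<dots> = (\<Sum>A\<in>Pow S. 2 * (X A)\<^sup>2 + 2 * (u j)\<^sup>2)"
      by (simp add: power2_eq_square algebra_simps)
    also have "\<dots> = 2 * (\<Sum>A\<in>Pow S. (X A)\<^sup>2) + 2 * 2 ^ card S * (u j)\<^sup>2"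
      using c by (simp add: sum.distrib sum_distrib_left)
    finally show ?case using insert by (simp add: X_def algebra_simps)
  }
  { case 2
    have "(\<Sum>A\<in>Pow (insert j S). (\<Sum>i\<in>insert j S. sgn_in A i * u i) ^ 4)
      = (\<Sum>A\<in>Pow S. (X A - u j) ^ 4 + (X A + u j) ^ 4)"
      using insert.hyps by (subst sum_Pow_insert) (auto intro!: sum.cong simp del: sum.insert simp: X)
    also have "\<dots> = (\<Sum>A\<in>Pow S. 2 * (X A) ^ 4 + 12 * (u j)\<^sup>2 * (X A)\<^sup>2 + 2 * (u j) ^ 4)"
      by (intro sum.cong) (simp_all add: eval_nat_numeral algebra_simps)
    also have "\<dots> = 2 * (\<Sum>A\<in>Pow S. (X A) ^ 4) + 12 * (u j)\<^sup>2 * (\<Sum>A\<in>Pow S. (X A)\<^sup>2)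
        + 2 * 2 ^ card S * (u j) ^ 4"
      using c by (simp add: sum.distrib sum_distrib_left)
    \<comment> \<open>Enlarging the coefficient of \<open>u j ^ 4\<close> from 2 to 6 completes the
      square with constant 3.\<close>
    also have "\<dots> \<le> 2 * (3 * 2 ^ card S * (\<Sum>i\<in>S. (u i)\<^sup>2)\<^sup>2)
        + 12 * (u j)\<^sup>2 * (2 ^ card S * (\<Sum>i\<in>S. (u i)\<^sup>2)) + 6 * 2 ^ card S * (u j) ^ 4"
      using insert by (intro add_mono mult_left_mono) (auto simp: X_def)
    also have "\<dots> = 3 * 2 ^ card (insert j S) * (\<Sum>i\<in>insert j S. (u i)\<^sup>2)\<^sup>2"
      using insert by (simp add: eval_nat_numeral algebra_simps)
    finally show ?case .
  }
qed

text \<open>Paley--Zygmund: the fourth moment bound keeps the sum from being small for most signs.\<close>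

lemma sum_squares_le_of_sign_sums:
  fixes u :: "'i \<Rightarrow> real"
  assumes S: "finite S" and t: "0 \<le> t"
    and few: "12 * card {A\<in>Pow S. \<not> \<bar>\<Sum>i\<in>S. sgn_in A i * u i\<bar> \<le> t} < 2 ^ card S"
  shows "(\<Sum>i\<in>S. (u i)\<^sup>2) \<le> 2 * t\<^sup>2"
proof (rule ccontr)
  define X where "X A = (\<Sum>i\<in>S. sgn_in A i * u i)" for A
  define \<sigma> where "\<sigma> = (\<Sum>i\<in>S. (u i)\<^sup>2)"
  define B where "B = {A\<in>Pow S. \<not> \<bar>X A\<bar> \<le> t}"
  assume "\<not> ?thesis"
  then have gt: "2 * t\<^sup>2 < \<sigma>" by (simp add: \<sigma>_def)
  then have pos: "0 < \<sigma>" using zero_le_power2[of t] by linarith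
  have finB: "finite B" "B \<subseteq> Pow S" using S by (auto simp: B_def)
  have "2 ^ card S * \<sigma> = (\<Sum>A\<in>Pow S. (X A)\<^sup>2)"
    using sign_sum_moments(1)[OF S] by (simp add: X_def \<sigma>_def)
  \<comment> \<open>On \<open>B\<close> the arithmetic-geometric mean inequality trades the square
    for a fourth power, whose average costs only \<open>\<sigma> / 4\<close>. As
    \<open>t\<^sup>2\<close> is below \<open>\<sigma> / 2\<close>, a quarter of
    \<open>\<sigma>\<close> is left to the terms \<open>3 * \<sigma>\<close> on \<open>B\<close>;
    hence the factor 12 in \<open>few\<close>.\<close>
  also have "\<dots> \<le> (\<Sum>A\<in>Pow S. t\<^sup>2 + (X A) ^ 4 / (12 * \<sigma>) + (if A \<in> B then 3 * \<sigma> else 0))"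
  proof (rule sum_mono)
    fix A assume A: "A \<in> Pow S"
    show "(X A)\<^sup>2 \<le> t\<^sup>2 + (X A) ^ 4 / (12 * \<sigma>) + (if A \<in> B then 3 * \<sigma> else 0)"
    proof (cases "A \<in> B")
      case True
      have "0 \<le> ((X A)\<^sup>2 - 6 * \<sigma>)\<^sup>2 / (12 * \<sigma>)" using pos by simp
      also have "\<dots> = (X A) ^ 4 / (12 * \<sigma>) + 3 * \<sigma> - (X A)\<^sup>2"
        using pos by (simp add: field_simps eval_nat_numeral)
      finally have "(X A)\<^sup>2 \<le> (X A) ^ 4 / (12 * \<sigma>) + 3 * \<sigma>" by simp
      moreover have "0 \<le> t\<^sup>2" by simp
      ultimately have "(X A)\<^sup>2 \<le> t\<^sup>2 + (X A) ^ 4 / (12 * \<sigma>) + 3 * \<sigma>" by linarith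
      then show ?thesis using True by simp
    next
      case False
      then have "\<bar>X A\<bar> \<le> t" using A by (simp add: B_def)
      then have "(X A)\<^sup>2 \<le> t\<^sup>2" by (rule abs_le_square_iff[THEN iffD1, OF order_trans]) (use t in simp)
      moreover have "0 \<le> (X A) ^ 4 / (12 * \<sigma>)" using pos by (intro divide_nonneg_pos) auto
      ultimately show ?thesis using False by simp
    qed
  qed
  also have "\<dots> = 2 ^ card S * t\<^sup>2 + (\<Sum>A\<in>Pow S. (X A) ^ 4) / (12 * \<sigma>) + 3 * \<sigma> * card B"
  proof -
    have "(\<Sum>A\<in>Pow S. if A \<in> B then 3 * \<sigma> else 0) = 3 * \<sigma> * card B"
      using S finB by (simp add: sum.If_cases Int_absorb1)
    then show ?thesis using S by (simp add: sum.distrib sum_divide_distrib card_Pow)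
  qed
  also have "\<dots> \<le> 2 ^ card S * (\<sigma> / 2) + 2 ^ card S * \<sigma> / 4 + 3 * \<sigma> * card B"
  proof -
    have "(\<Sum>A\<in>Pow S. (X A) ^ 4) / (12 * \<sigma>) \<le> 3 * 2 ^ card S * \<sigma>\<^sup>2 / (12 * \<sigma>)"
      using sign_sum_moments(2)[OF S] pos by (intro divide_right_mono) (auto simp: X_def \<sigma>_def)
    also have "\<dots> = 2 ^ card S * \<sigma> / 4" using pos by (simp add: power2_eq_square)
    finally show ?thesis using gt pos by (intro add_mono mult_left_mono) auto
  qed
  finally have "2 ^ card S * \<sigma> \<le> 12 * card B * \<sigma>" by (simp add: algebra_simps)
  then have "2 ^ card S \<le> 12 * real (card B)" using pos by simp
  moreover have "real (12 * card B) < real (2 ^ card S)"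
    using few unfolding B_def X_def by (intro of_nat_less_iff[THEN iffD2])
  ultimately show False by simp
qed

subsection \<open>Symmetrization with essential suprema over a parameter space\<close>

text \<open>The event that an essential supremum exceeds \<open>t\<close>, written as a failed AE
  bound: bounds for several functions then combine as AE statements, and no supremum has to be
  formed.\<close>

definition ess_gt :: "'p measure \<Rightarrow> real \<Rightarrow> ('p \<Rightarrow> real) \<Rightarrow> bool" where
  "ess_gt \<Theta> t G \<longleftrightarrow> \<not> (AE \<eta> in \<Theta>. \<bar>G \<eta>\<bar> \<le> t)"

text \<open>An AE statement says that a section has measure zero, and by sigma-finiteness the
  measure of a section is a measurable function of the base point.\<close>

lemma (in sigma_finite_measure) pred_AE:
  assumes P: "Measurable.pred (N \<Otimes>\<^sub>M M) (\<lambda>(x, y). P x y)"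
  shows "Measurable.pred N (\<lambda>x. AE y in M. P x y)"
proof -
  have sec: "{y \<in> space M. \<not> P x y} \<in> sets M" if "x \<in> space N" for x
  proof -
    have "Measurable.pred M (\<lambda>y. case (x, y) of (x, y) \<Rightarrow> P x y)"
      by (rule measurable_compose[OF measurable_Pair1'[OF that] P])
    then show ?thesis by simp
  qed
  have "Measurable.pred N (\<lambda>x. emeasure M {y \<in> space M. \<not> P x y} = 0)"
  proof -
    have "{z \<in> space (N \<Otimes>\<^sub>M M). \<not> (case z of (x, y) \<Rightarrow> P x y)} \<in> sets (N \<Otimes>\<^sub>M M)"
      using P by measurable
    then have "(\<lambda>x. emeasure M {y \<in> space M. \<not> P x y}) \<in> borel_measurable N"
      by (intro measurable_emeasure)
        (auto simp: space_pair_measure split_beta' conj_ac elim!: back_subst[of "\<lambda>x. x \<in> sets (N \<Otimes>\<^sub>M M)"])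
    then show ?thesis by measurable
  qed
  then show ?thesis
    by (rule measurable_cong[THEN iffD1, rotated]) (simp add: AE_iff_measurable[OF sec refl])
qed

lemma (in sigma_finite_measure) pred_ess_gt:
  assumes "(\<lambda>(x, \<eta>). g x \<eta>) \<in> borel_measurable (N \<Otimes>\<^sub>M M)"
  shows "Measurable.pred N (\<lambda>x. ess_gt M t (g x))"
  unfolding ess_gt_def
proof (intro pred_intros_logic pred_AE)
  have "Measurable.pred (N \<Otimes>\<^sub>M M) (\<lambda>p. \<bar>case p of (x, \<eta>) \<Rightarrow> g x \<eta>\<bar> \<le> t)"
    using assms by measurable
  then show "Measurable.pred (N \<Otimes>\<^sub>M M) (\<lambda>(x, \<eta>). \<bar>g x \<eta>\<bar> \<le> t)" by (simp add: split_beta')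
qed

text \<open>If \<open>x\<close> exceeds \<open>2 * t\<close> at some \<eta>, an independent copy
  stays within \<open>t\<close> at that \<eta> with probability at least 1/2, and then the
  difference exceeds \<open>t\<close>. The parameter must be chosen from \<open>x\<close> alone,
  before the copy is drawn.\<close>

lemma ess_symmetrization:
  fixes g :: "'p \<Rightarrow> 'x \<Rightarrow> real"
  assumes "prob_space \<Theta>" "prob_space S"
    and g[measurable]: "(\<lambda>(\<eta>, x). g \<eta> x) \<in> borel_measurable (\<Theta> \<Otimes>\<^sub>M S)"
    and half: "\<And>\<eta>. \<eta> \<in> space \<Theta> \<Longrightarrow> \<P>(y in S. \<not> \<bar>g \<eta> y\<bar> \<le> t) \<le> 1 / 2"
  shows "\<P>(x in S. ess_gt \<Theta> (2 * t) (\<lambda>\<eta>. g \<eta> x))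
    \<le> 2 * \<P>(p in S \<Otimes>\<^sub>M S. ess_gt \<Theta> t (\<lambda>\<eta>. g \<eta> (fst p) - g \<eta> (snd p)))"
proof -
  interpret T: prob_space \<Theta> by fact
  interpret S: prob_space S by fact
  interpret TS: pair_prob_space \<Theta> S ..
  interpret ST: pair_prob_space S \<Theta> ..
  interpret SS: pair_prob_space S S ..
  define D where "D = {p\<in>space (S \<Otimes>\<^sub>M S). ess_gt \<Theta> t (\<lambda>\<eta>. g \<eta> (fst p) - g \<eta> (snd p))}"
  define E where "E = {x\<in>space S. ess_gt \<Theta> (2 * t) (\<lambda>\<eta>. g \<eta> x)}"
  have [measurable]: "Measurable.pred (S \<Otimes>\<^sub>M S) (\<lambda>p. ess_gt \<Theta> t (\<lambda>\<eta>. g \<eta> (fst p) - g \<eta> (snd p)))"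
    by (rule T.pred_ess_gt) measurable
  have [measurable]: "Measurable.pred S (\<lambda>x. ess_gt \<Theta> (2 * t) (\<lambda>\<eta>. g \<eta> x))"
    by (rule T.pred_ess_gt) measurable
  have D[measurable]: "D \<in> sets (S \<Otimes>\<^sub>M S)" unfolding D_def by measurable
  have E[measurable]: "E \<in> sets S" unfolding E_def by measurable
  have key: "1 / 2 \<le> measure S (Pair x -` D)" if x: "x \<in> E" for x
  proof -
    have xS[simp]: "x \<in> space S" using x by (simp add: E_def)
    have G[measurable]: "Pair x -` D \<in> sets S" using D by (rule sets_Pair1)
    \<comment> \<open>For a copy \<open>y\<close> outside the difference event the triangle
      inequality works for almost every \<eta>, with a null set depending on \<open>y\<close>.
      Exchanging the quantifiers below makes one \<eta> serve almost all \<open>y\<close>.\<close>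
    have "AE y in S. AE \<eta> in \<Theta>. y \<notin> Pair x -` D \<longrightarrow> 2 * t < \<bar>g \<eta> x\<bar> \<longrightarrow> t < \<bar>g \<eta> y\<bar>"
    proof (rule AE_I2)
      fix y assume y: "y \<in> space S"
      show "AE \<eta> in \<Theta>. y \<notin> Pair x -` D \<longrightarrow> 2 * t < \<bar>g \<eta> x\<bar> \<longrightarrow> t < \<bar>g \<eta> y\<bar>"
      proof (cases "y \<in> Pair x -` D")
        case False
        then have "AE \<eta> in \<Theta>. \<bar>g \<eta> x - g \<eta> y\<bar> \<le> t"
          using x y by (simp add: D_def E_def space_pair_measure ess_gt_def)
        then show ?thesis by eventually_elim linarith
      qed simp
    qed
    moreover have [measurable]: "(\<lambda>\<eta>. g \<eta> x) \<in> borel_measurable \<Theta>"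
      using measurable_compose[OF measurable_Pair2'[OF xS, of \<Theta>] g] by simp
    have [measurable]: "Measurable.pred S (\<lambda>y. y \<in> Pair x -` D)" using G by measurable
    have "{p \<in> space (S \<Otimes>\<^sub>M \<Theta>). fst p \<notin> Pair x -` D \<longrightarrow> 2 * t < \<bar>g (snd p) x\<bar> \<longrightarrow> t < \<bar>g (snd p) (fst p)\<bar>}
        \<in> sets (S \<Otimes>\<^sub>M \<Theta>)" by measurable
    ultimately have "AE \<eta> in \<Theta>. AE y in S. y \<notin> Pair x -` D \<longrightarrow> 2 * t < \<bar>g \<eta> x\<bar> \<longrightarrow> t < \<bar>g \<eta> y\<bar>"
      using ST.AE_commute[of "\<lambda>y \<eta>. y \<notin> Pair x -` D \<longrightarrow> 2 * t < \<bar>g \<eta> x\<bar> \<longrightarrow> t < \<bar>g \<eta> y\<bar>"] by simp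
    \<comment> \<open>A set of parameters that is not null meets every set of full measure, which
      yields the required \<eta>.\<close>
    moreover have "\<exists>\<^sub>F \<eta> in ae_filter \<Theta>. 2 * t < \<bar>g \<eta> x\<bar>"
      using x by (simp add: E_def ess_gt_def frequently_def not_less)
    ultimately have "\<exists>\<^sub>F \<eta> in ae_filter \<Theta>. 2 * t < \<bar>g \<eta> x\<bar> \<and>
        ((AE y in S. y \<notin> Pair x -` D \<longrightarrow> 2 * t < \<bar>g \<eta> x\<bar> \<longrightarrow> t < \<bar>g \<eta> y\<bar>) \<and> \<eta> \<in> space \<Theta>)"
      by (intro frequently_eventually_frequently eventually_conj AE_space)
    then obtain \<eta> where \<eta>: "AE y in S. y \<notin> Pair x -` D \<longrightarrow> t < \<bar>g \<eta> y\<bar>" "\<eta> \<in> space \<Theta>"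
      using frequently_ex by fastforce
    have [measurable]: "g \<eta> \<in> borel_measurable S"
      using measurable_compose[OF measurable_Pair1'[OF \<eta>(2), of S] g] by simp
    have "measure S (space S - Pair x -` D) \<le> \<P>(y in S. \<not> \<bar>g \<eta> y\<bar> \<le> t)"
    proof (rule S.finite_measure_mono_AE)
      show "AE y in S. y \<in> space S - Pair x -` D \<longrightarrow> y \<in> {y\<in>space S. \<not> \<bar>g \<eta> y\<bar> \<le> t}"
        using \<eta>(1) by eventually_elim auto
    qed measurable
    also have "\<dots> \<le> 1 / 2" using half \<eta> by simp
    finally show ?thesis using S.prob_compl[OF G] by simp
  qed
  have half': "(1 / 2 :: ennreal) = ennreal (1 / 2)"
    using divide_ennreal[of 1 2] by simp
  have "1 / 2 * emeasure S E = (\<integral>\<^sup>+x. 1 / 2 * indicator E x \<partial>S)"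
    by (subst nn_integral_cmult_indicator) auto
  also have "\<dots> \<le> (\<integral>\<^sup>+x. emeasure S (Pair x -` D) \<partial>S)"
  proof (rule nn_integral_mono)
    fix x show "1 / 2 * indicator E x \<le> emeasure S (Pair x -` D)"
    proof (cases "x \<in> E")
      case True
      then have "ennreal (1 / 2) \<le> ennreal (measure S (Pair x -` D))"
        using key by (intro ennreal_leI)
      then show ?thesis using True by (simp add: S.emeasure_eq_measure half' del: ennreal_half)
    qed simp
  qed
  also have "\<dots> = emeasure (S \<Otimes>\<^sub>M S) D" by (rule S.emeasure_pair_measure_alt[symmetric, OF D])
  finally have "ennreal (1 / 2 * measure S E) \<le> ennreal (measure (S \<Otimes>\<^sub>M S) D)"
    unfolding half' S.emeasure_eq_measure SS.emeasure_eq_measure by (subst ennreal_mult) auto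
  then show ?thesis unfolding D_def E_def by (subst (asm) ennreal_le_iff) auto
qed

section \<open>Second moments and coordinate exchanges for i.i.d. sequences\<close>

lemma (in sequence_space) indep_coordinates:
  "P.indep_vars (\<lambda>_. M) (\<lambda>i x. x i) (UNIV :: nat set)"
proof -
  have "distr S S (\<lambda>x. \<lambda>i\<in>UNIV. x i) = S" by (simp add: restrict_UNIV distr_id2)
  moreover have "distr S M (\<lambda>x. x i) = M" for i
    by (rule distr_PiM_component) (auto intro: M.prob_space_axioms)
  ultimately show ?thesis
    by (subst P.indep_vars_iff_distr_eq_PiM') auto
qed

lemma (in sequence_space) iid_sum_second_moment:
  fixes g :: "'a \<Rightarrow> real" and c :: "nat \<Rightarrow> real"
  assumes g2: "integrable M (\<lambda>z. (g z)\<^sup>2)" and gm[measurable]: "g \<in> borel_measurable M"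
    and g0: "(\<integral>z. g z \<partial>M) = 0"
  shows "integrable S (\<lambda>x. (\<Sum>i<n. c i * g (x i))\<^sup>2)"
    and "(\<integral>x. (\<Sum>i<n. c i * g (x i))\<^sup>2 \<partial>S) = (\<Sum>i<n. (c i)\<^sup>2) * (\<integral>z. (g z)\<^sup>2 \<partial>M)"
proof -
  have comp: "distr S M (\<lambda>x. x i) = M" for i
    by (rule distr_PiM_component) (auto intro: M.prob_space_axioms)
  have g1: "integrable M g"
    using M.square_integrable_imp_integrable[OF gm] g2 by simp
  have intc: "integrable S (\<lambda>x. f (x i))" "(\<integral>x. f (x i) \<partial>S) = (\<integral>z. f z \<partial>M)"
    if "integrable M f" for f :: "'a \<Rightarrow> real" and i
  proof -
    have "(\<lambda>x. x i) \<in> measurable S M" by simp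
    from integrable_distr_eq[OF this, of f] integral_distr[OF this, of f] that comp[of i]
    show "integrable S (\<lambda>x. f (x i))" "(\<integral>x. f (x i) \<partial>S) = (\<integral>z. f z \<partial>M)" by auto
  qed
  have ind: "P.indep_vars (\<lambda>_. borel) (\<lambda>i x. g (x i)) UNIV"
    using P.indep_vars_compose2[OF indep_coordinates, of "\<lambda>_. g" "\<lambda>_. borel"] by simp
  have cross: "integrable S (\<lambda>x. g (x i) * g (x j)) \<and>
      (\<integral>x. g (x i) * g (x j) \<partial>S) = (if i = j then \<integral>z. (g z)\<^sup>2 \<partial>M else 0)" for i j
  proof (cases "i = j")
    case True
    then show ?thesis using intc[OF g2, of i] by (simp add: power2_eq_square)
  next
    case False
    have i2: "P.indep_vars (\<lambda>_. borel) (\<lambda>i x. g (x i)) {i, j}"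
      by (rule P.indep_vars_subset[OF ind]) simp
    show ?thesis
      using P.indep_vars_lebesgue_integral[OF _ i2] P.indep_vars_integrable[OF _ i2] False
        intc[OF g1] g0 by simp
  qed
  have sq: "(\<Sum>i<n. c i * g (x i))\<^sup>2 = (\<Sum>i<n. \<Sum>j<n. c i * c j * (g (x i) * g (x j)))" for x
    by (simp add: power2_eq_square sum_product mult_ac)
  show "integrable S (\<lambda>x. (\<Sum>i<n. c i * g (x i))\<^sup>2)"
    unfolding sq using cross by (intro Bochner_Integration.integrable_sum integrable_mult_right) auto
  have "(\<integral>x. (\<Sum>i<n. c i * g (x i))\<^sup>2 \<partial>S)
      = (\<Sum>i<n. \<Sum>j<n. c i * c j * (if i = j then \<integral>z. (g z)\<^sup>2 \<partial>M else 0))"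
    unfolding sq using cross
    by (subst Bochner_Integration.integral_sum | simp)+
  then show "(\<integral>x. (\<Sum>i<n. c i * g (x i))\<^sup>2 \<partial>S) = (\<Sum>i<n. (c i)\<^sup>2) * (\<integral>z. (g z)\<^sup>2 \<partial>M)"
    by (simp add: if_distrib[of "\<lambda>x. _ * x"] sum.delta power2_eq_square sum_distrib_right cong: if_cong)
qed

text \<open>The coefficients make room for fixed signs, which do not change the variance.\<close>

lemma (in sequence_space) iid_sum_chebyshev:
  fixes g :: "'a \<Rightarrow> real" and c :: "nat \<Rightarrow> real"
  assumes g2: "integrable M (\<lambda>z. (g z)\<^sup>2)" and gm[measurable]: "g \<in> borel_measurable M"
    and g0: "(\<integral>z. g z \<partial>M) = 0" and v: "(\<integral>z. (g z)\<^sup>2 \<partial>M) \<le> v"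
    and c: "\<And>i. \<bar>c i\<bar> \<le> 1" and t: "0 < t"
  shows "\<P>(x in S. \<not> \<bar>\<Sum>i<n. c i * g (x i)\<bar> \<le> t) \<le> n * v / t\<^sup>2"
proof -
  let ?X = "\<lambda>x. (\<Sum>i<n. c i * g (x i))\<^sup>2"
  have meas[measurable]: "(\<lambda>x. \<Sum>i<n. c i * g (x i)) \<in> borel_measurable S" by measurable
  have "\<P>(x in S. \<not> \<bar>\<Sum>i<n. c i * g (x i)\<bar> \<le> t) \<le> \<P>(x in S. t\<^sup>2 \<le> ?X x)"
    using t by (intro P.finite_measure_mono) (auto simp: not_le intro!: power2_le_iff_abs_le[THEN iffD2] abs_le_square_iff[THEN iffD1])
  also have "\<dots> \<le> (\<integral>x. ?X x \<partial>S) / t\<^sup>2"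
    using iid_sum_second_moment(1)[OF g2 gm g0] t
    by (intro integral_Markov_inequality_measure[where A = "{}"]) auto
  also have "\<dots> \<le> n * v / t\<^sup>2"
  proof -
    have "(\<Sum>i<n. (c i)\<^sup>2) \<le> (\<Sum>i<n. 1)"
      using c by (intro sum_mono) (simp add: abs_square_le_1)
    then have "(\<Sum>i<n. (c i)\<^sup>2) * (\<integral>z. (g z)\<^sup>2 \<partial>M) \<le> n * v"
      using v by (intro mult_mono) auto
    then show ?thesis
      unfolding iid_sum_second_moment(2)[OF g2 gm g0] by (intro divide_right_mono) auto
  qed
  finally show ?thesis .
qed

text \<open>Two independent samples are glued into one sequence, the second starting at position
  \<open>n\<close>. Symmetries of a pair of samples thus become permutations of the coordinates of a
  single product.\<close>

lemma (in sequence_space) measure_comb_seq: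
  assumes Q: "Measurable.pred S Q"
  shows "\<P>(x in S. Q x) = \<P>(p in S \<Otimes>\<^sub>M S. Q (comb_seq n (fst p) (snd p)))"
proof -
  have m: "(\<lambda>(x, y). comb_seq n x y) \<in> measurable (S \<Otimes>\<^sub>M S) S" by (rule measurable_comb_seq)
  have "emeasure (distr (S \<Otimes>\<^sub>M S) S (\<lambda>(x, y). comb_seq n x y)) {x\<in>space S. Q x}
      = emeasure (S \<Otimes>\<^sub>M S) {p\<in>space (S \<Otimes>\<^sub>M S). Q (case p of (x, y) \<Rightarrow> comb_seq n x y)}"
    by (rule emeasure_Collect_distr[OF m Q])
  then show ?thesis unfolding PiM_comb_seq by (simp add: measure_def split_beta')
qed

text \<open>Exchanging the two copies of observation \<open>i\<close> reverses the sign of their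
  difference and preserves the joint law; doing so for all \<open>i\<close> outside \<open>A\<close>
  inserts the signs of \<open>A\<close>.\<close>

lemma (in sequence_space) ess_sum_swap:
  fixes k :: "'p \<Rightarrow> 'a \<Rightarrow> real"
  assumes T: "prob_space \<Theta>" and k[measurable]: "(\<lambda>(\<eta>, z). k \<eta> z) \<in> borel_measurable (\<Theta> \<Otimes>\<^sub>M M)"
  shows "measure (S \<Otimes>\<^sub>M S) {p\<in>space (S \<Otimes>\<^sub>M S).
      ess_gt \<Theta> t (\<lambda>\<eta>. \<Sum>i<n. sgn_in A i * (k \<eta> (fst p i) - k \<eta> (snd p i)))}
    = measure (S \<Otimes>\<^sub>M S) {p\<in>space (S \<Otimes>\<^sub>M S).
      ess_gt \<Theta> t (\<lambda>\<eta>. \<Sum>i<n. k \<eta> (fst p i) - k \<eta> (snd p i))}" (is "?L = ?R")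
proof -
  interpret T: prob_space \<Theta> by fact
  \<comment> \<open>\<open>\<pi>\<close> exchanges positions \<open>i\<close> and
    \<open>i + n\<close> for \<open>i < n\<close> outside \<open>A\<close> and fixes all others; it
    is its own inverse.\<close>
  define \<pi> :: "nat \<Rightarrow> nat" where
    "\<pi> j = (if j < n then (if j \<in> A then j else j + n)
      else if j < 2 * n then (if j - n \<in> A then j else j - n) else j)" for j
  define F where "F B x = ess_gt \<Theta> t (\<lambda>\<eta>. \<Sum>i<n. sgn_in B i * (k \<eta> (x i) - k \<eta> (x (i + n))))"
    for B and x :: "nat \<Rightarrow> 'a"
  have F: "Measurable.pred S (F B)" for B
    unfolding F_def by (rule T.pred_ess_gt) measurable
  have "inj \<pi>"
    by (rule inj_on_inverseI[where g = \<pi>]) (auto simp: \<pi>_def)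
  then have d: "distr S S (\<lambda>x. \<lambda>i\<in>UNIV. x (\<pi> i)) = S"
    using distr_PiM_reindex[of UNIV "\<lambda>_. M" \<pi> UNIV] M.prob_space_axioms by simp
  have mr: "(\<lambda>x i. x (\<pi> i)) \<in> measurable S S"
    by (rule measurable_PiM_single') (auto simp: space_PiM PiE_iff)
  have FA: "F A x = F UNIV (\<lambda>i. x (\<pi> i))" for x
  proof -
    have "(\<Sum>i<n. sgn_in A i * (k \<eta> (x i) - k \<eta> (x (i + n))))
       = (\<Sum>i<n. sgn_in UNIV i * (k \<eta> (x (\<pi> i)) - k \<eta> (x (\<pi> (i + n)))))" for \<eta>
      by (rule sum.cong) (auto simp: \<pi>_def sgn_in_def)
    then show ?thesis by (simp add: F_def)
  qed
  have "?L = \<P>(x in S. F A x)"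
    unfolding measure_comb_seq[OF F[of A], where n = n]
    by (simp add: F_def comb_seq_less comb_seq_add)
  also have "\<dots> = \<P>(x in S. F UNIV x)"
  proof -
    have "emeasure (distr S S (\<lambda>x i. x (\<pi> i))) {x\<in>space S. F UNIV x}
       = emeasure S {x\<in>space S. F UNIV (\<lambda>i. x (\<pi> i))}"
      by (rule emeasure_Collect_distr[OF mr F])
    then show ?thesis using d by (simp add: FA restrict_UNIV measure_def)
  qed
  also have "\<dots> = ?R"
    unfolding measure_comb_seq[OF F[of UNIV], where n = n]
    by (simp add: F_def comb_seq_less comb_seq_add sgn_in_def)
  finally show ?thesis .
qed

text \<open>This lets random signs be treated as a count of patterns for a fixed sample, instead of
  as coordinates of a larger probability space.\<close>

lemma (in prob_space) expectation_card:
  assumes "finite I" and Q[measurable]: "\<And>A. A \<in> I \<Longrightarrow> Measurable.pred M (Q A)"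
  shows "integrable M (\<lambda>x. real (card {A\<in>I. Q A x}))"
    and "expectation (\<lambda>x. real (card {A\<in>I. Q A x})) = (\<Sum>A\<in>I. prob {x\<in>space M. Q A x})"
proof -
  have c: "real (card {A\<in>I. Q A x}) = (\<Sum>A\<in>I. indicator {x\<in>space M. Q A x} x)" if "x \<in> space M" for x
  proof -
    have "(\<Sum>A\<in>I. indicator {x\<in>space M. Q A x} x) = (\<Sum>A\<in>I. if Q A x then 1 else 0 :: real)"
      using that by (intro sum.cong) auto
    then show ?thesis using assms(1) by (simp add: sum.If_cases Int_def)
  qed
  have i: "integrable M (\<lambda>x. indicator {x\<in>space M. Q A x} x :: real)" if "A \<in> I" for A
    using Q[OF that] by (intro integrable_real_indicator) (auto simp: emeasure_eq_measure)
  show "integrable M (\<lambda>x. real (card {A\<in>I. Q A x}))"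
    using i by (subst Bochner_Integration.integrable_cong[OF refl c]) auto
  show "expectation (\<lambda>x. real (card {A\<in>I. Q A x})) = (\<Sum>A\<in>I. prob {x\<in>space M. Q A x})"
    using i by (subst Bochner_Integration.integral_cong[OF refl c])
      (auto simp: Int_absorb2 intro!: sum.cong)
qed

text \<open>The converse of symmetrization: by the triangle inequality one of the two copies must
  exceed \<open>t\<close>, and the union bound costs a factor 2.\<close>

lemma ess_difference:
  fixes g :: "'p \<Rightarrow> 'x \<Rightarrow> real"
  assumes "prob_space \<Theta>" "prob_space S"
    and g[measurable]: "(\<lambda>(\<eta>, x). g \<eta> x) \<in> borel_measurable (\<Theta> \<Otimes>\<^sub>M S)"
  shows "\<P>(p in S \<Otimes>\<^sub>M S. ess_gt \<Theta> (2 * t) (\<lambda>\<eta>. g \<eta> (fst p) - g \<eta> (snd p)))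
    \<le> 2 * \<P>(x in S. ess_gt \<Theta> t (\<lambda>\<eta>. g \<eta> x))"
proof -
  interpret T: prob_space \<Theta> by fact
  interpret S: prob_space S by fact
  interpret SS: pair_prob_space S S ..
  define E where "E = {x\<in>space S. ess_gt \<Theta> t (\<lambda>\<eta>. g \<eta> x)}"
  have [measurable]: "Measurable.pred S (\<lambda>x. ess_gt \<Theta> t (\<lambda>\<eta>. g \<eta> x))"
    by (rule T.pred_ess_gt) measurable
  have E: "E \<in> sets S" unfolding E_def by measurable
  have "{p\<in>space (S \<Otimes>\<^sub>M S). ess_gt \<Theta> (2 * t) (\<lambda>\<eta>. g \<eta> (fst p) - g \<eta> (snd p))}
      \<subseteq> E \<times> space S \<union> space S \<times> E"
  proof (rule subsetI, rule ccontr)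
    fix p assume p: "p \<in> {p\<in>space (S \<Otimes>\<^sub>M S). ess_gt \<Theta> (2 * t) (\<lambda>\<eta>. g \<eta> (fst p) - g \<eta> (snd p))}"
      and np: "p \<notin> E \<times> space S \<union> space S \<times> E"
    obtain x y where "p = (x, y)" by (cases p)
    with p np have xy: "x \<in> space S" "y \<in> space S" "x \<notin> E" "y \<notin> E"
      and gt: "ess_gt \<Theta> (2 * t) (\<lambda>\<eta>. g \<eta> x - g \<eta> y)"
      by (auto simp: space_pair_measure)
    then have "AE \<eta> in \<Theta>. \<bar>g \<eta> x\<bar> \<le> t" "AE \<eta> in \<Theta>. \<bar>g \<eta> y\<bar> \<le> t"
      by (auto simp: E_def ess_gt_def space_pair_measure)
    then have "AE \<eta> in \<Theta>. \<bar>g \<eta> x - g \<eta> y\<bar> \<le> 2 * t" by eventually_elim linarith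
    with gt show False by (simp add: ess_gt_def)
  qed
  then have "\<P>(p in S \<Otimes>\<^sub>M S. ess_gt \<Theta> (2 * t) (\<lambda>\<eta>. g \<eta> (fst p) - g \<eta> (snd p)))
      \<le> measure (S \<Otimes>\<^sub>M S) (E \<times> space S \<union> space S \<times> E)"
    using E by (intro SS.finite_measure_mono) auto
  also have "\<dots> \<le> measure (S \<Otimes>\<^sub>M S) (E \<times> space S) + measure (S \<Otimes>\<^sub>M S) (space S \<times> E)"
    using E by (intro measure_subadditive) (auto simp: SS.emeasure_eq_measure)
  also have "\<dots> = 2 * measure S E"
    using E by (simp add: measure_def S.emeasure_pair_measure_Times S.emeasure_space_1)
  finally show ?thesis by (simp add: E_def)
qed

text \<open>The condition \<open>t_var\<close> makes Chebyshev's bound at level \<open>2 * t\<close>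
  at most 1/2, which is what symmetrization demands at each single parameter.\<close>

locale centered_class = sequence_space M + T: prob_space \<Theta>
  for M :: "'a measure" and \<Theta> :: "'p measure" +
  fixes k :: "'p \<Rightarrow> 'a \<Rightarrow> real" and v t :: real and n :: nat
  assumes k_measurable[measurable]: "(\<lambda>(\<eta>, z). k \<eta> z) \<in> borel_measurable (\<Theta> \<Otimes>\<^sub>M M)"
    and k_sq: "\<And>\<eta>. \<eta> \<in> space \<Theta> \<Longrightarrow> integrable M (\<lambda>z. (k \<eta> z)\<^sup>2)"
    and k_mean: "\<And>\<eta>. \<eta> \<in> space \<Theta> \<Longrightarrow> (\<integral>z. k \<eta> z \<partial>M) = 0"
    and k_var: "\<And>\<eta>. \<eta> \<in> space \<Theta> \<Longrightarrow> (\<integral>z. (k \<eta> z)\<^sup>2 \<partial>M) \<le> v"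
    and t_pos: "0 < t" and t_var: "n * v \<le> 2 * t\<^sup>2"
begin

text \<open>The one uniform quantity that the hypotheses will control. All bounds below are absolute
  multiples of it.\<close>

definition tau :: real where
  "tau = \<P>(x in S. ess_gt \<Theta> t (\<lambda>\<eta>. \<Sum>i<n. k \<eta> (x i)))"

lemma k_section: "\<eta> \<in> space \<Theta> \<Longrightarrow> k \<eta> \<in> borel_measurable M"
  using measurable_compose[OF measurable_Pair1'[of \<eta> \<Theta> M] k_measurable] by simp

text \<open>Symmetrization halves the level \<open>4 * t\<close>, the signs disappear by exchanging
  copies, and desymmetrization halves the level again; each of the two passages costs a factor
  2.\<close>

lemma ess_sign_sum_le:
  "\<P>(x in S. ess_gt \<Theta> (4 * t) (\<lambda>\<eta>. \<Sum>i<n. sgn_in A i * k \<eta> (x i))) \<le> 4 * tau"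
proof -
  have "\<P>(x in S. ess_gt \<Theta> (2 * (2 * t)) (\<lambda>\<eta>. \<Sum>i<n. sgn_in A i * k \<eta> (x i)))
    \<le> 2 * \<P>(p in S \<Otimes>\<^sub>M S. ess_gt \<Theta> (2 * t)
        (\<lambda>\<eta>. (\<Sum>i<n. sgn_in A i * k \<eta> (fst p i)) - (\<Sum>i<n. sgn_in A i * k \<eta> (snd p i))))"
  proof (rule ess_symmetrization[OF T.prob_space_axioms P.prob_space_axioms])
    show "(\<lambda>(\<eta>, x). \<Sum>i<n. sgn_in A i * k \<eta> (x i)) \<in> borel_measurable (\<Theta> \<Otimes>\<^sub>M S)" by measurable
    fix \<eta> assume \<eta>: "\<eta> \<in> space \<Theta>"
    have "\<P>(y in S. \<not> \<bar>\<Sum>i<n. sgn_in A i * k \<eta> (y i)\<bar> \<le> 2 * t) \<le> n * v / (2 * t)\<^sup>2"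
      using \<eta> k_sq k_mean k_var t_pos k_section by (intro iid_sum_chebyshev) auto
    also have "\<dots> \<le> 1 / 2" using t_var t_pos by (simp add: field_simps power2_eq_square)
    finally show "\<P>(y in S. \<not> \<bar>\<Sum>i<n. sgn_in A i * k \<eta> (y i)\<bar> \<le> 2 * t) \<le> 1 / 2" .
  qed
  also have "\<dots> = 2 * \<P>(p in S \<Otimes>\<^sub>M S. ess_gt \<Theta> (2 * t)
        (\<lambda>\<eta>. (\<Sum>i<n. k \<eta> (fst p i)) - (\<Sum>i<n. k \<eta> (snd p i))))"
    using ess_sum_swap[OF T.prob_space_axioms k_measurable, of "2 * t" A n]
    by (simp add: sum_subtractf right_diff_distrib)
  also have "\<dots> \<le> 2 * (2 * \<P>(x in S. ess_gt \<Theta> t (\<lambda>\<eta>. \<Sum>i<n. k \<eta> (x i))))"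
    by (intro mult_left_mono ess_difference T.prob_space_axioms P.prob_space_axioms) auto
  finally show ?thesis by (simp add: tau_def)
qed

lemma sign_card_expectation:
  "P.expectation (\<lambda>x. real (card {A\<in>Pow {..<n}. ess_gt \<Theta> (4 * t) (\<lambda>\<eta>. \<Sum>i<n. sgn_in A i * k \<eta> (x i))}))
    \<le> 2 ^ n * (4 * tau)"
  and sign_card_integrable:
  "integrable S (\<lambda>x. real (card {A\<in>Pow {..<n}. ess_gt \<Theta> (4 * t) (\<lambda>\<eta>. \<Sum>i<n. sgn_in A i * k \<eta> (x i))}))"
proof -
  have Q: "Measurable.pred S (\<lambda>x. ess_gt \<Theta> (4 * t) (\<lambda>\<eta>. \<Sum>i<n. sgn_in A i * k \<eta> (x i)))" for A
    by (rule T.pred_ess_gt) measurable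
  note e = P.expectation_card[of "Pow {..<n}"
      "\<lambda>A x. ess_gt \<Theta> (4 * t) (\<lambda>\<eta>. \<Sum>i<n. sgn_in A i * k \<eta> (x i))", OF _ Q]
  show "integrable S (\<lambda>x. real (card {A\<in>Pow {..<n}. ess_gt \<Theta> (4 * t) (\<lambda>\<eta>. \<Sum>i<n. sgn_in A i * k \<eta> (x i))}))"
    using e(1) by simp
  have "(\<Sum>A\<in>Pow {..<n}. \<P>(x in S. ess_gt \<Theta> (4 * t) (\<lambda>\<eta>. \<Sum>i<n. sgn_in A i * k \<eta> (x i))))
      \<le> (\<Sum>A\<in>Pow {..<n}. 4 * tau)"
    by (intro sum_mono ess_sign_sum_le)
  then show "P.expectation (\<lambda>x. real (card {A\<in>Pow {..<n}. ess_gt \<Theta> (4 * t) (\<lambda>\<eta>. \<Sum>i<n. sgn_in A i * k \<eta> (x i))}))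
    \<le> 2 ^ n * (4 * tau)"
    using e(2) by (simp add: card_Pow)
qed

text \<open>The level is \<open>2 * (4 * t)\<^sup>2\<close> from the Paley-Zygmund step. The factor
  is 12 times 4: the expected number of bad patterns is at most \<open>2 ^ n * (4 * tau)\<close>,
  and Markov's inequality is applied at \<open>2 ^ n / 12\<close>.\<close>

lemma ess_sum_squares_le:
  "\<P>(x in S. ess_gt \<Theta> (32 * t\<^sup>2) (\<lambda>\<eta>. \<Sum>i<n. (k \<eta> (x i))\<^sup>2)) \<le> 48 * tau"
proof -
  let ?c = "\<lambda>x. card {A\<in>Pow {..<n}. ess_gt \<Theta> (4 * t) (\<lambda>\<eta>. \<Sum>i<n. sgn_in A i * k \<eta> (x i))}"
  have [measurable]: "(\<lambda>x. real (?c x)) \<in> borel_measurable S"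
    using sign_card_integrable by (rule borel_measurable_integrable)
  have "{x\<in>space S. ess_gt \<Theta> (32 * t\<^sup>2) (\<lambda>\<eta>. \<Sum>i<n. (k \<eta> (x i))\<^sup>2)} \<subseteq> {x\<in>space S. 2 ^ n / 12 \<le> real (?c x)}"
  proof (clarify, rule ccontr)
    fix x assume gt: "ess_gt \<Theta> (32 * t\<^sup>2) (\<lambda>\<eta>. \<Sum>i<n. (k \<eta> (x i))\<^sup>2)" and "\<not> 2 ^ n / 12 \<le> real (?c x)"
    then have "real (12 * ?c x) < real (2 ^ n)" by simp
    then have few: "12 * ?c x < 2 ^ n" by (rule of_nat_less_iff[THEN iffD1])
    \<comment> \<open>Outside one null set every pattern that is bad at \<eta> is counted in
      \<open>?c x\<close>, so this count bounds the bad patterns simultaneously for almost every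
      parameter.\<close>
    have "AE \<eta> in \<Theta>. \<forall>A\<in>Pow {..<n} - {A\<in>Pow {..<n}. ess_gt \<Theta> (4 * t) (\<lambda>\<eta>. \<Sum>i<n. sgn_in A i * k \<eta> (x i))}.
        \<bar>\<Sum>i<n. sgn_in A i * k \<eta> (x i)\<bar> \<le> 4 * t"
      by (intro AE_finite_allI) (auto simp: ess_gt_def)
    then have "AE \<eta> in \<Theta>. \<bar>\<Sum>i<n. (k \<eta> (x i))\<^sup>2\<bar> \<le> 32 * t\<^sup>2"
    proof eventually_elim
      case (elim \<eta>)
      have "{A\<in>Pow {..<n}. \<not> \<bar>\<Sum>i<n. sgn_in A i * k \<eta> (x i)\<bar> \<le> 4 * t}
          \<subseteq> {A\<in>Pow {..<n}. ess_gt \<Theta> (4 * t) (\<lambda>\<eta>. \<Sum>i<n. sgn_in A i * k \<eta> (x i))}"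
        using elim by blast
      then have "card {A\<in>Pow {..<n}. \<not> \<bar>\<Sum>i<n. sgn_in A i * k \<eta> (x i)\<bar> \<le> 4 * t} \<le> ?c x"
        by (intro card_mono) auto
      then have "(\<Sum>i<n. (k \<eta> (x i))\<^sup>2) \<le> 2 * (4 * t)\<^sup>2"
        using few t_pos by (intro sum_squares_le_of_sign_sums) auto
      then show ?case by (simp add: abs_of_nonneg sum_nonneg power_mult_distrib)
    qed
    with gt show False by (simp add: ess_gt_def)
  qed
  then have "\<P>(x in S. ess_gt \<Theta> (32 * t\<^sup>2) (\<lambda>\<eta>. \<Sum>i<n. (k \<eta> (x i))\<^sup>2))
      \<le> \<P>(x in S. 2 ^ n / 12 \<le> real (?c x))"
    by (intro P.finite_measure_mono) measurable
  also have "\<dots> \<le> P.expectation (\<lambda>x. real (?c x)) / (2 ^ n / 12)"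
    by (intro integral_Markov_inequality_measure[where A = "{}"] sign_card_integrable) auto
  also have "\<dots> \<le> (2 ^ n * (4 * tau)) / (2 ^ n / 12)"
    by (intro divide_right_mono sign_card_expectation) auto
  finally show ?thesis by simp
qed

text \<open>Signs are inserted, the multiplier is removed by contraction for each fixed sample, and
  the remaining sign sums are bounded by \<open>tau\<close>. The factor 32 is 2 from symmetrization,
  2 from desymmetrization, 2 from contraction and 4 from \<open>ess_sign_sum_le\<close>; the level
  drops from \<open>16 * C * t\<close> to \<open>C * (4 * t)\<close>.\<close>

lemma ess_multiplier_le:
  assumes \<phi>[measurable]: "\<phi> \<in> borel_measurable M" and bd: "AE z in M. 0 \<le> \<phi> z \<and> \<phi> z \<le> C" and C: "0 < C"
  shows "\<P>(x in S. ess_gt \<Theta> (16 * C * t)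
      (\<lambda>\<eta>. \<Sum>i<n. \<phi> (x i) * k \<eta> (x i) - (\<integral>z. \<phi> z * k \<eta> z \<partial>M))) \<le> 32 * tau"
proof -
  define m where "m \<eta> = (\<integral>z. \<phi> z * k \<eta> z \<partial>M)" for \<eta>
  have [measurable]: "m \<in> borel_measurable \<Theta>"
    unfolding m_def by (rule M.borel_measurable_lebesgue_integral) measurable
  have eq16: "2 * (8 * C * t) = 16 * C * t" by simp
  have "\<P>(x in S. ess_gt \<Theta> (2 * (8 * C * t)) (\<lambda>\<eta>. \<Sum>i<n. \<phi> (x i) * k \<eta> (x i) - m \<eta>))
    \<le> 2 * \<P>(p in S \<Otimes>\<^sub>M S. ess_gt \<Theta> (8 * C * t)
        (\<lambda>\<eta>. (\<Sum>i<n. \<phi> (fst p i) * k \<eta> (fst p i) - m \<eta>) - (\<Sum>i<n. \<phi> (snd p i) * k \<eta> (snd p i) - m \<eta>)))"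
  proof (rule ess_symmetrization[OF T.prob_space_axioms P.prob_space_axioms])
    have "(\<lambda>p. \<Sum>i<n. \<phi> (snd p i) * k (fst p) (snd p i) - m (fst p)) \<in> borel_measurable (\<Theta> \<Otimes>\<^sub>M S)"
      by measurable
    then show "(\<lambda>(\<eta>, x). \<Sum>i<n. \<phi> (x i) * k \<eta> (x i) - m \<eta>) \<in> borel_measurable (\<Theta> \<Otimes>\<^sub>M S)"
      by (simp add: split_beta')
    fix \<eta> assume \<eta>: "\<eta> \<in> space \<Theta>"
    have [measurable]: "k \<eta> \<in> borel_measurable M" using \<eta> by (rule k_section)
    have sqb: "AE z in M. (\<phi> z * k \<eta> z)\<^sup>2 \<le> C\<^sup>2 * (k \<eta> z)\<^sup>2"
      using bd by eventually_elim (simp add: power_mult_distrib mult_right_mono power_mono)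
    have i2: "integrable M (\<lambda>z. (\<phi> z * k \<eta> z)\<^sup>2)"
    proof (rule Bochner_Integration.integrable_bound)
      show "integrable M (\<lambda>z. C\<^sup>2 * (k \<eta> z)\<^sup>2)" using k_sq[OF \<eta>] by simp
      show "AE z in M. norm ((\<phi> z * k \<eta> z)\<^sup>2) \<le> norm (C\<^sup>2 * (k \<eta> z)\<^sup>2)"
        using sqb by eventually_elim simp
    qed measurable
    have i1: "integrable M (\<lambda>z. \<phi> z * k \<eta> z)"
      by (rule M.square_integrable_imp_integrable[OF _ i2]) measurable
    \<comment> \<open>The product need not have mean zero although \<open>k \<eta>\<close> does;
      subtracting its mean only lowers the second moment.\<close>
    have "(\<integral>z. (\<phi> z * k \<eta> z - m \<eta>)\<^sup>2 \<partial>M) = (\<integral>z. (\<phi> z * k \<eta> z)\<^sup>2 \<partial>M) - (m \<eta>)\<^sup>2"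
      unfolding m_def using M.variance_eq[OF i1 i2] by simp
    also have "\<dots> \<le> (\<integral>z. (\<phi> z * k \<eta> z)\<^sup>2 \<partial>M)" by simp
    also have "\<dots> \<le> (\<integral>z. C\<^sup>2 * (k \<eta> z)\<^sup>2 \<partial>M)"
      using k_sq[OF \<eta>] by (intro integral_mono_AE[OF i2 _ sqb]) simp
    also have "\<dots> \<le> C\<^sup>2 * v" using k_var[OF \<eta>] by (simp add: mult_left_mono)
    finally have var: "(\<integral>z. (\<phi> z * k \<eta> z - m \<eta>)\<^sup>2 \<partial>M) \<le> C\<^sup>2 * v" .
    have "\<P>(y in S. \<not> \<bar>\<Sum>i<n. 1 * (\<phi> (y i) * k \<eta> (y i) - m \<eta>)\<bar> \<le> 8 * C * t)
        \<le> n * (C\<^sup>2 * v) / (8 * C * t)\<^sup>2"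
    proof (rule iid_sum_chebyshev)
      show "integrable M (\<lambda>z. (\<phi> z * k \<eta> z - m \<eta>)\<^sup>2)"
        using i1 i2 by (simp add: power2_diff)
      show "(\<integral>z. \<phi> z * k \<eta> z - m \<eta> \<partial>M) = 0" using i1 by (simp add: m_def M.prob_space)
    qed (use var C t_pos \<eta> in auto)
    also have "\<dots> = n * v / (64 * t\<^sup>2)" using C by (simp add: power2_eq_square)
    also have "\<dots> \<le> 1 / 2"
    proof -
      have "n * v \<le> 32 * t\<^sup>2" using t_var zero_le_power2[of t] by linarith
      then show ?thesis using t_pos by (simp add: field_simps)
    qed
    finally show "\<P>(y in S. \<not> \<bar>\<Sum>i<n. \<phi> (y i) * k \<eta> (y i) - m \<eta>\<bar> \<le> 8 * C * t) \<le> 1 / 2"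
      by simp
  qed
  also have "\<dots> = 2 * \<P>(p in S \<Otimes>\<^sub>M S. ess_gt \<Theta> (8 * C * t)
        (\<lambda>\<eta>. \<Sum>i<n. \<phi> (fst p i) * k \<eta> (fst p i) - \<phi> (snd p i) * k \<eta> (snd p i)))"
    by (simp add: sum_subtractf)
  finally have first: "\<P>(x in S. ess_gt \<Theta> (16 * C * t) (\<lambda>\<eta>. \<Sum>i<n. \<phi> (x i) * k \<eta> (x i) - m \<eta>))
    \<le> 2 * \<P>(p in S \<Otimes>\<^sub>M S. ess_gt \<Theta> (8 * C * t)
        (\<lambda>\<eta>. \<Sum>i<n. \<phi> (fst p i) * k \<eta> (fst p i) - \<phi> (snd p i) * k \<eta> (snd p i)))" unfolding eq16 .
  define \<Psi> where "\<Psi> A x = ess_gt \<Theta> (C * (4 * t)) (\<lambda>\<eta>. \<Sum>i<n. sgn_in A i * (\<phi> (x i) * k \<eta> (x i)))"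
    for A and x :: "nat \<Rightarrow> 'a"
  \<comment> \<open>The pattern \<open>A\<close> is fixed but arbitrary, so the bound can be
    averaged over all patterns, where contraction applies.\<close>
  have each: "\<P>(x in S. ess_gt \<Theta> (16 * C * t) (\<lambda>\<eta>. \<Sum>i<n. \<phi> (x i) * k \<eta> (x i) - m \<eta>))
      \<le> 4 * \<P>(x in S. \<Psi> A x)" for A
  proof -
    have "\<P>(p in S \<Otimes>\<^sub>M S. ess_gt \<Theta> (8 * C * t)
        (\<lambda>\<eta>. \<Sum>i<n. \<phi> (fst p i) * k \<eta> (fst p i) - \<phi> (snd p i) * k \<eta> (snd p i)))
      = \<P>(p in S \<Otimes>\<^sub>M S. ess_gt \<Theta> (8 * C * t)
        (\<lambda>\<eta>. \<Sum>i<n. sgn_in A i * (\<phi> (fst p i) * k \<eta> (fst p i) - \<phi> (snd p i) * k \<eta> (snd p i))))"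
      by (rule ess_sum_swap[OF T.prob_space_axioms, of "\<lambda>\<eta> z. \<phi> z * k \<eta> z", symmetric]) measurable
    also have "\<dots> = \<P>(p in S \<Otimes>\<^sub>M S. ess_gt \<Theta> (2 * (C * (4 * t)))
        (\<lambda>\<eta>. (\<Sum>i<n. sgn_in A i * (\<phi> (fst p i) * k \<eta> (fst p i)))
          - (\<Sum>i<n. sgn_in A i * (\<phi> (snd p i) * k \<eta> (snd p i)))))"
      by (simp add: sum_subtractf right_diff_distrib mult.assoc)
    also have "\<dots> \<le> 2 * \<P>(x in S. \<Psi> A x)"
      unfolding \<Psi>_def by (intro ess_difference T.prob_space_axioms P.prob_space_axioms) measurable
    finally show ?thesis using first by simp
  qed
  have Q: "Measurable.pred S (\<Psi> A)" for A
    unfolding \<Psi>_def by (rule T.pred_ess_gt) measurable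
  note e = P.expectation_card[of "Pow {..<n}" \<Psi>, OF _ Q, simplified]
  have "AE z in S. \<forall>i. 0 \<le> \<phi> (z i) \<and> \<phi> (z i) \<le> C"
    using bd unfolding AE_all_countable by (auto intro: AE_component)
  then have ae: "AE x in S. real (card {A\<in>Pow {..<n}. \<Psi> A x})
      \<le> 2 * real (card {A\<in>Pow {..<n}. ess_gt \<Theta> (4 * t) (\<lambda>\<eta>. \<Sum>i<n. sgn_in A i * k \<eta> (x i))})"
  proof eventually_elim
    case (elim x)
    show ?case
      using sign_contraction[where S = "{..<n}" and c = "\<lambda>i. \<phi> (x i)" and m = C and t = "4 * t"
          and \<Theta> = \<Theta> and v = "\<lambda>i \<eta>. k \<eta> (x i)"] elim C t_pos
      unfolding \<Psi>_def ess_gt_def by simp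
  qed
  have "2 ^ n * \<P>(x in S. ess_gt \<Theta> (16 * C * t) (\<lambda>\<eta>. \<Sum>i<n. \<phi> (x i) * k \<eta> (x i) - m \<eta>))
      = (\<Sum>A\<in>Pow {..<n}. \<P>(x in S. ess_gt \<Theta> (16 * C * t) (\<lambda>\<eta>. \<Sum>i<n. \<phi> (x i) * k \<eta> (x i) - m \<eta>)))"
    by (simp add: card_Pow)
  also have "\<dots> \<le> (\<Sum>A\<in>Pow {..<n}. 4 * \<P>(x in S. \<Psi> A x))"
    by (intro sum_mono each)
  also have "\<dots> = 4 * P.expectation (\<lambda>x. real (card {A\<in>Pow {..<n}. \<Psi> A x}))"
    using e(2) by (simp add: sum_distrib_left)
  also have "\<dots> \<le> 4 * P.expectation (\<lambda>x. 2 * real (card {A\<in>Pow {..<n}. ess_gt \<Theta> (4 * t) (\<lambda>\<eta>. \<Sum>i<n. sgn_in A i * k \<eta> (x i))}))"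
    using ae e(1) sign_card_integrable by (intro mult_left_mono integral_mono_AE) auto
  also have "\<dots> \<le> 4 * (2 * (2 ^ n * (4 * tau)))"
    using sign_card_expectation by simp
  finally show ?thesis unfolding m_def by simp
qed

lemma ess_multiplier_sets:
  assumes \<phi>[measurable]: "\<phi> \<in> borel_measurable M"
  shows "{x\<in>space S. ess_gt \<Theta> u (\<lambda>\<eta>. \<Sum>i<n. \<phi> (x i) * k \<eta> (x i) - (\<integral>z. \<phi> z * k \<eta> z \<partial>M))} \<in> sets S"
proof -
  have "Measurable.pred S (\<lambda>x. ess_gt \<Theta> u (\<lambda>\<eta>. \<Sum>i<n. \<phi> (x i) * k \<eta> (x i) - m \<eta>))"
    if [measurable]: "m \<in> borel_measurable \<Theta>" for m
    by (rule T.pred_ess_gt) measurable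
  moreover have "(\<lambda>\<eta>. \<integral>z. \<phi> z * k \<eta> z \<partial>M) \<in> borel_measurable \<Theta>"
    by (rule M.borel_measurable_lebesgue_integral) measurable
  ultimately show ?thesis by measurable
qed

lemma ess_sum_squares_sets:
  "{x\<in>space S. ess_gt \<Theta> u (\<lambda>\<eta>. \<Sum>i<n. (k \<eta> (x i))\<^sup>2)} \<in> sets S"
proof -
  have "Measurable.pred S (\<lambda>x. ess_gt \<Theta> u (\<lambda>\<eta>. \<Sum>i<n. (k \<eta> (x i))\<^sup>2))"
    by (rule T.pred_ess_gt) measurable
  then show ?thesis by measurable
qed

lemma ess_sum_sets:
  "{x\<in>space S. ess_gt \<Theta> u (\<lambda>\<eta>. \<Sum>i<n. k \<eta> (x i))} \<in> sets S"
proof -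
  have "Measurable.pred S (\<lambda>x. ess_gt \<Theta> u (\<lambda>\<eta>. \<Sum>i<n. k \<eta> (x i)))"
    by (rule T.pred_ess_gt) measurable
  then show ?thesis by measurable
qed

end

subsection \<open>Bounded Lipschitz distance and moment generating functions\<close>

lemma abs_lipschitz_diff_le:
  fixes h :: "real \<Rightarrow> real"
  assumes "1-lipschitz_on UNIV h"
  shows "\<bar>h x - h y\<bar> \<le> \<bar>x - y\<bar>"
  using lipschitz_onD[OF assms, of x y] by (simp add: dist_real_def)

lemma borel_measurable_lipschitz:
  fixes h :: "real \<Rightarrow> real"
  assumes "1-lipschitz_on UNIV h"
  shows "h \<in> borel_measurable borel"
  by (rule borel_measurable_continuous_onI) (rule lipschitz_on_continuous_on[OF assms])

lemma bl_dist_le: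
  assumes "\<And>h. (\<And>x. \<bar>h x\<bar> \<le> 1) \<Longrightarrow> 1-lipschitz_on UNIV h \<Longrightarrow> \<bar>(\<integral>x. h x \<partial>\<mu>) - (\<integral>x. h x \<partial>\<nu>)\<bar> \<le> c"
  shows "bl_dist \<mu> \<nu> \<le> c"
  unfolding bl_dist_def
proof (rule cSUP_least)
  have "(\<lambda>_. 0 :: real) \<in> {h :: real \<Rightarrow> real. (\<forall>x. \<bar>h x\<bar> \<le> 1) \<and> 1-lipschitz_on UNIV h}"
    by (auto simp: lipschitz_on_def)
  then show "{h :: real \<Rightarrow> real. (\<forall>x. \<bar>h x\<bar> \<le> 1) \<and> 1-lipschitz_on UNIV h} \<noteq> {}" by (metis empty_iff)
qed (use assms in auto)

lemma (in real_distribution) abs_integral_le_one: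
  assumes "\<And>x. \<bar>h x\<bar> \<le> (1 :: real)" "h \<in> borel_measurable borel"
  shows "integrable M h" "\<bar>\<integral>x. h x \<partial>M\<bar> \<le> 1"
proof -
  have p1: "prob UNIV = 1" using prob_space by simp
  show i: "integrable M h"
    using assms by (intro integrable_const_bound[of _ 1]) auto
  have "\<bar>\<integral>x. h x \<partial>M\<bar> \<le> (\<integral>x. \<bar>h x\<bar> \<partial>M)" by (rule integral_abs_bound)
  also have "\<dots> \<le> (\<integral>x. 1 \<partial>M)" using i assms by (intro integral_mono) auto
  finally show "\<bar>\<integral>x. h x \<partial>M\<bar> \<le> 1" by (simp add: p1)
qed

text \<open>The bounded Lipschitz distance is a supremum in the reals, which dominates its members
  only once the set is known to be bounded.\<close>

lemma bl_class_bdd_above: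
  assumes "real_distribution \<mu>" "real_distribution \<nu>"
  shows "bdd_above ((\<lambda>h. \<bar>(\<integral>x. h x \<partial>\<mu>) - (\<integral>x. h x \<partial>\<nu>)\<bar>) `
    {h :: real \<Rightarrow> real. (\<forall>x. \<bar>h x\<bar> \<le> 1) \<and> 1-lipschitz_on UNIV h})"
proof (rule bdd_aboveI)
  interpret A: real_distribution \<mu> by fact
  interpret B: real_distribution \<nu> by fact
  fix y assume "y \<in> (\<lambda>h. \<bar>(\<integral>x. h x \<partial>\<mu>) - (\<integral>x. h x \<partial>\<nu>)\<bar>) ` {h :: real \<Rightarrow> real. (\<forall>x. \<bar>h x\<bar> \<le> 1) \<and> 1-lipschitz_on UNIV h}"
  then obtain h :: "real \<Rightarrow> real" where "\<And>x. \<bar>h x\<bar> \<le> 1" "1-lipschitz_on UNIV h"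
    "y = \<bar>(\<integral>x. h x \<partial>\<mu>) - (\<integral>x. h x \<partial>\<nu>)\<bar>" by auto
  then show "y \<le> 2"
    using A.abs_integral_le_one(2)[of h] B.abs_integral_le_one(2)[of h] borel_measurable_lipschitz[of h]
    by auto
qed

lemma bl_dist_nonneg:
  assumes "real_distribution \<mu>" "real_distribution \<nu>"
  shows "0 \<le> bl_dist \<mu> \<nu>"
proof -
  have "\<bar>(\<integral>x. 0 \<partial>\<mu>) - (\<integral>x. 0 \<partial>\<nu>)\<bar> \<le> bl_dist \<mu> \<nu>"
    unfolding bl_dist_def
    by (rule cSUP_upper[OF _ bl_class_bdd_above[OF assms]]) (auto simp: lipschitz_on_def)
  then show ?thesis by simp
qed

text \<open>Skorohod's representation puts converging copies on one space. There
  \<open>min 2 \<bar>Ys n x - Y x\<bar>\<close> dominates the difference for all test functions at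
  once, and dominated convergence applies.\<close>

lemma bl_dist_tendsto_0:
  assumes \<mu>: "\<And>n. real_distribution (\<mu> n)" and M: "real_distribution M" and w: "weak_conv_m \<mu> M"
  shows "(\<lambda>n. bl_dist (\<mu> n) M) \<longlonglongrightarrow> 0"
proof -
  obtain \<Omega> :: "real measure" and Ys Y where "prob_space \<Omega>"
    and Ys[measurable]: "\<And>n. Ys n \<in> borel_measurable \<Omega>" and dYs: "\<And>n. distr \<Omega> borel (Ys n) = \<mu> n"
    and Y: "Y \<in> measurable \<Omega> lborel" and dY: "distr \<Omega> borel Y = M"
    and lim: "\<And>x. x \<in> space \<Omega> \<Longrightarrow> (\<lambda>n. Ys n x) \<longlonglongrightarrow> Y x"
    using Skorohod[OF \<mu> M w] by blast
  interpret \<Omega>: prob_space \<Omega> by fact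
  have Y[measurable]: "Y \<in> borel_measurable \<Omega>" using Y by (simp add: measurable_lborel1)
  define d where "d n = (\<integral>x. min 2 \<bar>Ys n x - Y x\<bar> \<partial>\<Omega>)" for n
  have di: "integrable \<Omega> (\<lambda>x. min 2 \<bar>Ys n x - Y x\<bar>)" for n
    by (rule \<Omega>.integrable_const_bound[of _ 2]) auto
  have "d \<longlonglongrightarrow> (\<integral>x. 0 \<partial>\<Omega>)"
    unfolding d_def
  proof (rule integral_dominated_convergence[where w = "\<lambda>_. 2"])
    show "AE x in \<Omega>. (\<lambda>n. min 2 \<bar>Ys n x - Y x\<bar>) \<longlonglongrightarrow> 0"
    proof (rule AE_I2)
      fix x assume "x \<in> space \<Omega>"
      then have "(\<lambda>n. min 2 \<bar>Ys n x - Y x\<bar>) \<longlonglongrightarrow> min 2 \<bar>Y x - Y x\<bar>"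
        by (intro tendsto_intros lim)
      then show "(\<lambda>n. min 2 \<bar>Ys n x - Y x\<bar>) \<longlonglongrightarrow> 0" by simp
    qed
  qed auto
  then have d0: "d \<longlonglongrightarrow> 0" by simp
  have le: "bl_dist (\<mu> n) M \<le> d n" for n
  proof (rule bl_dist_le)
    fix h :: "real \<Rightarrow> real" assume h: "\<And>x. \<bar>h x\<bar> \<le> 1" "1-lipschitz_on UNIV h"
    have [measurable]: "h \<in> borel_measurable borel" using h(2) by (rule borel_measurable_lipschitz)
    have i: "integrable \<Omega> (\<lambda>x. h (Ys n x))" "integrable \<Omega> (\<lambda>x. h (Y x))"
      using h by (auto intro!: \<Omega>.integrable_const_bound[of _ 1])
    have "(\<integral>x. h x \<partial>\<mu> n) - (\<integral>x. h x \<partial>M) = (\<integral>x. h (Ys n x) - h (Y x) \<partial>\<Omega>)"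
      unfolding dYs[symmetric] dY[symmetric] using i by (simp add: integral_distr)
    also have "\<bar>\<dots>\<bar> \<le> (\<integral>x. \<bar>h (Ys n x) - h (Y x)\<bar> \<partial>\<Omega>)" by (rule integral_abs_bound)
    also have "\<dots> \<le> d n"
      unfolding d_def
    proof (rule integral_mono)
      show "\<bar>h (Ys n x) - h (Y x)\<bar> \<le> min 2 \<bar>Ys n x - Y x\<bar>" for x
        using abs_lipschitz_diff_le[OF h(2), of "Ys n x" "Y x"] h(1)[of "Ys n x"] h(1)[of "Y x"]
        by linarith
    qed (use i di in auto)
    finally show "\<bar>(\<integral>x. h x \<partial>\<mu> n) - (\<integral>x. h x \<partial>M)\<bar> \<le> d n" .
  qed
  have ge: "0 \<le> bl_dist (\<mu> n) M" for n by (rule bl_dist_nonneg[OF \<mu> M])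
  show ?thesis
    by (rule tendsto_sandwich[OF _ _ tendsto_const d0]) (use le ge in auto)
qed

text \<open>Weak convergence reaches only bounded continuous functions. The uniform bound at the
  doubled exponent gives uniform integrability, which carries the limit over to
  \<open>exp (t * x)\<close>.\<close>

lemma mgf_weak_limit:
  assumes \<mu>: "\<And>n. real_distribution (\<mu> n)" and M: "real_distribution M" and w: "weak_conv_m \<mu> M"
    and int: "\<And>n. integrable (\<mu> n) (\<lambda>x. exp (t * x))" "\<And>n. integrable (\<mu> n) (\<lambda>x. exp (2 * t * x))"
    and lim: "(\<lambda>n. \<integral>x. exp (t * x) \<partial>\<mu> n) \<longlonglongrightarrow> m"
    and bd: "\<And>n. (\<integral>x. exp (2 * t * x) \<partial>\<mu> n) \<le> C"
  shows "integrable M (\<lambda>x. exp (t * x))" "(\<integral>x. exp (t * x) \<partial>M) = m"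
proof -
  interpret M: real_distribution M by (rule M)
  define g where "g K x = min (exp (t * x)) K" for K x :: real
  have gc: "isCont (g K) x" for K x unfolding g_def by (intro continuous_intros)
  have gm[measurable]: "g K \<in> borel_measurable borel" for K unfolding g_def by measurable
  have gb: "\<bar>g K x\<bar> \<le> K" if "0 \<le> K" for K x using that by (simp add: g_def)
  have gi: "integrable (\<mu> n) (g K)" "integrable M (g K)" if "0 \<le> K" for K n
  proof -
    interpret A: real_distribution "\<mu> n" by (rule \<mu>)
    show "integrable (\<mu> n) (g K)" using gb[OF that] by (intro A.integrable_const_bound[of _ K]) auto
    show "integrable M (g K)" using gb[OF that] by (intro M.integrable_const_bound[of _ K]) auto
  qed
  have gl: "(\<lambda>n. \<integral>x. g K x \<partial>\<mu> n) \<longlonglongrightarrow> (\<integral>x. g K x \<partial>M)" if "0 \<le> K" for K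
    using weak_conv_imp_integral_bdd_continuous_conv[OF \<mu> M w gc, of K K] gb[OF that] by auto
  have up: "(\<integral>x. g K x \<partial>M) \<le> m" if "0 < K" for K
  proof (rule LIMSEQ_le[OF gl lim])
    show "\<exists>N. \<forall>n\<ge>N. (\<integral>x. g K x \<partial>\<mu> n) \<le> (\<integral>x. exp (t * x) \<partial>\<mu> n)"
      using that int gi[of K] by (intro exI[of _ 0] allI impI integral_mono) (auto simp: g_def[abs_def])
  qed (use that in auto)
  have lo: "m - C / K \<le> (\<integral>x. g K x \<partial>M)" if K: "0 < K" for K
  proof (rule LIMSEQ_le[OF tendsto_diff[OF lim tendsto_const] gl])
    have "(\<integral>x. exp (t * x) \<partial>\<mu> n) - C / K \<le> (\<integral>x. g K x \<partial>\<mu> n)" for n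
    proof -
      \<comment> \<open>Where truncation at \<open>K\<close> acts, \<open>exp (t * x)\<close>
        exceeds \<open>K\<close>, so multiplying it by \<open>exp (t * x) / K\<close> only enlarges
        it.\<close>
      have "exp (t * x) \<le> g K x + exp (2 * t * x) / K" for x
      proof (cases "exp (t * x) \<le> K")
        case False
        then have "exp (t * x) * K \<le> exp (t * x) * exp (t * x)" by (intro mult_left_mono) auto
        also have "\<dots> = exp (2 * t * x)" by (simp add: exp_add[symmetric])
        finally have "exp (t * x) \<le> exp (2 * t * x) / K" using K by (simp add: field_simps)
        then show ?thesis using False K by (simp add: g_def)
      qed (use K in \<open>simp add: g_def\<close>)
      then have "(\<integral>x. exp (t * x) \<partial>\<mu> n) \<le> (\<integral>x. g K x + exp (2 * t * x) / K \<partial>\<mu> n)"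
        using int gi K by (intro integral_mono) auto
      also have "\<dots> = (\<integral>x. g K x \<partial>\<mu> n) + (\<integral>x. exp (2 * t * x) \<partial>\<mu> n) / K"
        using int gi K by simp
      also have "\<dots> \<le> (\<integral>x. g K x \<partial>\<mu> n) + C / K"
        using bd K by (intro add_left_mono divide_right_mono) auto
      finally show ?thesis by simp
    qed
    then show "\<exists>N. \<forall>n\<ge>N. (\<integral>x. exp (t * x) \<partial>\<mu> n) - C / K \<le> (\<integral>x. g K x \<partial>\<mu> n)" by auto
  qed (use K in auto)
  \<comment> \<open>Letting \<open>K\<close> run through \<open>Suc j\<close> squeezes the truncated
    integrals to \<open>m\<close>; monotone convergence then gives integrability under the limit law
    as well as the value.\<close>
  have conv: "(\<lambda>j. \<integral>x. g (real (Suc j)) x \<partial>M) \<longlonglongrightarrow> m"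
  proof (rule tendsto_sandwich[OF _ _ _ tendsto_const])
    show "\<forall>\<^sub>F j in sequentially. m - C / real (Suc j) \<le> (\<integral>x. g (real (Suc j)) x \<partial>M)"
      using lo by simp
    show "\<forall>\<^sub>F j in sequentially. (\<integral>x. g (real (Suc j)) x \<partial>M) \<le> m" using up by simp
    have "(\<lambda>j. m - C / real (Suc j)) \<longlonglongrightarrow> m - 0"
      by (intro tendsto_intros LIMSEQ_Suc[OF lim_const_over_n])
    then show "(\<lambda>j. m - C / real (Suc j)) \<longlonglongrightarrow> m" by simp
  qed
  have mono: "AE x in M. mono (\<lambda>j. g (real (Suc j)) x)"
    by (auto simp: mono_def g_def)
  have pw: "AE x in M. (\<lambda>j. g (real (Suc j)) x) \<longlonglongrightarrow> exp (t * x)"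
  proof (rule AE_I2, rule tendsto_eventually)
    fix x :: real
    obtain N :: nat where "exp (t * x) \<le> real N" using real_arch_simple by blast
    then have "\<And>j. j \<ge> N \<Longrightarrow> g (real (Suc j)) x = exp (t * x)" by (simp add: g_def)
    then show "\<forall>\<^sub>F j in sequentially. g (real (Suc j)) x = exp (t * x)"
      unfolding eventually_sequentially by blast
  qed
  have m: "(\<lambda>x. exp (t * x)) \<in> borel_measurable M" by simp
  show "integrable M (\<lambda>x. exp (t * x))"
    by (rule integrable_monotone_convergence[OF gi(2) mono pw conv m]) simp
  show "(\<integral>x. exp (t * x) \<partial>M) = m"
    by (rule integral_monotone_convergence[OF gi(2) mono pw conv m]) simp
qed

text \<open>The partial sums of the exponential series are dominated by
  \<open>exp (b * x) + exp (- b * x)\<close>, so they may be integrated termwise on the closed disc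
  of radius \<open>b\<close>.\<close>

lemma (in real_distribution) mgf_power_series:
  assumes b: "0 < b" and int: "integrable M (\<lambda>x. exp (b * x))" "integrable M (\<lambda>x. exp (- b * x))"
    and z: "norm z \<le> b"
  shows "(\<lambda>k. of_real ((\<integral>x. x ^ k \<partial>M) / fact k) * z ^ k) sums (\<integral>x. exp (z * complex_of_real x) \<partial>M)"
proof -
  have dom: "exp (b * \<bar>x\<bar>) \<le> exp (b * x) + exp (- b * x)" for x :: real
    by (cases "0 \<le> x") (auto simp: add_increasing add_increasing2)
  have powb: "\<bar>x\<bar> ^ k \<le> (exp (b * x) + exp (- b * x)) * (fact k / b ^ k)" for x :: real and k
  proof -
    have "(b * \<bar>x\<bar>) ^ k /\<^sub>R fact k \<le> (\<Sum>j. (b * \<bar>x\<bar>) ^ j /\<^sub>R fact j)"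
      using b by (intro sum_le_suminf[of _ "{k}", simplified] summable_exp_generic) auto
    then have "(b * \<bar>x\<bar>) ^ k / fact k \<le> exp (b * \<bar>x\<bar>)" by (simp add: exp_def field_simps)
    with dom[of x] have "(b * \<bar>x\<bar>) ^ k / fact k \<le> exp (b * x) + exp (- b * x)" by linarith
    then show ?thesis using b by (simp add: field_simps power_mult_distrib)
  qed
  have intk: "integrable M (\<lambda>x. x ^ k)" for k
  proof (rule Bochner_Integration.integrable_bound)
    show "integrable M (\<lambda>x. (exp (b * x) + exp (- b * x)) * (fact k / b ^ k))" using int by simp
    show "AE x in M. norm (x ^ k) \<le> norm ((exp (b * x) + exp (- b * x)) * (fact k / b ^ k))"
      using powb b by (auto simp: power_abs abs_mult add_nonneg_nonneg)
  qed simp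
  have "(\<lambda>N. \<integral>x. (\<Sum>k<N. (z * complex_of_real x) ^ k /\<^sub>R fact k) \<partial>M) \<longlonglongrightarrow> (\<integral>x. exp (z * complex_of_real x) \<partial>M)"
  proof (rule integral_dominated_convergence[where w = "\<lambda>x. exp (b * x) + exp (- b * x)"])
    show "AE x in M. (\<lambda>N. \<Sum>k<N. (z * complex_of_real x) ^ k /\<^sub>R fact k) \<longlonglongrightarrow> exp (z * complex_of_real x)"
      using exp_converges by (auto simp: sums_def)
    show "AE x in M. norm (\<Sum>k<N. (z * complex_of_real x) ^ k /\<^sub>R fact k) \<le> exp (b * x) + exp (- b * x)" for N
    proof (rule AE_I2)
      fix x :: real
      have "norm (\<Sum>k<N. (z * complex_of_real x) ^ k /\<^sub>R fact k) \<le> (\<Sum>k<N. (norm z * \<bar>x\<bar>) ^ k /\<^sub>R fact k)"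
        by (intro sum_norm_le) (simp add: norm_mult norm_power)
      also have "\<dots> \<le> (\<Sum>k. (norm z * \<bar>x\<bar>) ^ k /\<^sub>R fact k)"
        by (intro sum_le_suminf summable_exp_generic) auto
      also have "\<dots> = exp (norm z * \<bar>x\<bar>)" by (simp add: exp_def)
      also have "\<dots> \<le> exp (b * \<bar>x\<bar>)" using z by (simp add: mult_right_mono)
      finally show "norm (\<Sum>k<N. (z * complex_of_real x) ^ k /\<^sub>R fact k) \<le> exp (b * x) + exp (- b * x)"
        using dom[of x] by linarith
    qed
  qed (use int in \<open>auto intro!: borel_measurable_continuous_onI continuous_intros\<close>)
  moreover have "(\<integral>x. (\<Sum>k<N. (z * complex_of_real x) ^ k /\<^sub>R fact k) \<partial>M)
      = (\<Sum>k<N. of_real ((\<integral>x. x ^ k \<partial>M) / fact k) * z ^ k)" for N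
  proof -
    have e: "(z * complex_of_real x) ^ k /\<^sub>R fact k = (z ^ k / fact k) * complex_of_real (x ^ k)" for x k
      by (simp add: power_mult_distrib scaleR_conv_of_real field_simps)
    have "(\<integral>x. (\<Sum>k<N. (z * complex_of_real x) ^ k /\<^sub>R fact k) \<partial>M)
      = (\<Sum>k<N. (z ^ k / fact k) * (\<integral>x. complex_of_real (x ^ k) \<partial>M))"
      unfolding e using intk by (subst Bochner_Integration.integral_sum) (auto simp del: of_real_power)
    also have "\<dots> = (\<Sum>k<N. of_real ((\<integral>x. x ^ k \<partial>M) / fact k) * z ^ k)"
      using intk by (simp add: integral_of_real mult_ac del: of_real_power)
    finally show ?thesis .
  qed
  ultimately show ?thesis by (simp add: sums_def)
qed

text \<open>The difference of the two complex transforms is holomorphic on a disc and vanishes at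
  points accumulating at 0, hence also at \<open>\<i> * t\<close>, which equates the characteristic
  functions. Rational exponents are the countable family that the compactness argument below
  supplies.\<close>

lemma mgf_uniqueness:
  assumes M1: "real_distribution M1" and M2: "real_distribution M2"
    and i1: "\<And>t. t \<in> \<rat> \<Longrightarrow> integrable M1 (\<lambda>x. exp (t * x))"
    and i2: "\<And>t. t \<in> \<rat> \<Longrightarrow> integrable M2 (\<lambda>x. exp (t * x))"
    and eq: "\<And>t. t \<in> \<rat> \<Longrightarrow> (\<integral>x. exp (t * x) \<partial>M1) = (\<integral>x. exp (t * x) \<partial>M2)"
  shows "M1 = M2"
proof (rule Levy_uniqueness[OF M1 M2], rule ext)
  fix t :: real
  interpret M1: real_distribution M1 by (rule M1)
  interpret M2: real_distribution M2 by (rule M2)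
  \<comment> \<open>An integer, so that the hypotheses apply at \<open>b\<close> and
    \<open>- b\<close>; larger than \<open>\<bar>t\<bar>\<close> so that the disc contains
    \<open>\<i> * t\<close>, and larger than 1 so that it contains every
    \<open>1 / real (Suc n)\<close>.\<close>
  define b where "b = real (nat \<lceil>\<bar>t\<bar>\<rceil> + 2)"
  have b: "0 < b" "b \<in> \<rat>" "\<bar>t\<bar> < b" "1 < b" unfolding b_def by (auto simp: of_nat_nat) linarith+
  define f where "f z = (\<integral>x. exp (z * complex_of_real x) \<partial>M1) - (\<integral>x. exp (z * complex_of_real x) \<partial>M2)" for z
  define a where "a k = complex_of_real ((\<integral>x. x ^ k \<partial>M1) / fact k) - of_real ((\<integral>x. x ^ k \<partial>M2) / fact k)" for k
  have s: "(\<lambda>k. a k * (z - 0) ^ k) sums f z" if "z \<in> ball 0 b" for z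
  proof -
    have nb: "- b \<in> \<rat>" using b by simp
    have "(\<lambda>k. of_real ((\<integral>x. x ^ k \<partial>M1) / fact k) * z ^ k) sums (\<integral>x. exp (z * complex_of_real x) \<partial>M1)"
      using that b i1[OF b(2)] i1[OF nb] by (intro M1.mgf_power_series) auto
    moreover have "(\<lambda>k. of_real ((\<integral>x. x ^ k \<partial>M2) / fact k) * z ^ k) sums (\<integral>x. exp (z * complex_of_real x) \<partial>M2)"
      using that b i2[OF b(2)] i2[OF nb] by (intro M2.mgf_power_series) auto
    ultimately show ?thesis
      unfolding f_def a_def using sums_diff by (simp add: left_diff_distrib) blast
  qed
  have hol: "f holomorphic_on ball 0 b" by (rule power_series_holomorphic) (rule s)
  define U where "U = (\<lambda>n. complex_of_real (1 / real (Suc n))) ` UNIV"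
  have U0: "f u = 0" if "u \<in> U" for u
  proof -
    from that have "u \<in> range (\<lambda>n. complex_of_real (1 / real (Suc n)))" by (simp only: U_def)
    then obtain n where u: "u = complex_of_real (1 / real (Suc n))" by (rule rangeE)
    have r: "1 / real (Suc n) \<in> \<rat>" by simp
    have "(\<integral>x. exp (u * complex_of_real x) \<partial>M) = complex_of_real (\<integral>x. exp (1 / real (Suc n) * x) \<partial>M)" for M
      unfolding u of_real_mult[symmetric] exp_of_real by (rule integral_complex_of_real)
    then show ?thesis using eq[OF r] by (simp add: f_def)
  qed
  have "f (\<i> * of_real t) = 0"
  proof (rule analytic_continuation[OF hol])
    show "0 islimpt U"
      unfolding islimpt_sequential
    proof (intro exI[of _ "\<lambda>n. complex_of_real (1 / real (Suc n))"] conjI allI)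
      have "(\<lambda>n. complex_of_real (1 / real (Suc n))) \<longlonglongrightarrow> of_real 0"
        by (intro tendsto_of_real LIMSEQ_Suc[OF lim_const_over_n])
      then show "(\<lambda>n. complex_of_real (1 / real (Suc n))) \<longlonglongrightarrow> 0" by simp
      show "complex_of_real (1 / real (Suc n)) \<in> U - {0}" for n
        unfolding U_def by (simp del: of_nat_Suc of_real_divide)
    qed
    show "U \<subseteq> ball 0 b"
    proof
      fix u assume "u \<in> U"
      then have "u \<in> range (\<lambda>n. complex_of_real (1 / real (Suc n)))" by (simp only: U_def)
      then obtain n where u: "u = complex_of_real (1 / real (Suc n))" by (rule rangeE)
      have "norm u = 1 / real (Suc n)" unfolding u norm_of_real by simp
      also have "\<dots> \<le> 1" by simp
      finally show "u \<in> ball 0 b" using b by simp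
    qed
  qed (use b U0 in \<open>auto simp: norm_mult\<close>)
  then show "char M1 t = char M2 t"
    by (simp add: f_def char_def mult.assoc)
qed

lemma normal_mgf:
  assumes \<sigma>: "0 < \<sigma>"
  shows "integrable (density lborel (\<lambda>u. ennreal (normal_density 0 \<sigma> u))) (\<lambda>x. exp (t * x))"
    and "(\<integral>x. exp (t * x) \<partial>(density lborel (\<lambda>u. ennreal (normal_density 0 \<sigma> u)))) = exp (t\<^sup>2 * \<sigma>\<^sup>2 / 2)"
proof -
  have e: "normal_density 0 \<sigma> x * exp (t * x) = exp (t\<^sup>2 * \<sigma>\<^sup>2 / 2) * normal_density (t * \<sigma>\<^sup>2) \<sigma> x" for x
  proof -
    have "- (x - 0)\<^sup>2 / (2 * \<sigma>\<^sup>2) + t * x = t\<^sup>2 * \<sigma>\<^sup>2 / 2 + - (x - t * \<sigma>\<^sup>2)\<^sup>2 / (2 * \<sigma>\<^sup>2)"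
      using \<sigma> by (simp add: field_simps power2_eq_square)
    then have "exp (- (x - 0)\<^sup>2 / (2 * \<sigma>\<^sup>2)) * exp (t * x)
        = exp (t\<^sup>2 * \<sigma>\<^sup>2 / 2) * exp (- (x - t * \<sigma>\<^sup>2)\<^sup>2 / (2 * \<sigma>\<^sup>2))"
      by (simp only: exp_add[symmetric])
    then show ?thesis unfolding normal_density_def by (simp add: field_simps)
  qed
  have i: "integrable lborel (\<lambda>x. exp (t\<^sup>2 * \<sigma>\<^sup>2 / 2) * normal_density (t * \<sigma>\<^sup>2) \<sigma> x)"
    using \<sigma> by (intro integrable_mult_right) simp
  show "integrable (density lborel (\<lambda>u. ennreal (normal_density 0 \<sigma> u))) (\<lambda>x. exp (t * x))"
    using i by (subst integrable_density) (auto simp: e)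
  show "(\<integral>x. exp (t * x) \<partial>(density lborel (\<lambda>u. ennreal (normal_density 0 \<sigma> u)))) = exp (t\<^sup>2 * \<sigma>\<^sup>2 / 2)"
    using \<sigma> by (subst integral_density) (auto simp: e)
qed

text \<open>Markov's inequality for \<open>exp x\<close> and \<open>exp (- x)\<close> controls the
  two tails.\<close>

lemma tight_of_mgf:
  assumes \<mu>: "\<And>n. real_distribution (\<mu> n)"
    and int: "\<And>n. integrable (\<mu> n) (\<lambda>x. exp x)" "\<And>n. integrable (\<mu> n) (\<lambda>x. exp (- x))"
    and bd: "\<And>n. (\<integral>x. exp x \<partial>\<mu> n) \<le> C" "\<And>n. (\<integral>x. exp (- x) \<partial>\<mu> n) \<le> C"
  shows "tight \<mu>"
  unfolding tight_def
proof (intro conjI allI impI \<mu>)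
  fix \<epsilon> :: real assume \<epsilon>: "0 < \<epsilon>"
  define R where "R = max 1 (ln (2 * (\<bar>C\<bar> + 1) / \<epsilon>))"
  have R: "2 * (\<bar>C\<bar> + 1) / \<epsilon> \<le> exp R" "0 < R"
  proof -
    have "ln (2 * (\<bar>C\<bar> + 1) / \<epsilon>) \<le> R" by (simp add: R_def)
    then have "exp (ln (2 * (\<bar>C\<bar> + 1) / \<epsilon>)) \<le> exp R" by simp
    then show "2 * (\<bar>C\<bar> + 1) / \<epsilon> \<le> exp R" using \<epsilon> by (subst (asm) exp_ln) auto
    show "0 < R" by (simp add: R_def)
  qed
  have "1 - \<epsilon> < measure (\<mu> n) {- R<..R}" for n
  proof -
    interpret A: real_distribution "\<mu> n" by (rule \<mu>)
    have M: "A.prob {x\<in>space (\<mu> n). exp R \<le> exp (s * x)} < \<epsilon> / 2"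
      if i: "integrable (\<mu> n) (\<lambda>x. exp (s * x))" and b: "(\<integral>x. exp (s * x) \<partial>\<mu> n) \<le> C" for s
    proof -
      have "A.prob {x\<in>space (\<mu> n). exp R \<le> exp (s * x)} \<le> (\<integral>x. exp (s * x) \<partial>\<mu> n) / exp R"
        by (rule integral_Markov_inequality_measure[where A = "{}", OF i]) auto
      also have "\<dots> < \<epsilon> / 2"
      proof -
        have "\<bar>C\<bar> + 1 \<le> \<epsilon> / 2 * exp R" using R(1) \<epsilon> by (simp add: field_simps)
        then have "(\<integral>x. exp (s * x) \<partial>\<mu> n) < \<epsilon> / 2 * exp R" using b by linarith
        then show ?thesis by (simp add: pos_divide_less_eq)
      qed
      finally show ?thesis .
    qed
    let ?A = "{x\<in>space (\<mu> n). exp R \<le> exp (1 * x)}" and ?B = "{x\<in>space (\<mu> n). exp R \<le> exp (-1 * x)}"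
    have "measure (\<mu> n) (space (\<mu> n) - {- R<..R}) \<le> measure (\<mu> n) (?A \<union> ?B)"
      by (intro A.finite_measure_mono) auto
    also have "\<dots> \<le> measure (\<mu> n) ?A + measure (\<mu> n) ?B"
      by (intro measure_subadditive) (auto simp: A.emeasure_eq_measure)
    also have "\<dots> < \<epsilon>"
      using M[of 1] M[of "-1"] int bd by simp
    finally show ?thesis using A.prob_compl[of "{- R<..R}"] by simp
  qed
  then show "\<exists>a b. a < b \<and> (\<forall>n. 1 - \<epsilon> < measure (\<mu> n) {a<..b})"
    using R(2) by (intro exI[of _ "- R"] exI[of _ R]) auto
qed


text \<open>Compactness, by contradiction: if no finite set of exponents and no tolerance works, the
  counterexamples form a tight sequence whose transforms converge at every rational, and a
  subsequential weak limit has the normal transform. The order of quantifiers matters: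
  \<open>T\<close> and \<open>\<delta>\<close> are fixed before the law, which may then depend on
  the data.\<close>

lemma bl_dist_normal_le_of_mgf:
  assumes \<sigma>: "0 < \<sigma>" and \<epsilon>: "0 < \<epsilon>"
  shows "\<exists>T \<delta>. finite T \<and> 0 < \<delta> \<and> (\<forall>\<nu>. real_distribution \<nu> \<longrightarrow>
      (\<forall>t\<in>T. integrable \<nu> (\<lambda>x. exp (t * x)) \<and> \<bar>(\<integral>x. exp (t * x) \<partial>\<nu>) - exp (t\<^sup>2 * \<sigma>\<^sup>2 / 2)\<bar> \<le> \<delta>) \<longrightarrow>
      bl_dist \<nu> (density lborel (\<lambda>u. ennreal (normal_density 0 \<sigma> u))) \<le> \<epsilon>)"
proof (rule ccontr)
  define G where "G = density lborel (\<lambda>u. ennreal (normal_density 0 \<sigma> u))"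
  have G: "real_distribution G"
    unfolding G_def real_distribution_def real_distribution_axioms_def
    using prob_space_normal_density[OF \<sigma>] by simp
  define g where "g t = exp (t\<^sup>2 * \<sigma>\<^sup>2 / 2)" for t :: real
  define q :: "nat \<Rightarrow> real" where "q = from_nat_into \<rat>"
  have q: "range q = \<rat>" unfolding q_def by (rule range_from_nat_into) (auto simp: countable_rat)
  \<comment> \<open>The exponents 1 and -1 are present from the start to give tightness; the others
    exhaust the rationals.\<close>
  define T where "T k = {1, - 1} \<union> q ` {..k}" for k :: nat
  assume no: "\<not> ?thesis"
  have "\<exists>\<nu>. real_distribution \<nu> \<and> (\<forall>t\<in>T k. integrable \<nu> (\<lambda>x. exp (t * x)) \<and>
      \<bar>(\<integral>x. exp (t * x) \<partial>\<nu>) - g t\<bar> \<le> 1 / real (Suc k)) \<and> \<not> bl_dist \<nu> G \<le> \<epsilon>" for k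
  proof -
    have "finite (T k)" "0 < 1 / real (Suc k)" by (auto simp: T_def)
    then show ?thesis using no unfolding g_def[symmetric] G_def[symmetric] by blast
  qed
  then obtain \<nu> where \<nu>: "\<And>k. real_distribution (\<nu> k)"
    and near: "\<And>k t. t \<in> T k \<Longrightarrow> integrable (\<nu> k) (\<lambda>x. exp (t * x)) \<and>
      \<bar>(\<integral>x. exp (t * x) \<partial>\<nu> k) - g t\<bar> \<le> 1 / real (Suc k)"
    and far: "\<And>k. \<not> bl_dist (\<nu> k) G \<le> \<epsilon>"
    by metis
  have lim: "(\<lambda>k. \<integral>x. exp (t * x) \<partial>\<nu> k) \<longlonglongrightarrow> g t" if tail: "\<And>k. k \<ge> k0 \<Longrightarrow> t \<in> T k" for t k0
  proof (rule Lim_transform_bound[of "\<lambda>k. (\<integral>x. exp (t * x) \<partial>\<nu> k) - g t", THEN LIM_zero_cancel])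
    show "\<forall>\<^sub>F k in sequentially. norm ((\<integral>x. exp (t * x) \<partial>\<nu> k) - g t) \<le> norm (1 / real (Suc k))"
      using near tail by (auto simp: eventually_sequentially)
    show "(\<lambda>k. 1 / real (Suc k)) \<longlonglongrightarrow> 0" by (rule LIMSEQ_Suc[OF lim_const_over_n])
  qed
  have tight: "tight \<nu>"
  proof (rule tight_of_mgf[OF \<nu>, where C = "g 1 + 1"])
    fix k
    have k: "1 / real (Suc k) \<le> 1" by simp
    have g: "g (- 1) = g 1" by (simp add: g_def)
    have "1 \<in> T k" "- 1 \<in> T k" by (auto simp: T_def)
    note n = near[OF this(1)] near[OF this(2)]
    show "integrable (\<nu> k) exp" "integrable (\<nu> k) (\<lambda>x. exp (- x))" using n by simp_all
    have "\<bar>(\<integral>x. exp x \<partial>\<nu> k) - g 1\<bar> \<le> 1 / real (Suc k)" "\<bar>(\<integral>x. exp (- x) \<partial>\<nu> k) - g 1\<bar> \<le> 1 / real (Suc k)"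
      using n g by simp_all
    with k show "(\<integral>x. exp x \<partial>\<nu> k) \<le> g 1 + 1" "(\<integral>x. exp (- x) \<partial>\<nu> k) \<le> g 1 + 1"
      unfolding abs_le_iff by linarith+
  qed
  obtain r M where r: "strict_mono (r :: nat \<Rightarrow> nat)" and M: "real_distribution M"
    and w: "weak_conv_m (\<nu> \<circ> r) M"
  proof -
    have "strict_mono (id :: nat \<Rightarrow> nat)" by (simp add: strict_mono_def)
    note tight_imp_convergent_subsubsequence[OF tight this, unfolded comp_id]
    then show thesis by (elim exE conjE) (rule that)
  qed
  have rT: "\<exists>k0. \<forall>k\<ge>k0. t \<in> T k" if "t \<in> \<rat>" for t
  proof -
    have "t \<in> range q" using that q by simp
    then obtain j where "t = q j" by (rule rangeE)
    then show ?thesis by (auto simp: T_def)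
  qed
  have mgfM: "integrable M (\<lambda>x. exp (t * x)) \<and> (\<integral>x. exp (t * x) \<partial>M) = g t" if t: "t \<in> \<rat>" for t
  proof -
    have t2: "2 * t \<in> \<rat>" using t by simp
    obtain k1 k2 where k: "\<And>k. k \<ge> k1 \<Longrightarrow> t \<in> T k" "\<And>k. k \<ge> k2 \<Longrightarrow> 2 * t \<in> T k"
      using rT[OF t] rT[OF t2] by blast
    \<comment> \<open>Shifting the subsequence past both indices makes the conditions at
      \<open>t\<close> and \<open>2 * t\<close> hold for every term, as
      \<open>mgf_weak_limit\<close> demands.\<close>
    define s where "s n = r (n + max k1 k2)" for n
    have s: "s n \<ge> k1" "s n \<ge> k2" for n
      using seq_suble[OF r, of "n + max k1 k2"] by (auto simp: s_def)
    have s_mono: "strict_mono s" using r by (auto simp: s_def strict_mono_def)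
    have ws: "weak_conv_m (\<lambda>n. \<nu> (s n)) M"
      using w LIMSEQ_ignore_initial_segment[where k = "max k1 k2"]
      unfolding weak_conv_m_def weak_conv_def s_def by fastforce
    have l: "(\<lambda>n. \<integral>x. exp (t * x) \<partial>\<nu> (s n)) \<longlonglongrightarrow> g t"
      using LIMSEQ_subseq_LIMSEQ[OF lim[OF k(1)] s_mono] by (simp add: o_def)
    have b: "(\<integral>x. exp (2 * t * x) \<partial>\<nu> (s n)) \<le> g (2 * t) + 1" for n
    proof -
      have "1 / real (Suc (s n)) \<le> 1" by simp
      then show ?thesis using near[OF k(2)[OF s(2)[of n]]] by linarith
    qed
    show ?thesis
      using mgf_weak_limit[OF \<nu> M ws _ _ l b] near[OF k(1)[OF s(1)]] near[OF k(2)[OF s(2)]] by auto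
  qed
  have MG: "M = G"
    using mgfM normal_mgf[OF \<sigma>] by (intro mgf_uniqueness[OF M G]) (auto simp: G_def g_def)
  have "(\<lambda>n. bl_dist ((\<nu> \<circ> r) n) G) \<longlonglongrightarrow> 0"
    using w \<nu> G unfolding MG o_def by (intro bl_dist_tendsto_0)
  then have "\<forall>\<^sub>F n in sequentially. bl_dist ((\<nu> \<circ> r) n) G < \<epsilon>"
    using \<epsilon> by (rule order_tendstoD(2))
  then show False using far by (auto simp: eventually_sequentially not_le) (meson less_asym order_refl)
qed

subsection \<open>The law of an observation\<close>

lemma pair_count_space_integral:
  fixes G :: "'a \<times> 'c \<Rightarrow> real"
  assumes N: "sigma_finite_measure N" and C: "finite C"
    and G: "G \<in> borel_measurable (N \<Otimes>\<^sub>M count_space C)"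
    and int: "\<And>c. c \<in> C \<Longrightarrow> integrable N (\<lambda>z. G (z, c))"
  shows "integrable (N \<Otimes>\<^sub>M count_space C) G"
    and "(\<integral>p. G p \<partial>(N \<Otimes>\<^sub>M count_space C)) = (\<integral>z. (\<Sum>c\<in>C. G (z, c)) \<partial>N)"
proof -
  interpret N: sigma_finite_measure N by fact
  interpret C: finite_measure "count_space C" by (rule finite_measure_count_space) fact
  interpret NC: pair_sigma_finite N "count_space C" ..
  show I: "integrable (N \<Otimes>\<^sub>M count_space C) G"
    by (rule NC.Fubini_integrable[OF G])
      (use C int in \<open>auto simp: lebesgue_integral_count_space_finite integrable_count_space\<close>)
  show "(\<integral>p. G p \<partial>(N \<Otimes>\<^sub>M count_space C)) = (\<integral>z. (\<Sum>c\<in>C. G (z, c)) \<partial>N)"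
    using NC.integral_fst'[OF I] C by (simp add: lebesgue_integral_count_space_finite)
qed

lemma AE_pair_count_space:
  assumes N: "sigma_finite_measure N" and C: "finite C" and P: "AE z in N. \<forall>c\<in>C. P (z, c)"
  shows "AE p in N \<Otimes>\<^sub>M count_space C. P p"
proof -
  interpret C: finite_measure "count_space C" by (rule finite_measure_count_space) fact
  obtain X where X: "{z\<in>space N. \<not> (\<forall>c\<in>C. P (z, c))} \<subseteq> X" "emeasure N X = 0" "X \<in> sets N"
    using P by (auto elim: AE_E)
  show ?thesis
  proof (rule AE_I)
    show "{p\<in>space (N \<Otimes>\<^sub>M count_space C). \<not> P p} \<subseteq> X \<times> C" using X by (auto simp: space_pair_measure)
    show "emeasure (N \<Otimes>\<^sub>M count_space C) (X \<times> C) = 0"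
      using X by (subst C.emeasure_pair_measure_Times) auto
    show "X \<times> C \<in> sets (N \<Otimes>\<^sub>M count_space C)" using X by (intro pair_measureI) auto
  qed
qed

abbreviation bin2 :: "(nat \<times> nat) set" where "bin2 \<equiv> {0, 1} \<times> {0, 1}"

lemma obs_space_eq: "obs_space N = N \<Otimes>\<^sub>M count_space bin2"
  unfolding obs_space_def by (subst pair_measure_count_space) auto

text \<open>The binary components range over a finite set, so measurability is a question about the
  sections in \<open>z\<close>.\<close>

lemma obs_measurableI:
  assumes "\<And>r w. r \<in> {0, 1} \<Longrightarrow> w \<in> {0, 1} \<Longrightarrow> (\<lambda>z. g (z, r, w)) \<in> measurable N K"
  shows "g \<in> measurable (obs_space N) K"
proof -
  have 1: "(\<lambda>p. (snd p, fst p)) \<in> measurable (N \<Otimes>\<^sub>M count_space bin2) (count_space bin2 \<Otimes>\<^sub>M N)"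
    by measurable
  have 2: "(\<lambda>q. g (snd q, fst q)) \<in> measurable (count_space bin2 \<Otimes>\<^sub>M N) K"
  proof (rule measurable_pair_measure_countable1)
    fix c assume "c \<in> bin2"
    then obtain r w where "c = (r, w)" "r \<in> {0, 1}" "w \<in> {0, 1}" by (rule SigmaE)
    then show "(\<lambda>z. g (snd (c, z), fst (c, z))) \<in> measurable N K" using assms[of r w] by simp
  qed (simp add: countable_finite)
  show ?thesis using measurable_compose[OF 1 2] unfolding obs_space_eq by simp
qed

text \<open>The density of the full triple (Z, R, Y), before \<open>y\<close> is collapsed to
  \<open>r * y\<close>.\<close>

definition obs_weight :: "('z \<Rightarrow> real) \<Rightarrow> ('z \<Rightarrow> real) \<Rightarrow> ('z \<Rightarrow> real) \<Rightarrow> 'z obs \<Rightarrow> real" where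
  "obs_weight a b f = (\<lambda>(z, r, y).
     (1 / a z) ^ r * (1 - 1 / a z) ^ (1 - r) * (b z ^ y * (1 - b z) ^ (1 - y)) * f z)"

lemma full_law_eq: "full_law N a b f = density (obs_space N) (\<lambda>x. ennreal (obs_weight a b f x))"
  unfolding full_law_def obs_weight_def obs_space_def by (simp add: split_beta')

text \<open>Data missing at random. One constant serves all bounds; as \<open>a0\<close> is the
  inverse of the observation probability, its bounds read from 1 to
  \<open>1 / \<delta>\<close>.\<close>

locale mar_model =
  fixes N :: "'z measure" and a0 b0 f0 :: "'z \<Rightarrow> real" and \<delta> :: real
  assumes a0_meas[measurable]: "a0 \<in> borel_measurable N"
    and b0_meas[measurable]: "b0 \<in> borel_measurable N"
    and f0_meas[measurable]: "f0 \<in> borel_measurable N"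
    and f0_density: "has_bochner_integral N f0 1"
    and \<delta>_pos: "0 < \<delta>"
    and bounds: "AE z in N. 1 \<le> a0 z \<and> a0 z \<le> 1 / \<delta> \<and> \<delta> \<le> b0 z \<and> b0 z \<le> 1 - \<delta> \<and> \<delta> \<le> f0 z"
begin

abbreviation "P0 \<equiv> obs_law N a0 b0 f0"

text \<open>Gathers the support restriction \<open>w \<le> r\<close> and the pointwise bounds. On
  this almost sure event the likelihood identities can be proved observation by observation.\<close>

definition good_obs :: "'z obs \<Rightarrow> bool" where
  "good_obs = (\<lambda>(z, r, w). r \<in> {0, 1} \<and> w \<in> {0, 1} \<and> w \<le> r \<and>
     1 \<le> a0 z \<and> a0 z \<le> 1 / \<delta> \<and> \<delta> \<le> b0 z \<and> b0 z \<le> 1 - \<delta>)"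

lemma f0_integrable[simp]: "integrable N f0" and f0_integral: "(\<integral>z. f0 z \<partial>N) = 1"
  using f0_density by (auto simp: has_bochner_integral_iff)

text \<open>\<open>f0\<close> integrates to 1 and is at least \<open>\<delta>\<close>, so the total
  mass is at most \<open>1 / \<delta>\<close>.\<close>

lemma finite_N: "finite_measure N"
proof
  have "ennreal \<delta> * emeasure N (space N) = (\<integral>\<^sup>+z. ennreal \<delta> \<partial>N)" by simp
  also have "\<dots> \<le> (\<integral>\<^sup>+z. ennreal (f0 z) \<partial>N)"
    by (intro nn_integral_mono_AE eventually_mono[OF bounds]) (auto intro!: ennreal_leI)
  also have "\<dots> = ennreal (\<integral>z. f0 z \<partial>N)"
    using \<delta>_pos by (intro nn_integral_eq_integral f0_integrable eventually_mono[OF bounds]) auto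
  finally show "emeasure N (space N) \<noteq> \<infinity>" using \<delta>_pos
    by (auto simp: ennreal_mult_eq_top_iff top_unique f0_integral)
qed

sublocale N: finite_measure N by (rule finite_N)

lemma integrable_weighted:
  assumes "g \<in> borel_measurable N" "AE z in N. \<bar>g z\<bar> \<le> K"
  shows "integrable N (\<lambda>z. f0 z * g z)"
proof (rule Bochner_Integration.integrable_bound)
  show "integrable N (\<lambda>z. f0 z * K)" by simp
  show "AE z in N. norm (f0 z * g z) \<le> norm (f0 z * K)"
    using assms(2) by eventually_elim (auto simp: abs_mult intro!: mult_left_mono)
qed (use assms(1) in measurable)

text \<open>Both values of \<open>y\<close> with \<open>r = 0\<close> are sent to the observation
  \<open>(z, 0, 0)\<close>, and their weights add up to \<open>1 - 1 / a0 z\<close>; the cell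
  \<open>(z, 0, 1)\<close> carries no mass.\<close>

lemma obs_law_integral:
  assumes g: "g \<in> borel_measurable (obs_space N)"
    and bd: "AE z in N. \<bar>g (z, 0, 0)\<bar> \<le> K \<and> \<bar>g (z, 1, 0)\<bar> \<le> K \<and> \<bar>g (z, 1, 1)\<bar> \<le> (K :: real)"
  shows "integrable P0 g"
    and "(\<integral>x. g x \<partial>P0) = (\<integral>z. f0 z * ((1 - 1 / a0 z) * g (z, 0, 0)
        + 1 / a0 z * ((1 - b0 z) * g (z, 1, 0) + b0 z * g (z, 1, 1))) \<partial>N)"
proof -
  let ?m = "\<lambda>(z, r, y). (z, r, r * y) :: 'z obs"
  let ?W = "obs_weight a0 b0 f0"
  have m[measurable]: "?m \<in> measurable (obs_space N) (obs_space N)"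
  proof (rule obs_measurableI)
    fix r w :: nat assume "r \<in> {0, 1}" "w \<in> {0, 1}"
    then show "(\<lambda>z. ?m (z, r, w)) \<in> measurable N (obs_space N)"
      unfolding obs_space_def by auto
  qed
  have W[measurable]: "?W \<in> borel_measurable (obs_space N)"
    by (rule obs_measurableI) (simp add: obs_weight_def)
  note g[measurable]
  have gm[measurable]: "(\<lambda>x. g (?m x)) \<in> borel_measurable (obs_space N)"
    by (rule measurable_compose[OF m g])
  have sec: "(\<lambda>z. g (z, r, w)) \<in> borel_measurable N" if "r \<in> {0, 1}" "w \<in> {0, 1}" for r w
  proof -
    have "(\<lambda>z. (z, r, w)) \<in> measurable N (obs_space N)" unfolding obs_space_def using that by auto
    from measurable_compose[OF this g] show ?thesis .
  qed
  have W01: "AE z in N. \<forall>c\<in>bin2. 0 \<le> ?W (z, c) \<and> ?W (z, c) \<le> f0 z"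
    using bounds
  proof eventually_elim
    case (elim z)
    have a: "0 \<le> 1 / a0 z" "1 / a0 z \<le> 1" "0 \<le> 1 - 1 / a0 z" "1 - 1 / a0 z \<le> 1" using elim by auto
    have b: "0 \<le> b0 z" "b0 z \<le> 1" "0 \<le> 1 - b0 z" "1 - b0 z \<le> 1" "0 \<le> f0 z" using elim \<delta>_pos by auto
    have p: "0 \<le> x * y * f0 z \<and> x * y * f0 z \<le> f0 z" if "0 \<le> x" "x \<le> 1" "0 \<le> y" "y \<le> 1" for x y
      using that b(5) by (auto intro!: mult_nonneg_nonneg mult_left_le_one_le mult_le_one)
    show ?case using a b by (auto simp: obs_weight_def simp del: times_divide_eq_left times_divide_eq_right intro!: p[THEN conjunct1] p[THEN conjunct2])
  qed
  have Wpos: "AE x in obs_space N. 0 \<le> ?W x"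
    unfolding obs_space_eq by (rule AE_pair_count_space) (use W01 N.sigma_finite_measure_axioms in auto)
  have intW: "integrable N (\<lambda>z. ?W (z, c) * g (?m (z, c)))" if c: "c \<in> bin2" for c
  proof (rule Bochner_Integration.integrable_bound)
    show "integrable N (\<lambda>z. f0 z * K)" by simp
    obtain r w where rw: "c = (r, w)" "r \<in> {0, 1}" "w \<in> {0, 1}" using c by auto
    then show "(\<lambda>z. ?W (z, c) * g (?m (z, c))) \<in> borel_measurable N"
      using sec[of r "r * w"] by (auto simp: obs_weight_def)
    show "AE z in N. norm (?W (z, c) * g (?m (z, c))) \<le> norm (f0 z * K)"
      using W01 bd
    proof eventually_elim
      case (elim z)
      then have "0 \<le> ?W (z, c)" "?W (z, c) \<le> f0 z" using c by auto
      moreover have "\<bar>g (?m (z, c))\<bar> \<le> K" using rw elim by auto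
      ultimately show ?case by (auto simp: abs_mult intro!: mult_mono)
    qed
  qed
  have G[measurable]: "(\<lambda>x. ?W x * g (?m x)) \<in> borel_measurable (N \<Otimes>\<^sub>M count_space bin2)"
    using W gm unfolding obs_space_eq[symmetric] by measurable
  note pc = pair_count_space_integral[OF N.sigma_finite_measure_axioms _ G intW, folded obs_space_eq]
  have i: "integrable (obs_space N) (\<lambda>x. ?W x *\<^sub>R g (?m x))" using pc(1) by simp
  have "integrable (density (obs_space N) (\<lambda>x. ennreal (?W x))) (\<lambda>x. g (?m x))"
    using i Wpos by (subst integrable_density) auto
  moreover have m': "?m \<in> measurable (density (obs_space N) (\<lambda>x. ennreal (?W x))) (obs_space N)"
    using m by simp
  ultimately show "integrable P0 g"
    unfolding obs_law_def full_law_eq by (simp add: integrable_distr_eq)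
  have "(\<integral>x. g x \<partial>P0) = (\<integral>x. g (?m x) \<partial>density (obs_space N) (\<lambda>x. ennreal (?W x)))"
    unfolding obs_law_def full_law_eq using m' by (simp add: integral_distr)
  also have "\<dots> = (\<integral>x. ?W x * g (?m x) \<partial>obs_space N)"
    using Wpos by (subst integral_density) auto
  also have "\<dots> = (\<integral>z. (\<Sum>c\<in>bin2. ?W (z, c) * g (?m (z, c))) \<partial>N)"
    using pc(2) by simp
  also have "\<dots> = (\<integral>z. f0 z * ((1 - 1 / a0 z) * g (z, 0, 0)
        + 1 / a0 z * ((1 - b0 z) * g (z, 1, 0) + b0 z * g (z, 1, 1))) \<partial>N)"
  proof (rule Bochner_Integration.integral_cong[OF refl])
    fix z
    have sum4: "(\<Sum>c\<in>bin2. F c) = F (0, 0) + F (0, 1) + F (1, 0) + F (1, 1)" for F :: "nat \<times> nat \<Rightarrow> real"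
      unfolding sum.cartesian_product' by simp
    have alg: "(1 - p) * (1 - b) * f * x + (1 - p) * b * f * x + p * (1 - b) * f * y + p * b * f * w
        = f * ((1 - p) * x + p * ((1 - b) * y + b * w))" for p b f x y w :: real
      by (simp add: algebra_simps)
    show "(\<Sum>c\<in>bin2. ?W (z, c) * g (?m (z, c))) = f0 z * ((1 - 1 / a0 z) * g (z, 0, 0)
        + 1 / a0 z * ((1 - b0 z) * g (z, 1, 0) + b0 z * g (z, 1, 1)))"
      unfolding sum4 alg[symmetric] by (simp add: obs_weight_def del: times_divide_eq_left times_divide_eq_right)
  qed
  finally show "(\<integral>x. g x \<partial>P0) = (\<integral>z. f0 z * ((1 - 1 / a0 z) * g (z, 0, 0)
        + 1 / a0 z * ((1 - b0 z) * g (z, 1, 0) + b0 z * g (z, 1, 1))) \<partial>N)" .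
qed

lemma space_obs_law[simp]: "space P0 = space (obs_space N)"
  and sets_obs_law[simp, measurable_cong]: "sets P0 = sets (obs_space N)"
  by (simp_all add: obs_law_def)

lemma prob_space_obs_law: "prob_space P0"
proof (rule prob_spaceI)
  have "(\<integral>x. 1 \<partial>P0) = (\<integral>z. f0 z * ((1 - 1 / a0 z) * 1 + 1 / a0 z * ((1 - b0 z) * 1 + b0 z * 1)) \<partial>N)"
    by (rule obs_law_integral(2)[where K = 1]) auto
  also have "\<dots> = 1" by (simp add: f0_integral)
  finally have 1: "measure P0 (space P0) = 1" by simp
  then have "emeasure P0 (space P0) \<noteq> \<infinity>" by (auto simp: measure_def)
  then show "emeasure P0 (space P0) = 1" using 1 by (simp add: emeasure_eq_ennreal_measure)
qed

sublocale P0: prob_space P0 by (rule prob_space_obs_law)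

lemma good_obs_measurable[measurable]: "Measurable.pred (obs_space N) good_obs"
  by (rule obs_measurableI) (simp add: good_obs_def)

lemma AE_good_obs: "AE x in P0. good_obs x"
proof -
  let ?m = "\<lambda>(z, r, y). (z, r, r * y) :: 'z obs"
  have m: "?m \<in> measurable (full_law N a0 b0 f0) (obs_space N)"
  proof -
    have "?m \<in> measurable (obs_space N) (obs_space N)"
      by (rule obs_measurableI) (auto simp: obs_space_def)
    then show ?thesis by (simp add: full_law_eq)
  qed
  have "AE x in obs_space N. good_obs (?m x)"
    unfolding obs_space_eq
  proof (rule AE_pair_count_space)
    show "AE z in N. \<forall>c\<in>bin2. good_obs (?m (z, c))"
      using bounds by eventually_elim (auto simp: good_obs_def)
  qed (use N.sigma_finite_measure_axioms in auto)
  then have "AE x in full_law N a0 b0 f0. good_obs (?m x)"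
    unfolding full_law_eq by (subst AE_density) (auto simp: obs_weight_def[abs_def] intro!: obs_measurableI elim: AE_mp)
  then show ?thesis
    unfolding obs_law_def by (subst AE_distr_iff[OF m]) auto
qed

lemma good_bounds: "AE z in N. \<bar>a0 z\<bar> \<le> 1 / \<delta> \<and> \<bar>b0 z\<bar> \<le> 1 \<and> 0 \<le> f0 z"
  using bounds by eventually_elim (use \<delta>_pos in auto)

lemma obs_law_integral_z:
  assumes h: "h \<in> borel_measurable N" "AE z in N. \<bar>h z\<bar> \<le> K"
  shows "integrable P0 (\<lambda>(z, r, w). h z)" "integral\<^sup>L P0 (\<lambda>(z, r, w). h z) = (\<integral>z. f0 z * h z \<partial>N)"
proof -
  have m: "(\<lambda>(z, r, w). h z) \<in> borel_measurable (obs_space N)"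
    by (rule obs_measurableI) (use h in simp)
  show "integrable P0 (\<lambda>(z, r, w). h z)"
    using h by (intro obs_law_integral(1)[OF m, of K]) simp
  have "integral\<^sup>L P0 (\<lambda>(z, r, w). h z)
      = (\<integral>z. f0 z * ((1 - 1 / a0 z) * h z + 1 / a0 z * ((1 - b0 z) * h z + b0 z * h z)) \<partial>N)"
    using h obs_law_integral(2)[OF m, of K] by simp
  then show "integral\<^sup>L P0 (\<lambda>(z, r, w). h z) = (\<integral>z. f0 z * h z \<partial>N)"
    by (simp add: algebra_simps)
qed

lemma obs_law_integral_r:
  assumes h: "h \<in> borel_measurable N" "AE z in N. \<bar>h z\<bar> \<le> K"
  shows "integrable P0 (\<lambda>(z, r, w). real r * h z)"
    "integral\<^sup>L P0 (\<lambda>(z, r, w). real r * h z) = (\<integral>z. f0 z * (h z / a0 z) \<partial>N)"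
proof -
  have m: "(\<lambda>(z, r, w). real r * h z) \<in> borel_measurable (obs_space N)"
    by (rule obs_measurableI) (use h in simp)
  have K: "AE z in N. \<bar>real 0 * h z\<bar> \<le> K \<and> \<bar>real 1 * h z\<bar> \<le> K \<and> \<bar>real 1 * h z\<bar> \<le> K"
    using h(2) by eventually_elim auto
  show "integrable P0 (\<lambda>(z, r, w). real r * h z)"
    using K by (intro obs_law_integral(1)[OF m, of K]) simp
  have "integral\<^sup>L P0 (\<lambda>(z, r, w). real r * h z)
      = (\<integral>z. f0 z * (1 / a0 z * ((1 - b0 z) * h z + b0 z * h z)) \<partial>N)"
    using K obs_law_integral(2)[OF m, of K] by simp
  then show "integral\<^sup>L P0 (\<lambda>(z, r, w). real r * h z) = (\<integral>z. f0 z * (h z / a0 z) \<partial>N)"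
    by (simp add: algebra_simps)
qed

text \<open>\<open>V1\<close> and \<open>V2\<close> are the contributions of the regression and of
  the law of \<open>Z\<close> to the efficient variance. They arise separately, as limits of the
  second order terms of the two perturbed components.\<close>

definition V1 :: real where "V1 = (\<integral>z. f0 z * (a0 z * b0 z * (1 - b0 z)) \<partial>N)"
definition V2 :: real where "V2 = (\<integral>z. f0 z * (b0 z - chi N b0 f0)\<^sup>2 \<partial>N)"

lemma chi0_bounds: "0 \<le> chi N b0 f0" "chi N b0 f0 \<le> 1"
proof -
  have i: "integrable N (\<lambda>z. b0 z * f0 z)"
    using integrable_weighted[of b0 1] eventually_mono[OF good_bounds, of "\<lambda>z. \<bar>b0 z\<bar> \<le> 1"]
    by (simp add: mult.commute)
  show "0 \<le> chi N b0 f0" unfolding chi_def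
    using \<delta>_pos by (intro integral_nonneg_AE eventually_mono[OF bounds]) (auto intro!: mult_nonneg_nonneg)
  have "chi N b0 f0 \<le> (\<integral>z. f0 z \<partial>N)" unfolding chi_def
    using i \<delta>_pos
    by (intro integral_mono_AE f0_integrable eventually_mono[OF bounds]) (auto intro!: mult_left_le_one_le)
  then show "chi N b0 f0 \<le> 1" by (simp add: f0_integral)
qed

lemma chi_tilde_measurable[measurable]: "chi_tilde N a0 b0 f0 \<in> borel_measurable (obs_space N)"
  unfolding chi_tilde_def by (rule obs_measurableI) simp

lemma V1_integrable: "integrable N (\<lambda>z. f0 z * (a0 z * b0 z * (1 - b0 z)))"
proof (rule integrable_weighted[of _ "1 / \<delta>"])
  show "AE z in N. \<bar>a0 z * b0 z * (1 - b0 z)\<bar> \<le> 1 / \<delta>"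
    using bounds
  proof eventually_elim
    case (elim z)
    have "a0 z * b0 z * (1 - b0 z) \<le> 1 / \<delta> * 1 * 1" using elim \<delta>_pos by (intro mult_mono) auto
    moreover have "0 \<le> a0 z * b0 z * (1 - b0 z)" using elim \<delta>_pos by (intro mult_nonneg_nonneg) auto
    ultimately show ?case by simp
  qed
qed simp

text \<open>The cross term vanishes because \<open>Y - b0\<close> has conditional mean zero given
  \<open>Z\<close> and \<open>R\<close>.\<close>

lemma eff_var_eq: "eff_var N a0 b0 f0 = V1 + V2"
proof -
  define c0 where "c0 = chi N b0 f0"
  have c0: "0 \<le> c0" "c0 \<le> 1" using chi0_bounds by (auto simp: c0_def)
  define K where "K = (1 / \<delta> + 1)\<^sup>2"
  let ?g = "\<lambda>x. (chi_tilde N a0 b0 f0 x)\<^sup>2"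
  have sq: "u\<^sup>2 \<le> K" if "\<bar>u\<bar> \<le> 1 / \<delta> + 1" for u
    unfolding K_def using that \<delta>_pos by (intro abs_le_square_iff[THEN iffD1]) auto
  have bd: "AE z in N. \<bar>?g (z, 0, 0)\<bar> \<le> K \<and> \<bar>?g (z, 1, 0)\<bar> \<le> K \<and> \<bar>?g (z, 1, 1)\<bar> \<le> K"
    using bounds
  proof eventually_elim
    case (elim z)
    have b: "0 \<le> b0 z" "b0 z \<le> 1" "0 \<le> a0 z" using elim \<delta>_pos by auto
    have d: "0 < 1 / \<delta>" using \<delta>_pos by simp
    have 1: "0 \<le> a0 z * b0 z" "a0 z * b0 z \<le> 1 / \<delta>" "0 \<le> a0 z * (1 - b0 z)" "a0 z * (1 - b0 z) \<le> 1 / \<delta>"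
      using b elim mult_mono[of "a0 z" "1 / \<delta>" "b0 z" 1] mult_mono[of "a0 z" "1 / \<delta>" "1 - b0 z" 1] d
      by auto
    then have "\<bar>b0 z - c0\<bar> \<le> 1 / \<delta> + 1" "\<bar>- (a0 z * b0 z) + b0 z - c0\<bar> \<le> 1 / \<delta> + 1"
      "\<bar>a0 z * (1 - b0 z) + b0 z - c0\<bar> \<le> 1 / \<delta> + 1"
      using b c0 d by linarith+
    then show ?case using sq by (simp add: chi_tilde_def c0_def)
  qed
  have "eff_var N a0 b0 f0 = (\<integral>z. f0 z * ((1 - 1 / a0 z) * ?g (z, 0, 0)
        + 1 / a0 z * ((1 - b0 z) * ?g (z, 1, 0) + b0 z * ?g (z, 1, 1))) \<partial>N)"
    unfolding eff_var_def using bd by (intro obs_law_integral(2)) measurable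
  also have "\<dots> = (\<integral>z. f0 z * (a0 z * b0 z * (1 - b0 z)) + f0 z * (b0 z - c0)\<^sup>2 \<partial>N)"
  proof (rule integral_cong_AE)
    show "AE z in N. f0 z * ((1 - 1 / a0 z) * ?g (z, 0, 0)
        + 1 / a0 z * ((1 - b0 z) * ?g (z, 1, 0) + b0 z * ?g (z, 1, 1)))
      = f0 z * (a0 z * b0 z * (1 - b0 z)) + f0 z * (b0 z - c0)\<^sup>2"
      using bounds
    proof eventually_elim
      case (elim z)
      define a b c where "a = a0 z" and "b = b0 z" and "c = b0 z - c0"
      have "(1 - 1 / a) * c\<^sup>2 + 1 / a * ((1 - b) * (a * (0 - b) + c)\<^sup>2 + b * (a * (1 - b) + c)\<^sup>2)
          = a * b * (1 - b) + c\<^sup>2"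
        using elim by (simp add: a_def[symmetric] field_simps power2_eq_square)
      moreover have "chi_tilde N a0 b0 f0 (z, 0, 0) = c" "chi_tilde N a0 b0 f0 (z, 1, 0) = a * (0 - b) + c"
        "chi_tilde N a0 b0 f0 (z, 1, 1) = a * (1 - b) + c"
        by (simp_all add: chi_tilde_def c0_def a_def b_def c_def algebra_simps)
      moreover have cc: "b0 z - c0 = c" by (simp add: c_def)
      ultimately show ?case unfolding cc by (simp only: a_def[symmetric] b_def[symmetric] c_def[symmetric] distrib_left)
    qed
  qed (simp_all add: chi_tilde_def)
  also have "\<dots> = V1 + V2"
    unfolding V1_def V2_def c0_def[symmetric]
  proof (rule Bochner_Integration.integral_add)
    show "integrable N (\<lambda>z. f0 z * (a0 z * b0 z * (1 - b0 z)))" by (rule V1_integrable)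
    show "integrable N (\<lambda>z. f0 z * (b0 z - c0)\<^sup>2)"
    proof (rule integrable_weighted[of _ 1])
      show "AE z in N. \<bar>(b0 z - c0)\<^sup>2\<bar> \<le> 1"
        using bounds by eventually_elim (use \<delta>_pos c0 in \<open>auto simp: abs_square_le_1\<close>)
    qed simp
  qed
  finally show ?thesis .
qed

text \<open>Nondegeneracy of the Gaussian limit: \<open>a0\<close> is at least 1 and both
  \<open>b0\<close> and \<open>1 - b0\<close> are at least \<open>\<delta>\<close>, so
  \<open>V1\<close> is at least \<open>\<delta>\<^sup>2\<close>.\<close>

lemma eff_var_pos: "0 < eff_var N a0 b0 f0"
proof -
  have "\<delta>\<^sup>2 = (\<integral>z. f0 z * \<delta>\<^sup>2 \<partial>N)" by (simp add: f0_integral)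
  also have "\<dots> \<le> V1"
    unfolding V1_def
  proof (rule integral_mono_AE)
    show "integrable N (\<lambda>z. f0 z * (a0 z * b0 z * (1 - b0 z)))" by (rule V1_integrable)
    show "AE z in N. f0 z * \<delta>\<^sup>2 \<le> f0 z * (a0 z * b0 z * (1 - b0 z))"
      using bounds
    proof eventually_elim
      case (elim z)
      have "1 * \<delta> * \<delta> \<le> a0 z * b0 z * (1 - b0 z)" using elim \<delta>_pos by (intro mult_mono) auto
      then show ?case using elim \<delta>_pos by (intro mult_left_mono) (auto simp: power2_eq_square)
    qed
  qed simp
  finally have "\<delta>\<^sup>2 \<le> V1" .
  moreover have "0 \<le> V2" unfolding V2_def
    by (intro integral_nonneg_AE eventually_mono[OF good_bounds]) auto
  ultimately show ?thesis using \<delta>_pos unfolding eff_var_eq by (smt (verit) zero_less_power)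
qed

end

subsection \<open>Second order expansions\<close>

lemma Psi_pos: "0 < Psi x" and Psi_less_1: "Psi x < 1"
  unfolding Psi_def by (simp_all add: add_pos_pos)

text \<open>The Bernoulli model in its natural parameter, with cumulant function
  \<open>ln (1 + exp x)\<close>: a shift of the logit changes the log likelihood by a linear term
  and an increment of this function.\<close>

lemma Psi_eq_exp: "Psi x = exp (x - ln (1 + exp x))" "1 - Psi x = exp (- ln (1 + exp x))"
proof -
  have "0 < 1 + exp x" by (simp add: add_pos_pos)
  then show "Psi x = exp (x - ln (1 + exp x))" "1 - Psi x = exp (- ln (1 + exp x))"
    unfolding Psi_def by (simp_all add: exp_diff exp_minus field_simps)
qed

lemma DERIV_Psi: "DERIV Psi x :> Psi x * (1 - Psi x)"
proof -
  have "1 + exp (- x) \<noteq> 0" by (smt (verit) exp_gt_zero)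
  then show ?thesis
    unfolding Psi_def [abs_def]
    by (auto intro!: derivative_eq_intros simp: field_simps power2_eq_square)
qed

text \<open>The third derivative is \<open>Psi * (1 - Psi) * (1 - 2 * Psi)\<close>, bounded by 1
  everywhere. The remainder is thus uniform in \<open>u\<close>, however large the logits under the
  prior are.\<close>

lemma softplus_taylor:
  "\<bar>ln (1 + exp (u + h)) - ln (1 + exp u) - h * Psi u - h\<^sup>2 / 2 * (Psi u * (1 - Psi u))\<bar> \<le> \<bar>h\<bar> ^ 3"
proof (cases "h = 0")
  case False
  define d :: "nat \<Rightarrow> real \<Rightarrow> real" where
    "d m = (if m = 0 then (\<lambda>x. ln (1 + exp x)) else if m = 1 then Psi
      else if m = 2 then (\<lambda>x. Psi x * (1 - Psi x)) else (\<lambda>x. Psi x * (1 - Psi x) * (1 - 2 * Psi x)))" for m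
  have D: "\<forall>m t. m < 3 \<and> u - \<bar>h\<bar> \<le> t \<and> t \<le> u + \<bar>h\<bar> \<longrightarrow> DERIV (d m) t :> d (Suc m) t"
  proof (intro allI impI)
    fix m :: nat and t :: real
    assume "m < 3 \<and> u - \<bar>h\<bar> \<le> t \<and> t \<le> u + \<bar>h\<bar>"
    then consider "m = 0" | "m = 1" | "m = 2" by fastforce
    then show "DERIV (d m) t :> d (Suc m) t"
    proof cases
      case 1
      have p: "0 < 1 + exp t" by (simp add: add_pos_pos)
      then have "exp t / (1 + exp t) = Psi t"
        unfolding Psi_def by (simp add: field_simps exp_minus add_nonneg_eq_0_iff)
      then show ?thesis unfolding 1 d_def using p
        by (auto intro!: derivative_eq_intros simp: field_simps)
    next
      case 2
      then show ?thesis using DERIV_Psi by (simp add: d_def numeral_2_eq_2)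
    next
      case 3
      have "DERIV (\<lambda>x. Psi x * (1 - Psi x)) t :> Psi t * (1 - Psi t) * (1 - 2 * Psi t)"
        by (rule derivative_eq_intros DERIV_Psi refl)+ (simp add: algebra_simps)
      then show ?thesis unfolding 3 by (simp add: d_def)
    qed
  qed
  obtain t where t: "ln (1 + exp (u + h)) = (\<Sum>m<3. (d m u / fact m) * (u + h - u) ^ m) + (d 3 t / fact 3) * (u + h - u) ^ 3"
  proof -
    have "d 0 = (\<lambda>x. ln (1 + exp x))" by (simp add: d_def)
    note T = Taylor[OF _ this D, of u "u + h"]
    have "\<exists>t. (if u + h < u then u + h < t \<and> t < u else u < t \<and> t < u + h) \<and>
        ln (1 + exp (u + h)) = (\<Sum>m<3. (d m u / fact m) * (u + h - u) ^ m) + (d 3 t / fact 3) * (u + h - u) ^ 3"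
      by (rule T) (use False in auto)
    then show thesis by (elim exE conjE) (rule that)
  qed
  have "ln (1 + exp (u + h)) - ln (1 + exp u) - h * Psi u - h\<^sup>2 / 2 * (Psi u * (1 - Psi u)) = d 3 t / 6 * h ^ 3"
  proof -
    have "(\<Sum>m<3. (d m u / fact m) * h ^ m) = d 0 u + d 1 u * h + d 2 u / 2 * h\<^sup>2"
      by (simp add: numeral_3_eq_3 numeral_2_eq_2)
    moreover have "fact 3 = (6 :: real)" by (simp add: eval_nat_numeral)
    ultimately have "ln (1 + exp (u + h)) = ln (1 + exp u) + Psi u * h + Psi u * (1 - Psi u) / 2 * h\<^sup>2 + d 3 t / 6 * h ^ 3"
      using t by (simp add: d_def[of 0] d_def[of "Suc 0"] d_def[of 2])
    moreover define Q where "Q = Psi u * (1 - Psi u)"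
    ultimately have "ln (1 + exp (u + h)) = ln (1 + exp u) + Psi u * h + Q / 2 * h\<^sup>2 + d 3 t / 6 * h ^ 3" by simp
    then show ?thesis unfolding Q_def[symmetric] by (simp add: mult.commute)
  qed
  also have "\<bar>\<dots>\<bar> \<le> 1 * \<bar>h\<bar> ^ 3"
  proof -
    have P: "0 \<le> Psi t" "Psi t \<le> 1" using Psi_pos[of t] Psi_less_1[of t] by auto
    have "\<bar>d 3 t\<bar> = Psi t * (1 - Psi t) * \<bar>1 - 2 * Psi t\<bar>" using P by (simp add: d_def abs_mult)
    also have "\<dots> \<le> 1 * 1 * 1" using P by (intro mult_mono) auto
    finally have "\<bar>d 3 t / 6\<bar> \<le> 1" by simp
    then have "\<bar>d 3 t / 6\<bar> * \<bar>h ^ 3\<bar> \<le> 1 * \<bar>h ^ 3\<bar>" by (intro mult_right_mono) auto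
    then show ?thesis by (simp add: abs_mult power_abs)
  qed
  finally show ?thesis by simp
qed simp

lemma exp_taylor2:
  fixes x :: real
  assumes "\<bar>x\<bar> \<le> 1"
  shows "\<bar>exp x - 1 - x - x\<^sup>2 / 2\<bar> \<le> \<bar>x\<bar> ^ 3"
proof -
  obtain t where t: "\<bar>t\<bar> \<le> \<bar>x\<bar>" "exp x = (\<Sum>m<3. x ^ m / fact m) + exp t / fact 3 * x ^ 3"
    using Maclaurin_exp_le[of x 3] by blast
  have "exp x - 1 - x - x\<^sup>2 / 2 = exp t / 6 * x ^ 3"
    using t(2) by (simp add: eval_nat_numeral fact_numeral)
  also have "\<bar>\<dots>\<bar> \<le> 1 * \<bar>x\<bar> ^ 3"
  proof -
    have "exp t \<le> exp 1" using t(1) assms by simp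
    also have "\<dots> \<le> 3" by (rule exp_le)
    finally have "exp t / 6 \<le> 1" by simp
    then have "exp t / 6 * \<bar>x ^ 3\<bar> \<le> 1 * \<bar>x ^ 3\<bar>" by (intro mult_right_mono) auto
    then show ?thesis by (simp add: abs_mult power_abs)
  qed
  finally show ?thesis by simp
qed

text \<open>Centering \<open>\<xi>\<close> at its mean removes the linear term before the logarithm
  is expanded. The constant is the same for every density \<open>f\<close>, which makes the bound
  uniform over the prior.\<close>

lemma cumulant_taylor:
  fixes f \<xi> :: "'z \<Rightarrow> real"
  assumes f: "integrable N f" "(\<integral>z. f z \<partial>N) = 1" "\<And>z. 0 \<le> f z"
    and \<xi>[measurable]: "\<xi> \<in> borel_measurable N" and bd: "AE z in N. 0 \<le> \<xi> z \<and> \<xi> z \<le> 1"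
    and s: "\<bar>s\<bar> \<le> 1 / 2"
  defines "m \<equiv> (\<integral>z. f z * \<xi> z \<partial>N)"
  shows "\<bar>ln (\<integral>z. f z * exp (- s * \<xi> z) \<partial>N) + s * m - s\<^sup>2 / 2 * ((\<integral>z. f z * (\<xi> z)\<^sup>2 \<partial>N) - m\<^sup>2)\<bar> \<le> 3 * \<bar>s\<bar> ^ 3"
    and "0 < (\<integral>z. f z * exp (- s * \<xi> z) \<partial>N)"
proof -
  have [measurable]: "f \<in> borel_measurable N" using f(1) by simp
  have i: "integrable N (\<lambda>z. f z * g z)" if [measurable]: "g \<in> borel_measurable N" and "AE z in N. \<bar>g z\<bar> \<le> K" for g K
  proof (rule Bochner_Integration.integrable_bound)
    show "integrable N (\<lambda>z. f z * K)" using f(1) by simp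
    show "AE z in N. norm (f z * g z) \<le> norm (f z * K)"
      using that(2) by eventually_elim (use f(3) in \<open>auto simp: abs_mult intro!: mult_left_mono\<close>)
  qed simp
  have i1: "integrable N (\<lambda>z. f z * \<xi> z)" by (intro i[where K = 1] eventually_mono[OF bd]) auto
  have i2: "integrable N (\<lambda>z. f z * (\<xi> z)\<^sup>2)"
    by (intro i[where K = 1] eventually_mono[OF bd]) (auto simp: abs_square_le_1)
  have m: "0 \<le> m" "m \<le> 1"
  proof -
    show "0 \<le> m" unfolding m_def using f(3) by (intro integral_nonneg_AE eventually_mono[OF bd]) auto
    have "m \<le> (\<integral>z. f z \<partial>N)" unfolding m_def using f i1
      by (intro integral_mono_AE eventually_mono[OF bd]) (auto intro!: mult_left_le)
    then show "m \<le> 1" using f(2) by simp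
  qed
  define y where "y z = \<xi> z - m" for z
  have [measurable]: "y \<in> borel_measurable N" unfolding y_def by measurable
  have y: "AE z in N. \<bar>y z\<bar> \<le> 1" using bd by eventually_elim (use m in \<open>auto simp: y_def\<close>)
  have iy: "integrable N (\<lambda>z. f z * y z)" by (rule i[OF _ y]) simp
  have iy2: "integrable N (\<lambda>z. f z * (y z)\<^sup>2)"
    by (intro i[where K = 1] eventually_mono[OF y]) (auto simp: abs_square_le_1)
  have ye: "AE z in N. \<bar>exp (- s * y z)\<bar> \<le> exp 1"
    using y
  proof eventually_elim
    case (elim z)
    have "\<bar>s\<bar> * \<bar>y z\<bar> \<le> 1 * 1" using elim s by (intro mult_mono) auto
    then have "- s * y z \<le> 1" by (simp flip: abs_mult add: abs_le_iff)
    then show ?case by simp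
  qed
  have ie: "integrable N (\<lambda>z. f z * exp (- s * y z))" by (rule i[OF _ ye]) simp
  define v where "v = (\<integral>z. f z * (y z)\<^sup>2 \<partial>N)"
  have v_eq: "v = (\<integral>z. f z * (\<xi> z)\<^sup>2 \<partial>N) - m\<^sup>2"
  proof -
    have "v = (\<integral>z. f z * (\<xi> z)\<^sup>2 - 2 * m * (f z * \<xi> z) + m\<^sup>2 * f z \<partial>N)"
      unfolding v_def y_def by (simp add: power2_diff algebra_simps)
    also have "\<dots> = (\<integral>z. f z * (\<xi> z)\<^sup>2 \<partial>N) - 2 * m * m + m\<^sup>2"
      using i1 i2 f unfolding m_def by simp
    finally show ?thesis by (simp add: power2_eq_square)
  qed
  have v01: "0 \<le> v" "v \<le> 1"
  proof -
    show "0 \<le> v" unfolding v_def using f(3) by (intro integral_nonneg_AE) auto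
    have "v \<le> (\<integral>z. f z \<partial>N)" unfolding v_def using f iy2
      by (intro integral_mono_AE eventually_mono[OF y]) (auto intro!: mult_left_le simp: abs_square_le_1)
    then show "v \<le> 1" using f(2) by simp
  qed
  have y0: "(\<integral>z. f z * y z \<partial>N) = 0"
    using i1 f unfolding y_def by (simp add: right_diff_distrib m_def[symmetric])
  define E where "E = (\<integral>z. f z * exp (- s * y z) \<partial>N)"
  have E: "\<bar>E - 1 - s\<^sup>2 / 2 * v\<bar> \<le> \<bar>s\<bar> ^ 3"
  proof -
    have "E - 1 - s\<^sup>2 / 2 * v = (\<integral>z. f z * exp (- s * y z) - f z + s * (f z * y z) - s\<^sup>2 / 2 * (f z * (y z)\<^sup>2) \<partial>N)"
      unfolding E_def v_def using ie f iy iy2 y0 by simp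
    also have "\<dots> = (\<integral>z. f z * (exp (- s * y z) - 1 - (- s * y z) - (- s * y z)\<^sup>2 / 2) \<partial>N)"
    proof (rule Bochner_Integration.integral_cong[OF refl])
      have "c * e - c + s * (c * x) - s\<^sup>2 / 2 * (c * x\<^sup>2) = c * (e - 1 - (- s * x) - (- s * x)\<^sup>2 / 2)" for c e x :: real
        by (simp add: power2_eq_square algebra_simps)
      then show "f z * exp (- s * y z) - f z + s * (f z * y z) - s\<^sup>2 / 2 * (f z * (y z)\<^sup>2)
          = f z * (exp (- s * y z) - 1 - (- s * y z) - (- s * y z)\<^sup>2 / 2)" for z .
    qed
    finally have "\<bar>E - 1 - s\<^sup>2 / 2 * v\<bar> \<le> (\<integral>z. \<bar>f z * (exp (- s * y z) - 1 - (- s * y z) - (- s * y z)\<^sup>2 / 2)\<bar> \<partial>N)"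
      by (simp only: integral_abs_bound)
    also have "\<dots> \<le> (\<integral>z. f z * \<bar>s\<bar> ^ 3 \<partial>N)"
    proof (rule integral_mono_AE)
      have ae: "AE z in N. \<bar>exp (- s * y z) - 1 - (- s * y z) - (- s * y z)\<^sup>2 / 2\<bar> \<le> \<bar>s\<bar> ^ 3"
        using y
      proof eventually_elim
        case (elim z)
        have sy: "\<bar>- s * y z\<bar> \<le> \<bar>s\<bar>" using mult_left_le[OF elim, of "\<bar>s\<bar>"] by (simp add: abs_mult)
        have "\<bar>exp (- s * y z) - 1 - (- s * y z) - (- s * y z)\<^sup>2 / 2\<bar> \<le> \<bar>- s * y z\<bar> ^ 3"
          using sy s by (intro exp_taylor2) linarith
        also have "\<dots> \<le> \<bar>s\<bar> ^ 3" using sy by (intro power_mono) auto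
        finally show ?case .
      qed
      then show "AE z in N. \<bar>f z * (exp (- s * y z) - 1 - (- s * y z) - (- s * y z)\<^sup>2 / 2)\<bar> \<le> f z * \<bar>s\<bar> ^ 3"
        by eventually_elim (use f(3) in \<open>auto simp: abs_mult intro!: mult_left_mono\<close>)
      show "integrable N (\<lambda>z. \<bar>f z * (exp (- s * y z) - 1 - (- s * y z) - (- s * y z)\<^sup>2 / 2)\<bar>)"
        using ae by (intro integrable_abs i[where K = "\<bar>s\<bar> ^ 3"]) auto
    qed (use f in simp)
    finally show ?thesis using f(2) by simp
  qed
  define X where "X = E - 1"
  have s3: "\<bar>s\<bar> ^ 3 \<le> \<bar>s\<bar>\<^sup>2 / 2"
    using mult_right_mono[OF s, of "\<bar>s\<bar>\<^sup>2"] by (simp add: eval_nat_numeral)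
  have s2: "\<bar>s\<bar>\<^sup>2 \<le> 1 / 4"
    using mult_mono[OF s s] by (simp add: power2_eq_square)
  have vs: "s\<^sup>2 / 2 * v \<le> s\<^sup>2 / 2" "0 \<le> s\<^sup>2 / 2 * v" using v01 by (auto intro!: mult_left_le)
  \<comment> \<open>\<open>E\<close> differs from 1 by at most \<open>\<bar>s\<bar>\<^sup>2\<close>,
    half from the cubic remainder and half from the variance term. The logarithm then adds at most
    \<open>2 * X\<^sup>2\<close>, hence at most \<open>2 * \<bar>s\<bar> ^ 3\<close>, to the
    remainder of the exponential; this gives the constant 3.\<close>
  have X: "\<bar>X\<bar> \<le> \<bar>s\<bar>\<^sup>2" using E s3 vs unfolding X_def power2_abs by linarith
  then have X2: "\<bar>X\<bar> \<le> 1 / 2" using s2 by linarith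
  have "\<bar>ln (1 + X) - X\<bar> \<le> 2 * X\<^sup>2" by (rule abs_ln_one_plus_x_minus_x_bound[OF X2])
  also have "\<dots> \<le> 2 * \<bar>s\<bar> ^ 3"
  proof -
    have "X\<^sup>2 = \<bar>X\<bar> * \<bar>X\<bar>" by (simp add: power2_eq_square)
    also have "\<dots> \<le> \<bar>s\<bar>\<^sup>2 * \<bar>s\<bar>\<^sup>2" using X by (intro mult_mono) auto
    also have "\<dots> = \<bar>s\<bar> ^ 3 * \<bar>s\<bar>" by (simp add: eval_nat_numeral)
    also have "\<dots> \<le> \<bar>s\<bar> ^ 3" using s by (intro mult_left_le) auto
    finally show ?thesis by simp
  qed
  finally have lnE: "\<bar>ln E - s\<^sup>2 / 2 * v\<bar> \<le> 3 * \<bar>s\<bar> ^ 3" using E by (simp add: X_def)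
  have Epos: "0 < E" using X2 unfolding X_def abs_le_iff by linarith
  have shift: "(\<integral>z. f z * exp (- s * \<xi> z) \<partial>N) = exp (- s * m) * E"
  proof -
    have "f z * exp (- s * \<xi> z) = exp (- s * m) * (f z * exp (- s * y z))" for z
    proof -
      have "- s * \<xi> z = - s * m + - s * y z" by (simp add: y_def algebra_simps)
      then have "exp (- s * \<xi> z) = exp (- s * m) * exp (- s * y z)" by (simp only: exp_add)
      then show ?thesis by simp
    qed
    then show ?thesis unfolding E_def by (simp only: integral_mult_right_zero)
  qed
  then show "0 < (\<integral>z. f z * exp (- s * \<xi> z) \<partial>N)" using Epos by simp
  show "\<bar>ln (\<integral>z. f z * exp (- s * \<xi> z) \<partial>N) + s * m - s\<^sup>2 / 2 * ((\<integral>z. f z * (\<xi> z)\<^sup>2 \<partial>N) - m\<^sup>2)\<bar> \<le> 3 * \<bar>s\<bar> ^ 3"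
    unfolding shift v_eq[symmetric] using Epos lnE by (simp add: ln_mult)
qed

subsection \<open>The likelihood ratio along the perturbed parameter\<close>

lemma borel_measurable_Psi[measurable]: "Psi \<in> borel_measurable borel"
  unfolding Psi_def [abs_def] by measurable

locale mar_bayes = mar_model N a0 b0 f0 \<delta>
  for N :: "'z measure" and a0 b0 f0 :: "'z \<Rightarrow> real" and \<delta> :: real +
  fixes Prior :: "'z param measure"
  assumes prior: "is_prior N Prior"
begin

sublocale Prior: prob_space Prior
  using prior by (simp add: is_prior_def)

lemma eta_a_joint[measurable]: "(\<lambda>(\<eta>, z). fst \<eta> z) \<in> borel_measurable (Prior \<Otimes>\<^sub>M N)"
  and eta_b_joint[measurable]: "(\<lambda>(\<eta>, z). fst (snd \<eta>) z) \<in> borel_measurable (Prior \<Otimes>\<^sub>M N)"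
  and eta_f_joint[measurable]: "(\<lambda>(\<eta>, z). snd (snd \<eta>) z) \<in> borel_measurable (Prior \<Otimes>\<^sub>M N)"
  and exp_eta_f_integrable: "\<eta> \<in> space Prior \<Longrightarrow> integrable N (\<lambda>z. exp (snd (snd \<eta>) z))"
  using prior by (auto simp: is_prior_def)

lemma section_measurable:
  assumes "(\<lambda>(\<eta>, z). g \<eta> z) \<in> borel_measurable (Prior \<Otimes>\<^sub>M N)"
  shows "\<eta> \<in> space Prior \<Longrightarrow> g \<eta> \<in> borel_measurable N"
    and "z \<in> space N \<Longrightarrow> (\<lambda>\<eta>. g \<eta> z) \<in> borel_measurable Prior"
  using measurable_compose[OF measurable_Pair1' assms] measurable_compose[OF measurable_Pair2' assms] by auto

lemma par_b_joint[measurable]: "(\<lambda>(\<eta>, z). par_b \<eta> z) \<in> borel_measurable (Prior \<Otimes>\<^sub>M N)"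
proof -
  have "(\<lambda>p. Psi (case p of (\<eta>, z) \<Rightarrow> fst (snd \<eta>) z)) \<in> borel_measurable (Prior \<Otimes>\<^sub>M N)" by measurable
  then show ?thesis by (simp add: par_b_def split_beta')
qed

lemma par_f_joint[measurable]: "(\<lambda>(\<eta>, z). par_f N \<eta> z) \<in> borel_measurable (Prior \<Otimes>\<^sub>M N)"
proof -
  have e: "(\<lambda>(\<eta>, z). exp (snd (snd \<eta>) z)) \<in> borel_measurable (Prior \<Otimes>\<^sub>M N)"
  proof -
    have "(\<lambda>p. exp (case p of (\<eta>, z) \<Rightarrow> snd (snd \<eta>) z)) \<in> borel_measurable (Prior \<Otimes>\<^sub>M N)" by measurable
    then show ?thesis by (simp add: split_beta')
  qed
  have "(\<lambda>\<eta>. \<integral>u. exp (snd (snd \<eta>) u) \<partial>N) \<in> borel_measurable Prior"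
    by (rule N.borel_measurable_lebesgue_integral[OF e])
  then have "(\<lambda>p. \<integral>u. exp (snd (snd (fst p)) u) \<partial>N) \<in> borel_measurable (Prior \<Otimes>\<^sub>M N)"
    by (rule measurable_compose[OF measurable_fst])
  with e show ?thesis unfolding par_f_def by (simp add: split_beta')
qed

lemma b_measurable: "\<eta> \<in> space Prior \<Longrightarrow> par_b \<eta> \<in> borel_measurable N"
  and f_measurable: "\<eta> \<in> space Prior \<Longrightarrow> par_f N \<eta> \<in> borel_measurable N"
  by (rule section_measurable; measurable)+

lemma par_b_01: "0 < par_b \<eta> z" "par_b \<eta> z < 1"
  by (simp_all add: par_b_def Psi_pos Psi_less_1)

lemma exp_eta_f_pos:
  assumes "\<eta> \<in> space Prior"
  shows "0 < (\<integral>u. exp (snd (snd \<eta>) u) \<partial>N)"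
proof -
  have "(\<integral>u. exp (snd (snd \<eta>) u) \<partial>N) \<noteq> 0"
  proof
    assume "(\<integral>u. exp (snd (snd \<eta>) u) \<partial>N) = 0"
    then have "AE z in N. exp (snd (snd \<eta>) z) = 0"
      using exp_eta_f_integrable[OF assms] by (subst (asm) integral_nonneg_eq_0_iff_AE) auto
    \<comment> \<open>A positive function vanishing almost everywhere makes \<open>N\<close> null,
      contrary to \<open>f0\<close> having integral 1.\<close>
    then have "AE z in N. f0 z = 0" by eventually_elim simp
    then have "(\<integral>z. f0 z \<partial>N) = 0" by (rule integral_eq_zero_AE)
    then show False by (simp add: f0_integral)
  qed
  moreover have "0 \<le> (\<integral>u. exp (snd (snd \<eta>) u) \<partial>N)" by simp
  ultimately show ?thesis by linarith
qed

lemma par_f_density: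
  assumes "\<eta> \<in> space Prior"
  shows "integrable N (par_f N \<eta>)" "(\<integral>z. par_f N \<eta> z \<partial>N) = 1" "0 < par_f N \<eta> z"
  using exp_eta_f_integrable[OF assms] exp_eta_f_pos[OF assms] unfolding par_f_def by auto

lemma integrable_par_f:
  assumes \<eta>: "\<eta> \<in> space Prior" and g: "g \<in> borel_measurable N" "AE z in N. \<bar>g z\<bar> \<le> K"
  shows "integrable N (\<lambda>z. par_f N \<eta> z * g z)"
proof (rule Bochner_Integration.integrable_bound)
  show "integrable N (\<lambda>z. par_f N \<eta> z * K)" using par_f_density[OF \<eta>] by simp
  show "AE z in N. norm (par_f N \<eta> z * g z) \<le> norm (par_f N \<eta> z * K)"
    using g(2) by eventually_elim (use par_f_density(3)[OF \<eta>] in \<open>auto simp: abs_mult less_imp_le intro!: mult_left_mono\<close>)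
qed (use g(1) f_measurable[OF \<eta>] in measurable)

lemma xi_f_eq: "xi_f N b0 f0 z = b0 z - chi N b0 f0"
proof -
  have "(\<integral>u. b0 u \<partial>density N (\<lambda>u. ennreal (f0 u))) = (\<integral>u. f0 u *\<^sub>R b0 u \<partial>N)"
    by (rule integral_density) (use eventually_mono[OF good_bounds] in auto)
  then show ?thesis by (simp add: xi_f_def chi_def mult.commute)
qed

text \<open>The Laplace transform of \<open>b0\<close> under the density
  \<open>par_f N \<eta>\<close>; its logarithm is the cumulant generating function at
  \<open>- s\<close>.\<close>

definition tilt :: "real \<Rightarrow> 'z param \<Rightarrow> real" where
  "tilt s \<eta> = (\<integral>z. par_f N \<eta> z * exp (- s * b0 z) \<partial>N)"

text \<open>The log density ratio along \<open>eta_t\<close>, with \<open>s\<close> for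
  \<open>t / sqrt n\<close>. The factor involving \<open>par_a\<close> is common to both densities
  and cancels.\<close>

definition log_ratio :: "real \<Rightarrow> 'z param \<Rightarrow> 'z obs \<Rightarrow> real" where
  "log_ratio s \<eta> = (\<lambda>(z, r, w). - s * a0 z * w
     - r * (ln (1 + exp (fst (snd \<eta>) z - s * a0 z)) - ln (1 + exp (fst (snd \<eta>) z)))
     - s * b0 z - ln (tilt s \<eta>))"

lemma b0_01: "AE z in N. 0 \<le> b0 z \<and> b0 z \<le> 1"
  by (rule eventually_mono[OF bounds]) (use \<delta>_pos in auto)

text \<open>The centering constant of \<open>xi_f\<close> cancels against the normalization, leaving
  an exponential tilt by \<open>b0\<close>. The exponential of the perturbed component already
  integrates to one, so \<open>par_f\<close> divides by 1.\<close>

lemma par_f_eta_t: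
  assumes \<eta>: "\<eta> \<in> space Prior" and s: "s = t / sqrt (real n)" "\<bar>s\<bar> \<le> 1 / 2"
  shows "par_f N (eta_t N a0 b0 f0 n t \<eta>) z = par_f N \<eta> z * exp (- s * b0 z) / tilt s \<eta>"
proof -
  obtain ea eb ef where \<eta>_eq: "\<eta> = (ea, eb, ef)" by (cases \<eta>) auto
  define I where "I = (\<integral>u. exp (ef u) \<partial>N)"
  have I: "0 < I" using exp_eta_f_pos[OF \<eta>] by (simp add: I_def \<eta>_eq)
  define c where "c = exp (s * chi N b0 f0)"
  have T: "0 < tilt s \<eta>" unfolding tilt_def
    using par_f_density[OF \<eta>] b0_01 s(2) less_imp_le by (intro cumulant_taylor(2)) auto
  define J where "J = (\<integral>u. exp (ef u - t * xi_f N b0 f0 u / sqrt (real n)) \<partial>N)"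
  have e: "exp (ef u - t * xi_f N b0 f0 u / sqrt (real n)) = c * I * (par_f N \<eta> u * exp (- s * b0 u))" for u
  proof -
    have "ef u - t * xi_f N b0 f0 u / sqrt (real n) = s * chi N b0 f0 + (ef u + - s * b0 u)"
      unfolding xi_f_eq s(1) by (simp add: diff_divide_distrib right_diff_distrib)
    then have "exp (ef u - t * xi_f N b0 f0 u / sqrt (real n)) = c * (exp (ef u) * exp (- s * b0 u))"
      unfolding c_def by (simp only: exp_add)
    moreover have "exp (ef u) = I * par_f N \<eta> u" using I by (simp add: par_f_def I_def \<eta>_eq)
    ultimately show ?thesis by simp
  qed
  have J: "J = c * I * tilt s \<eta>" unfolding J_def e tilt_def by simp
  have Jpos: "0 < J" using J I T by (simp add: c_def)
  have e3: "exp (snd (snd (eta_t N a0 b0 f0 n t \<eta>)) u) = par_f N \<eta> u * exp (- s * b0 u) / tilt s \<eta>" for u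
  proof -
    have "snd (snd (eta_t N a0 b0 f0 n t \<eta>)) u = (ef u - t * xi_f N b0 f0 u / sqrt (real n)) - ln J"
      by (simp add: eta_t_def \<eta>_eq J_def)
    then have "exp (snd (snd (eta_t N a0 b0 f0 n t \<eta>)) u) = exp (ef u - t * xi_f N b0 f0 u / sqrt (real n)) / J"
      using Jpos by (simp add: exp_diff)
    also have "\<dots> = par_f N \<eta> u * exp (- s * b0 u) / tilt s \<eta>"
      unfolding e J using I by (simp add: c_def)
    finally show ?thesis .
  qed
  show ?thesis
  proof -
    have "(\<integral>u. par_f N \<eta> u * exp (- s * b0 u) / tilt s \<eta> \<partial>N) = tilt s \<eta> / tilt s \<eta>"
      unfolding tilt_def by (rule integral_divide_zero)
    then have "(\<integral>u. par_f N \<eta> u * exp (- s * b0 u) / tilt s \<eta> \<partial>N) = 1" using T by simp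
    then show ?thesis
      unfolding par_f_def[of N "eta_t N a0 b0 f0 n t \<eta>"] e3 by (simp only: div_by_1)
  qed
qed

lemma p_dens_eta_t:
  assumes \<eta>: "\<eta> \<in> space Prior" and s: "s = t / sqrt (real n)" "\<bar>s\<bar> \<le> 1 / 2" and x: "good_obs x"
  shows "p_dens N (eta_t N a0 b0 f0 n t \<eta>) x = p_dens N \<eta> x * exp (log_ratio s \<eta> x)"
proof -
  obtain ea eb ef where \<eta>_eq: "\<eta> = (ea, eb, ef)" by (cases \<eta>) auto
  obtain z r w where x_eq: "x = (z, r, w)" by (cases x) auto
  have T: "0 < tilt s \<eta>" unfolding tilt_def
    using par_f_density[OF \<eta>] b0_01 s(2) less_imp_le by (intro cumulant_taylor(2)) auto
  define \<eta>' where "\<eta>' = eta_t N a0 b0 f0 n t \<eta>"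
  have a: "par_a \<eta>' z = par_a \<eta> z" by (simp add: \<eta>'_def eta_t_def \<eta>_eq par_a_def)
  have b: "par_b \<eta>' z = Psi (eb z - s * a0 z)" by (simp add: \<eta>'_def eta_t_def \<eta>_eq par_b_def s(1))
  have b1: "par_b \<eta> z = Psi (eb z)" by (simp add: \<eta>_eq par_b_def)
  have f: "par_f N \<eta>' z = par_f N \<eta> z * exp (- s * b0 z - ln (tilt s \<eta>))"
    unfolding \<eta>'_def par_f_eta_t[OF \<eta> s] using T by (simp add: exp_diff)
  define D where "D = ln (1 + exp (eb z - s * a0 z)) - ln (1 + exp (eb z))"
  have P1: "Psi (eb z - s * a0 z) = Psi (eb z) * exp (- s * a0 z - D)"
    unfolding Psi_eq_exp(1) D_def exp_add[symmetric] by (simp add: algebra_simps)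
  have P2: "1 - Psi (eb z - s * a0 z) = (1 - Psi (eb z)) * exp (- D)"
    unfolding Psi_eq_exp(2) D_def exp_add[symmetric] by (simp add: algebra_simps)
  have lr: "log_ratio s \<eta> x = - s * a0 z * w - r * D + (- s * b0 z - ln (tilt s \<eta>))"
    by (simp add: log_ratio_def x_eq D_def \<eta>_eq)
  \<comment> \<open>\<open>good_obs\<close> rules out \<open>r = 0\<close> with
    \<open>w = 1\<close>, the case where the natural number subtraction \<open>r - w\<close> would
    be truncated.\<close>
  consider "r = 0" "w = 0" | "r = 1" "w = 0" | "r = 1" "w = 1"
    using x unfolding good_obs_def x_eq by fastforce
  then show ?thesis
    unfolding \<eta>'_def[symmetric] lr
  proof cases
    case 1
    then show "p_dens N \<eta>' x = p_dens N \<eta> x * exp (- s * a0 z * w - r * D + (- s * b0 z - ln (tilt s \<eta>)))"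
      by (simp only: p_dens_def x_eq prod.case a b b1 f) simp
  next
    case 2
    then show "p_dens N \<eta>' x = p_dens N \<eta> x * exp (- s * a0 z * w - r * D + (- s * b0 z - ln (tilt s \<eta>)))"
      by (simp only: p_dens_def x_eq prod.case a b b1 f P2 exp_add) simp
  next
    case 3
    then show "p_dens N \<eta>' x = p_dens N \<eta> x * exp (- s * a0 z * w - r * D + (- s * b0 z - ln (tilt s \<eta>)))"
      by (simp only: p_dens_def x_eq prod.case a b b1 f P1 exp_add) simp
  qed
qed

text \<open>The variance of \<open>b0\<close> under \<open>par_f N \<eta>\<close>, that is, the
  second cumulant in the expansion of \<open>ln (tilt s \<eta>)\<close>.\<close>

definition var_f :: "'z param \<Rightarrow> real" where
  "var_f \<eta> = (\<integral>z. par_f N \<eta> z * (b0 z)\<^sup>2 \<partial>N) - (\<integral>z. par_f N \<eta> z * b0 z \<partial>N)\<^sup>2"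

definition resid :: "'z param \<Rightarrow> 'z \<Rightarrow> real" where
  "resid \<eta> z = par_b \<eta> z - b0 z"

text \<open>Taylor bounds for the two cumulant functions, linearized at \<open>b0\<close> instead of
  \<open>par_b \<eta>\<close>: this produces the influence function and leaves a first order term in
  \<open>resid\<close> with the multiplier \<open>r * a0\<close>. The remainder does not depend on
  \<eta>.\<close>

lemma log_ratio_expansion:
  assumes \<eta>: "\<eta> \<in> space Prior" and s: "\<bar>s\<bar> \<le> 1 / 2" and x: "good_obs (z, r, w)"
  shows "\<bar>log_ratio s \<eta> (z, r, w)
     - (- s * chi_tilde N a0 b0 f0 (z, r, w) + s * (r * a0 z * resid \<eta> z)
        + s * (chi N b0 (par_f N \<eta>) - chi N b0 f0)
        - s\<^sup>2 / 2 * (r * (a0 z)\<^sup>2 * (par_b \<eta> z * (1 - par_b \<eta> z))) - s\<^sup>2 / 2 * var_f \<eta>)\<bar>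
    \<le> \<bar>s\<bar> ^ 3 * (1 / \<delta> ^ 3 + 3)"
proof -
  define m where "m = chi N b0 (par_f N \<eta>)"
  have m: "m = (\<integral>z. par_f N \<eta> z * b0 z \<partial>N)" by (simp add: m_def chi_def mult.commute)
  have T: "\<bar>ln (tilt s \<eta>) + s * m - s\<^sup>2 / 2 * var_f \<eta>\<bar> \<le> 3 * \<bar>s\<bar> ^ 3"
    unfolding tilt_def m var_f_def
    using par_f_density[OF \<eta>] b0_01 s less_imp_le by (intro cumulant_taylor(1)) auto
  define u where "u = fst (snd \<eta>) z"
  have b: "par_b \<eta> z = Psi u" by (simp add: par_b_def u_def)
  define D where "D = ln (1 + exp (u - s * a0 z)) - ln (1 + exp u)"
  define Q where "Q = Psi u * (1 - Psi u)"
  have xs: "r \<in> {0, 1}" "w \<le> r" "1 \<le> a0 z" "a0 z \<le> 1 / \<delta>"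
    using x by (auto simp: good_obs_def)
  have D: "\<bar>D + s * a0 z * Psi u - s\<^sup>2 / 2 * ((a0 z)\<^sup>2 * Q)\<bar> \<le> \<bar>s\<bar> ^ 3 * (1 / \<delta> ^ 3)"
  proof -
    have "\<bar>D - (- s * a0 z) * Psi u - (- s * a0 z)\<^sup>2 / 2 * Q\<bar> \<le> \<bar>- s * a0 z\<bar> ^ 3"
      using softplus_taylor[of u "- s * a0 z"] by (simp add: D_def Q_def)
    also have "\<dots> = \<bar>s\<bar> ^ 3 * a0 z ^ 3" using xs by (simp add: abs_mult power_mult_distrib)
    also have "\<dots> \<le> \<bar>s\<bar> ^ 3 * (1 / \<delta>) ^ 3" using xs by (intro mult_left_mono power_mono) auto
    finally show ?thesis by (simp add: power_mult_distrib power_divide)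
  qed
  have lr: "log_ratio s \<eta> (z, r, w) = - s * a0 z * w - r * D - s * b0 z - ln (tilt s \<eta>)"
    by (simp add: log_ratio_def D_def u_def)
  have rw: "real r * (real w) = real w" using xs by (cases "r = 0") auto
  have ct: "chi_tilde N a0 b0 f0 (z, r, w) = a0 z * w - r * a0 z * b0 z + b0 z - chi N b0 f0"
  proof -
    have "chi_tilde N a0 b0 f0 (z, r, w) = a0 z * (real r * real w) - r * a0 z * b0 z + b0 z - chi N b0 f0"
      by (simp add: chi_tilde_def algebra_simps)
    then show ?thesis by (simp only: rw)
  qed
  have "log_ratio s \<eta> (z, r, w)
     - (- s * chi_tilde N a0 b0 f0 (z, r, w) + s * (r * a0 z * resid \<eta> z)
        + s * (chi N b0 (par_f N \<eta>) - chi N b0 f0)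
        - s\<^sup>2 / 2 * (r * (a0 z)\<^sup>2 * (par_b \<eta> z * (1 - par_b \<eta> z))) - s\<^sup>2 / 2 * var_f \<eta>)
    = - r * (D + s * a0 z * Psi u - s\<^sup>2 / 2 * ((a0 z)\<^sup>2 * Q)) - (ln (tilt s \<eta>) + s * m - s\<^sup>2 / 2 * var_f \<eta>)"
    unfolding lr ct resid_def b m_def[symmetric] Q_def[symmetric] by (simp add: algebra_simps)
  also have "\<bar>\<dots>\<bar> \<le> \<bar>r * (D + s * a0 z * Psi u - s\<^sup>2 / 2 * ((a0 z)\<^sup>2 * Q))\<bar> + \<bar>ln (tilt s \<eta>) + s * m - s\<^sup>2 / 2 * var_f \<eta>\<bar>"
    by simp
  also have "\<dots> \<le> \<bar>s\<bar> ^ 3 * (1 / \<delta> ^ 3) + 3 * \<bar>s\<bar> ^ 3"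
  proof (rule add_mono[OF _ T])
    show "\<bar>r * (D + s * a0 z * Psi u - s\<^sup>2 / 2 * ((a0 z)\<^sup>2 * Q))\<bar> \<le> \<bar>s\<bar> ^ 3 * (1 / \<delta> ^ 3)"
      using xs(1) D \<delta>_pos by auto
  qed
  also have "\<dots> = \<bar>s\<bar> ^ 3 * (1 / \<delta> ^ 3 + 3)" by (simp add: algebra_simps)
  finally show ?thesis .
qed

end

subsection \<open>Uniform control of the empirical remainders\<close>

text \<open>Working with events rather than random variables makes inclusions and union bounds
  direct, without any measurability.\<close>

definition outer_null :: "'a measure \<Rightarrow> (nat \<Rightarrow> 'a set) \<Rightarrow> bool" where
  "outer_null M B \<longleftrightarrow> (\<lambda>n. outer_measure_of M (B n)) \<longlonglongrightarrow> 0"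

lemma tendsto_outer_prob_iff:
  "tendsto_outer_prob M T c \<longleftrightarrow> (\<forall>\<epsilon>>0. outer_null M (\<lambda>n. {x\<in>space M. \<bar>T n x - c\<bar> > \<epsilon>}))"
  by (simp add: tendsto_outer_prob_def outer_null_def)

lemma outer_null_mono:
  assumes "outer_null M B" and "\<forall>\<^sub>F n in sequentially. A n \<subseteq> B n"
  shows "outer_null M A"
  unfolding outer_null_def
proof (rule tendsto_sandwich[OF _ _ tendsto_const])
  show "(\<lambda>n. outer_measure_of M (B n)) \<longlonglongrightarrow> 0" using assms(1) by (simp add: outer_null_def)
  show "\<forall>\<^sub>F n in sequentially. outer_measure_of M (A n) \<le> outer_measure_of M (B n)"
    using assms(2) by eventually_elim (rule outer_measure_of_mono)
qed simp

lemma outer_measure_of_Un_le: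
  "outer_measure_of M (A \<union> B) \<le> outer_measure_of M A + outer_measure_of M B"
proof (cases "A \<subseteq> space M \<and> B \<subseteq> space M")
  case True
  then obtain A' B' where A': "A' \<in> sets M" "A \<subseteq> A'" "outer_measure_of M A = emeasure M A'"
    and B': "B' \<in> sets M" "B \<subseteq> B'" "outer_measure_of M B = emeasure M B'"
    using outer_measure_of_attain by metis
  have "outer_measure_of M (A \<union> B) \<le> outer_measure_of M (A' \<union> B')"
    using A' B' by (intro outer_measure_of_mono) auto
  also have "\<dots> \<le> emeasure M A' + emeasure M B'"
    using A' B' by (simp add: emeasure_subadditive)
  finally show ?thesis using A' B' by simp
next
  case False
  \<comment> \<open>For a set not contained in the space there are no covering sets, and the infimum
    over the empty family is infinite.\<close>
  have "outer_measure_of M X = \<top>" if "\<not> X \<subseteq> space M" for X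
  proof -
    have e: "{C \<in> sets M. X \<subseteq> C} = {}" using that sets.sets_into_space by blast
    show ?thesis unfolding outer_measure_of_def e by simp
  qed
  with False have "outer_measure_of M A = \<top> \<or> outer_measure_of M B = \<top>" by blast
  then show ?thesis by auto
qed

lemma outer_null_Un:
  assumes "outer_null M A" "outer_null M B"
  shows "outer_null M (\<lambda>n. A n \<union> B n)"
  unfolding outer_null_def
proof (rule tendsto_sandwich[OF _ _ tendsto_const])
  show "(\<lambda>n. outer_measure_of M (A n) + outer_measure_of M (B n)) \<longlonglongrightarrow> 0"
    using tendsto_add[of "\<lambda>n. outer_measure_of M (A n)" 0 sequentially] assms by (auto simp: outer_null_def)
qed (auto simp: outer_measure_of_Un_le)

lemma outer_null_finite_UN:
  assumes "finite I" "\<And>i. i \<in> I \<Longrightarrow> outer_null M (A i)"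
  shows "outer_null M (\<lambda>n. \<Union>i\<in>I. A i n)"
  using assms
proof (induction rule: finite_induct)
  case empty
  then show ?case by (simp add: outer_null_def)
next
  case (insert i I)
  then have "outer_null M (\<lambda>n. A i n \<union> (\<Union>i\<in>I. A i n))" by (intro outer_null_Un) auto
  then show ?case by simp
qed

lemma (in finite_measure) outer_null_measure_le:
  assumes "\<forall>\<^sub>F n in sequentially. B n \<in> sets M \<and> measure M (B n) \<le> c n" "c \<longlonglongrightarrow> 0"
  shows "outer_null M B"
  unfolding outer_null_def
proof (rule tendsto_sandwich[OF _ _ tendsto_const])
  show "(\<lambda>n. ennreal (c n)) \<longlonglongrightarrow> 0" using tendsto_ennrealI[OF assms(2)] by simp
  show "\<forall>\<^sub>F n in sequentially. outer_measure_of M (B n) \<le> ennreal (c n)"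
    using assms(1) by eventually_elim (simp add: emeasure_eq_measure ennreal_leI)
qed simp

lemma outer_null_AE:
  assumes "AE x in M. P x"
  shows "outer_null M (\<lambda>n. {x\<in>space M. \<not> P x})"
proof -
  obtain X where X: "{x\<in>space M. \<not> P x} \<subseteq> X" "emeasure M X = 0" "X \<in> sets M"
    using assms by (auto elim: AE_E)
  have "outer_measure_of M {x\<in>space M. \<not> P x} \<le> 0"
    using outer_measure_of_mono[OF X(1), of M] X by simp
  then show ?thesis by (simp add: outer_null_def)
qed

locale bvm_setting = mar_bayes N a0 b0 f0 \<delta> Prior
  for N :: "'z measure" and a0 b0 f0 :: "'z \<Rightarrow> real" and \<delta> :: real and Prior :: "'z param measure" +
  fixes H :: "nat \<Rightarrow> 'z param set"
  assumes H_sets: "\<And>n. H n \<in> sets Prior"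
    and H_b: "(\<lambda>n. SUP \<eta>\<in>H n. l2_norm (density N (\<lambda>z. ennreal (f0 z))) (\<lambda>z. par_b \<eta> z - b0 z)) \<longlonglongrightarrow> 0"
    and H_emp: "tendsto_outer_prob (data_law N a0 b0 f0)
          (\<lambda>n x. SUP \<eta>\<in>H n. \<bar>emp_process (obs_law N a0 b0 f0) n (\<lambda>(z, r, w). par_b \<eta> z - b0 z) x\<bar>) 0"
begin

sublocale sequence_space P0 ..

lemma data_law_eq: "data_law N a0 b0 f0 = S"
  by (simp add: data_law_def)

lemma H_space: "\<eta> \<in> H n \<Longrightarrow> \<eta> \<in> space Prior"
  using H_sets sets.sets_into_space by blast

lemma resid_measurable: "\<eta> \<in> space Prior \<Longrightarrow> resid \<eta> \<in> borel_measurable N"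
  unfolding resid_def [abs_def] using b_measurable by measurable

lemma abs_resid_le: "0 \<le> b0 z \<Longrightarrow> b0 z \<le> 1 \<Longrightarrow> \<bar>resid \<eta> z\<bar> \<le> 1"
  using par_b_01[where \<eta> = \<eta> and z = z] by (simp add: resid_def abs_le_iff)

lemma AE_resid: "AE z in N. \<bar>resid \<eta> z\<bar> \<le> 1"
  using b0_01 by eventually_elim (rule abs_resid_le; simp)

text \<open>Takes the place of the variance bound in \<open>centered_class\<close>.\<close>

definition v :: "nat \<Rightarrow> real" where
  "v n = (SUP \<eta>\<in>H n. l2_norm (density N (\<lambda>z. ennreal (f0 z))) (\<lambda>z. par_b \<eta> z - b0 z))\<^sup>2"

lemma v_nonneg: "0 \<le> v n" by (simp add: v_def)

lemma v_tendsto: "v \<longlonglongrightarrow> 0"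
  unfolding v_def using tendsto_power[OF H_b, of 2] by simp

lemma resid_square_integrable:
  assumes "\<eta> \<in> space Prior"
  shows "integrable N (\<lambda>z. f0 z * (resid \<eta> z)\<^sup>2)"
  by (rule integrable_weighted[where K = 1])
    (use resid_measurable[OF assms] eventually_mono[OF AE_resid] in \<open>auto simp: abs_square_le_1\<close>)

lemma resid_square_le:
  assumes \<eta>: "\<eta> \<in> H n"
  shows "(\<integral>z. f0 z * (resid \<eta> z)\<^sup>2 \<partial>N) \<le> v n"
proof -
  have l2: "l2_norm (density N (\<lambda>z. ennreal (f0 z))) (\<lambda>z. par_b \<eta> z - b0 z) = sqrt (\<integral>z. f0 z * (resid \<eta> z)\<^sup>2 \<partial>N)"
    if "\<eta> \<in> space Prior" for \<eta>
  proof -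
    have "(\<integral>z. (par_b \<eta> z - b0 z)\<^sup>2 \<partial>density N (\<lambda>z. ennreal (f0 z))) = (\<integral>z. f0 z *\<^sub>R (par_b \<eta> z - b0 z)\<^sup>2 \<partial>N)"
      using b_measurable[OF that] eventually_mono[OF good_bounds] by (intro integral_density) auto
    then show ?thesis by (simp add: l2_norm_def resid_def)
  qed
  have nonneg: "0 \<le> (\<integral>z. f0 z * (resid \<eta> z)\<^sup>2 \<partial>N)" for \<eta>
    by (intro integral_nonneg_AE eventually_mono[OF good_bounds]) auto
  have le1: "(\<integral>z. f0 z * (resid \<eta> z)\<^sup>2 \<partial>N) \<le> 1" if "\<eta> \<in> space Prior" for \<eta>
  proof -
    have "(\<integral>z. f0 z * (resid \<eta> z)\<^sup>2 \<partial>N) \<le> (\<integral>z. f0 z \<partial>N)"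
    proof (rule integral_mono_AE[OF resid_square_integrable[OF that] f0_integrable])
      show "AE z in N. f0 z * (resid \<eta> z)\<^sup>2 \<le> f0 z"
        using AE_resid[of \<eta>] good_bounds by eventually_elim (auto intro!: mult_left_le simp: abs_square_le_1)
    qed
    then show ?thesis by (simp add: f0_integral)
  qed
  let ?l = "\<lambda>\<eta>. l2_norm (density N (\<lambda>z. ennreal (f0 z))) (\<lambda>z. par_b \<eta> z - b0 z)"
  have "?l \<eta> \<le> (SUP \<eta>\<in>H n. ?l \<eta>)"
  proof (rule cSUP_upper[OF \<eta>])
    show "bdd_above (?l ` H n)"
      using l2 le1 H_space by (intro bdd_aboveI2[where M = "1 :: real"]) auto
  qed
  then have "(?l \<eta>)\<^sup>2 \<le> v n"
    unfolding v_def using nonneg by (intro power_mono) (auto simp: l2_norm_def)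
  then show ?thesis using nonneg by (simp add: l2[OF H_space[OF \<eta>]])
qed

definition rmean :: "'z param \<Rightarrow> real" where
  "rmean \<eta> = integral\<^sup>L P0 (\<lambda>(z, r, w). resid \<eta> z)"

lemma resid_obs_joint[measurable]: "(\<lambda>(\<eta>, x). resid \<eta> (fst x)) \<in> borel_measurable (Prior \<Otimes>\<^sub>M P0)"
proof -
  have f: "fst \<in> measurable P0 N"
    by (simp add: measurable_cong_sets[OF sets_obs_law refl] obs_space_def)
  have "(\<lambda>p. (fst p, fst (snd p))) \<in> measurable (Prior \<Otimes>\<^sub>M P0) (Prior \<Otimes>\<^sub>M N)"
    by (intro measurable_Pair measurable_fst measurable_compose[OF measurable_snd f])
  from measurable_compose[OF this par_b_joint] measurable_compose[OF measurable_compose[OF measurable_snd f] b0_meas]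
  show ?thesis unfolding resid_def split_beta' by (intro borel_measurable_diff) simp_all
qed

lemma rmean_measurable[measurable]: "rmean \<in> borel_measurable Prior"
  unfolding rmean_def [abs_def] using P0.borel_measurable_lebesgue_integral[OF resid_obs_joint] by (simp add: split_beta')

lemma rmean_eq:
  assumes "\<eta> \<in> space Prior"
  shows "rmean \<eta> = (\<integral>z. f0 z * resid \<eta> z \<partial>N)" "integrable P0 (\<lambda>(z, r, w). resid \<eta> z)"
  unfolding rmean_def using obs_law_integral_z[OF resid_measurable[OF assms] AE_resid] by auto

lemma resid_var:
  assumes \<eta>: "\<eta> \<in> space Prior"
  shows "integrable P0 (\<lambda>x. (resid \<eta> (fst x) - rmean \<eta>)\<^sup>2)"
    "(\<integral>x. (resid \<eta> (fst x) - rmean \<eta>)\<^sup>2 \<partial>P0) = (\<integral>z. f0 z * (resid \<eta> z)\<^sup>2 \<partial>N) - (rmean \<eta>)\<^sup>2"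
    "(rmean \<eta>)\<^sup>2 \<le> (\<integral>z. f0 z * (resid \<eta> z)\<^sup>2 \<partial>N)"
proof -
  have i1: "integrable P0 (\<lambda>x. resid \<eta> (fst x))" using rmean_eq(2)[OF \<eta>] by (simp add: split_beta')
  have m: "rmean \<eta> = (\<integral>x. resid \<eta> (fst x) \<partial>P0)" by (simp add: rmean_def split_beta')
  have sq: "(\<lambda>z. (resid \<eta> z)\<^sup>2) \<in> borel_measurable N" "AE z in N. \<bar>(resid \<eta> z)\<^sup>2\<bar> \<le> 1"
    using resid_measurable[OF \<eta>] eventually_mono[OF AE_resid[of \<eta>]] by (auto simp: abs_square_le_1)
  have i2: "integrable P0 (\<lambda>x. (resid \<eta> (fst x))\<^sup>2)"
    and e2: "(\<integral>x. (resid \<eta> (fst x))\<^sup>2 \<partial>P0) = (\<integral>z. f0 z * (resid \<eta> z)\<^sup>2 \<partial>N)"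
    using obs_law_integral_z[OF sq] by (simp_all add: split_beta')
  show "integrable P0 (\<lambda>x. (resid \<eta> (fst x) - rmean \<eta>)\<^sup>2)"
    using i1 i2 by (simp add: power2_diff)
  show eq: "(\<integral>x. (resid \<eta> (fst x) - rmean \<eta>)\<^sup>2 \<partial>P0) = (\<integral>z. f0 z * (resid \<eta> z)\<^sup>2 \<partial>N) - (rmean \<eta>)\<^sup>2"
    unfolding m e2[symmetric] by (rule P0.variance_eq[OF i1 i2])
  have "0 \<le> (\<integral>x. (resid \<eta> (fst x) - rmean \<eta>)\<^sup>2 \<partial>P0)" by simp
  with eq show "(rmean \<eta>)\<^sup>2 \<le> (\<integral>z. f0 z * (resid \<eta> z)\<^sup>2 \<partial>N)" by linarith
qed

text \<open>The indicator sends parameters outside \<open>H n\<close> to zero, so that the essential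
  supremum under the whole prior is the one over \<open>H n\<close>.\<close>

definition k :: "nat \<Rightarrow> 'z param \<Rightarrow> 'z obs \<Rightarrow> real" where
  "k n \<eta> x = indicator (H n) \<eta> * (resid \<eta> (fst x) - rmean \<eta>)"

lemma k_centered_class:
  assumes t: "0 < t" and nv: "real n * v n \<le> 2 * t\<^sup>2"
  shows "centered_class P0 Prior (k n) (v n) t n"
proof
  have [measurable]: "H n \<in> sets Prior" by (rule H_sets)
  show "(\<lambda>(\<eta>, x). k n \<eta> x) \<in> borel_measurable (Prior \<Otimes>\<^sub>M P0)"
    unfolding k_def by measurable
  fix \<eta> assume \<eta>: "\<eta> \<in> space Prior"
  show "integrable P0 (\<lambda>x. (k n \<eta> x)\<^sup>2)"
    unfolding k_def power_mult_distrib using resid_var(1)[OF \<eta>] by simp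
  have "integrable P0 (\<lambda>x. resid \<eta> (fst x))" using rmean_eq(2)[OF \<eta>] by (simp add: split_beta')
  then show "(\<integral>x. k n \<eta> x \<partial>P0) = 0"
    unfolding k_def using P0.prob_space by (simp add: rmean_def split_beta')
  show "(\<integral>x. (k n \<eta> x)\<^sup>2 \<partial>P0) \<le> v n"
  proof (cases "\<eta> \<in> H n")
    case True
    then have "(\<integral>x. (k n \<eta> x)\<^sup>2 \<partial>P0) \<le> (\<integral>z. f0 z * (resid \<eta> z)\<^sup>2 \<partial>N)"
      using resid_var(2)[OF \<eta>] by (simp add: k_def)
    also have "\<dots> \<le> v n" by (rule resid_square_le[OF True])
    finally show ?thesis .
  qed (simp add: k_def v_nonneg)
qed (use t nv in auto)

lemma rmean_sq_le: "\<eta> \<in> H n \<Longrightarrow> (rmean \<eta>)\<^sup>2 \<le> v n"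
  using resid_var(3)[OF H_space] resid_square_le by (rule order_trans)

text \<open>An essential supremum above a positive level forces some parameter of \<open>H n\<close>
  above it, so the event lies in the one controlled by \<open>H_emp\<close>. The sum is
  \<open>sqrt n\<close> times the empirical process, hence the level
  \<open>sqrt n * \<epsilon>\<close>.\<close>

lemma k_sum_outer_null:
  assumes \<epsilon>: "0 < \<epsilon>"
  shows "outer_null S (\<lambda>n. {x\<in>space S. ess_gt Prior (sqrt n * \<epsilon>) (\<lambda>\<eta>. \<Sum>i<n. k n \<eta> (x i))})"
proof (rule outer_null_mono)
  let ?e = "\<lambda>n \<eta> x. \<bar>emp_process P0 n (\<lambda>(z, r, w). par_b \<eta> z - b0 z) x\<bar>"
  show "outer_null S (\<lambda>n. {x\<in>space S. \<bar>(SUP \<eta>\<in>H n. ?e n \<eta> x) - 0\<bar> > \<epsilon>})"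
    using H_emp \<epsilon> unfolding tendsto_outer_prob_iff data_law_eq by blast
  show "\<forall>\<^sub>F n in sequentially. {x\<in>space S. ess_gt Prior (sqrt n * \<epsilon>) (\<lambda>\<eta>. \<Sum>i<n. k n \<eta> (x i))}
      \<subseteq> {x\<in>space S. \<bar>(SUP \<eta>\<in>H n. ?e n \<eta> x) - 0\<bar> > \<epsilon>}"
    using eventually_gt_at_top[of 0]
  proof eventually_elim
    case (elim n)
    show ?case
    proof (rule subsetI)
      fix x assume "x \<in> {x\<in>space S. ess_gt Prior (sqrt n * \<epsilon>) (\<lambda>\<eta>. \<Sum>i<n. k n \<eta> (x i))}"
      then have x: "x \<in> space S" and gt: "ess_gt Prior (sqrt n * \<epsilon>) (\<lambda>\<eta>. \<Sum>i<n. k n \<eta> (x i))" by auto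
      have "\<exists>\<eta>\<in>space Prior. \<not> \<bar>\<Sum>i<n. k n \<eta> (x i)\<bar> \<le> sqrt n * \<epsilon>"
        using gt unfolding ess_gt_def by (auto intro: AE_I2)
      then obtain \<eta> where \<eta>: "\<eta> \<in> space Prior" "\<not> \<bar>\<Sum>i<n. k n \<eta> (x i)\<bar> \<le> sqrt n * \<epsilon>" by blast
      have \<eta>H: "\<eta> \<in> H n"
        by (rule ccontr) (use \<eta> \<epsilon> in \<open>simp add: k_def\<close>)
      have e: "emp_process P0 n (\<lambda>(z, r, w). par_b \<eta> z - b0 z) x
          = sqrt n * ((\<Sum>i<n. resid \<eta> (fst (x i))) / n - rmean \<eta>)" for \<eta>
        by (simp add: emp_process_def rmean_def resid_def split_beta')
      have "(\<Sum>i<n. k n \<eta> (x i)) = (\<Sum>i<n. resid \<eta> (fst (x i))) - n * rmean \<eta>"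
        using \<eta>H by (simp add: k_def sum_subtractf)
      also have "\<dots> = sqrt n * (sqrt n * ((\<Sum>i<n. resid \<eta> (fst (x i))) / n - rmean \<eta>))"
        using elim by (simp add: mult.assoc[symmetric] right_diff_distrib)
      finally have "sqrt n * \<epsilon> < sqrt n * ?e n \<eta> x"
        using \<eta>(2) by (simp add: e abs_mult)
      then have "\<epsilon> < ?e n \<eta> x" using elim by simp
      also have "\<dots> \<le> (SUP \<eta>\<in>H n. ?e n \<eta> x)"
      proof (rule cSUP_upper[OF \<eta>H])
        \<comment> \<open>The supremum is real and must be bounded at this particular
          \<open>x\<close>. As \<open>b0\<close> lies in the unit interval only almost everywhere,
          the bound involves \<open>b0\<close> at the sample points.\<close>
        show "bdd_above ((\<lambda>\<eta>. ?e n \<eta> x) ` H n)"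
        proof (rule bdd_aboveI2)
          fix \<eta> assume \<eta>: "\<eta> \<in> H n"
          have "(rmean \<eta>)\<^sup>2 \<le> v n" by (rule rmean_sq_le[OF \<eta>])
          then have m: "\<bar>rmean \<eta>\<bar> \<le> sqrt (v n)" by (rule real_le_rsqrt[of "\<bar>rmean \<eta>\<bar>", simplified])
          have "\<bar>resid \<eta> (fst (x i))\<bar> \<le> 1 + \<bar>b0 (fst (x i))\<bar>" for i
            using par_b_01[of \<eta> "fst (x i)"] by (simp add: resid_def) 
          then have "\<bar>\<Sum>i<n. resid \<eta> (fst (x i))\<bar> \<le> (\<Sum>i<n. 1 + \<bar>b0 (fst (x i))\<bar>)"
            by (intro order_trans[OF sum_abs] sum_mono)
          then have "\<bar>(\<Sum>i<n. resid \<eta> (fst (x i))) / n\<bar> \<le> (\<Sum>i<n. 1 + \<bar>b0 (fst (x i))\<bar>) / n"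
            using elim by (simp add: divide_right_mono)
          with m have "\<bar>(\<Sum>i<n. resid \<eta> (fst (x i))) / n - rmean \<eta>\<bar> \<le> (\<Sum>i<n. 1 + \<bar>b0 (fst (x i))\<bar>) / n + sqrt (v n)"
            by linarith
          then show "?e n \<eta> x \<le> sqrt n * ((\<Sum>i<n. 1 + \<bar>b0 (fst (x i))\<bar>) / n + sqrt (v n))"
            unfolding e abs_mult by (simp add: mult_left_mono)
        qed
      qed
      finally show "x \<in> {x\<in>space S. \<bar>(SUP \<eta>\<in>H n. ?e n \<eta> x) - 0\<bar> > \<epsilon>}" using x by auto
    qed
  qed
qed

text \<open>As \<open>v\<close> tends to zero, the Chebyshev condition eventually holds at every
  level proportional to \<open>sqrt n\<close>.\<close>

lemma class_eventually:
  assumes "0 < \<epsilon>"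
  shows "\<forall>\<^sub>F n in sequentially. centered_class P0 Prior (k n) (v n) (sqrt n * \<epsilon>) n"
proof -
  have "0 < \<epsilon>\<^sup>2" using assms by simp
  from eventually_gt_at_top[of "0 :: nat"] order_tendstoD(2)[OF v_tendsto this] show ?thesis
  proof eventually_elim
    case (elim n)
    have "real n * v n \<le> real n * \<epsilon>\<^sup>2" using elim assms by (intro mult_left_mono) auto
    also have "\<dots> \<le> 2 * (sqrt n * \<epsilon>)\<^sup>2" by (simp add: power_mult_distrib)
    finally show ?case using elim assms by (intro k_centered_class) auto
  qed
qed

text \<open>The event defined by the essential supremum is measurable inside
  \<open>centered_class\<close>, so there its outer measure is its probability.\<close>

lemma tau_tendsto:
  assumes "0 < \<epsilon>"
  shows "(\<lambda>n. centered_class.tau P0 Prior (k n) (sqrt n * \<epsilon>) n) \<longlonglongrightarrow> 0"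
proof -
  let ?B = "\<lambda>n. {x\<in>space S. ess_gt Prior (sqrt n * \<epsilon>) (\<lambda>\<eta>. \<Sum>i<n. k n \<eta> (x i))}"
  have s: "\<forall>\<^sub>F n in sequentially. ?B n \<in> sets S"
    using class_eventually[OF assms]
    by eventually_elim (rule centered_class.ess_sum_sets)
  have "(\<lambda>n. outer_measure_of S (?B n)) \<longlonglongrightarrow> ennreal 0"
    using k_sum_outer_null[OF assms] by (simp add: outer_null_def)
  from tendsto_enn2real[OF this] have "(\<lambda>n. enn2real (outer_measure_of S (?B n))) \<longlonglongrightarrow> 0" by simp
  moreover have "\<forall>\<^sub>F n in sequentially. enn2real (outer_measure_of S (?B n)) = centered_class.tau P0 Prior (k n) (sqrt n * \<epsilon>) n"
    using s class_eventually[OF assms]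
    by eventually_elim (simp add: centered_class.tau_def measure_def)
  ultimately show ?thesis by (rule Lim_transform_eventually)
qed

text \<open>The inverse probability weight. Its conditional mean given \<open>Z\<close> is 1, which
  \<open>phi_integral\<close> expresses.\<close>

definition phi :: "'z obs \<Rightarrow> real" where
  "phi = (\<lambda>(z, r, w). real r * a0 z)"

lemma phi_measurable[measurable]: "phi \<in> borel_measurable P0"
  unfolding measurable_cong_sets[OF sets_obs_law refl] phi_def by (rule obs_measurableI) simp

lemma AE_phi: "AE x in P0. 0 \<le> phi x \<and> phi x \<le> 1 / \<delta>"
  using AE_good_obs by eventually_elim (use \<delta>_pos in \<open>auto simp: good_obs_def phi_def\<close>)

lemma phi_integral:
  assumes h: "h \<in> borel_measurable N" "AE z in N. \<bar>h z\<bar> \<le> K"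
  shows "integrable P0 (\<lambda>x. phi x * h (fst x))" "(\<integral>x. phi x * h (fst x) \<partial>P0) = (\<integral>z. f0 z * h z \<partial>N)"
proof -
  have ah: "(\<lambda>z. a0 z * h z) \<in> borel_measurable N" using h(1) by simp
  have bd: "AE z in N. \<bar>a0 z * h z\<bar> \<le> 1 / \<delta> * K"
    using good_bounds h(2) by eventually_elim (auto simp only: abs_mult intro!: mult_mono order_trans[OF abs_ge_zero])
  have e: "(\<lambda>x. phi x * h (fst x)) = (\<lambda>(z, r, w). real r * (a0 z * h z))"
    by (auto simp: phi_def)
  show "integrable P0 (\<lambda>x. phi x * h (fst x))"
    unfolding e by (rule obs_law_integral_r(1)[OF ah bd])
  have "(\<integral>x. phi x * h (fst x) \<partial>P0) = (\<integral>z. f0 z * (a0 z * h z / a0 z) \<partial>N)"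
    unfolding e by (rule obs_law_integral_r(2)[OF ah bd])
  also have "\<dots> = (\<integral>z. f0 z * h z \<partial>N)"
    using h(1) by (intro integral_cong_AE eventually_mono[OF bounds]) auto
  finally show "(\<integral>x. phi x * h (fst x) \<partial>P0) = (\<integral>z. f0 z * h z \<partial>N)" .
qed

lemma AE_S_good: "AE x in S. \<forall>i. good_obs (x i)"
  unfolding AE_all_countable using AE_good_obs by (auto intro: AE_component)

lemma sample_mean_outer_null:
  fixes g :: "'z obs \<Rightarrow> real" and c d :: "nat \<Rightarrow> real"
  assumes g[measurable]: "g \<in> borel_measurable P0" and bd: "AE x in P0. \<bar>g x\<bar> \<le> K"
    and mean: "(\<integral>x. g x \<partial>P0) = 0" and q: "(\<lambda>n. n * (c n)\<^sup>2 / (d n)\<^sup>2) \<longlonglongrightarrow> 0"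
    and d: "\<And>n. 0 < n \<Longrightarrow> 0 < d n"
  shows "outer_null S (\<lambda>n. {x\<in>space S. \<not> \<bar>c n * (\<Sum>i<n. g (x i))\<bar> \<le> d n})"
proof (rule P.outer_null_measure_le)
  have sqb: "AE x in P0. (g x)\<^sup>2 \<le> K\<^sup>2"
    using bd by eventually_elim (rule abs_le_square_iff[THEN iffD1], simp)
  have i: "integrable P0 (\<lambda>x. (g x)\<^sup>2)" by (rule P0.integrable_const_bound[of _ "K\<^sup>2"]) (use sqb in auto)
  have v: "(\<integral>x. (g x)\<^sup>2 \<partial>P0) \<le> K\<^sup>2"
    using integral_mono_AE[OF i _ sqb] P0.prob_space by simp
  show "\<forall>\<^sub>F n in sequentially. {x\<in>space S. \<not> \<bar>c n * (\<Sum>i<n. g (x i))\<bar> \<le> d n} \<in> sets S \<and>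
      \<P>(x in S. \<not> \<bar>c n * (\<Sum>i<n. g (x i))\<bar> \<le> d n) \<le> K\<^sup>2 * (n * (c n)\<^sup>2 / (d n)\<^sup>2)"
    using eventually_gt_at_top[of "0 :: nat"]
  proof eventually_elim
    case (elim n)
    have "{x\<in>space S. \<not> \<bar>c n * (\<Sum>i<n. g (x i))\<bar> \<le> d n} \<in> sets S" by measurable
    moreover have "\<P>(x in S. \<not> \<bar>\<Sum>i<n. 1 * (c n * g (x i))\<bar> \<le> d n) \<le> n * ((c n)\<^sup>2 * K\<^sup>2) / (d n)\<^sup>2"
      by (rule iid_sum_chebyshev) (use i mean v d[OF elim] in \<open>auto simp: power_mult_distrib intro: mult_left_mono\<close>)
    ultimately show ?case by (simp add: sum_distrib_left mult_ac)
  qed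
  show "(\<lambda>n. K\<^sup>2 * (n * (c n)\<^sup>2 / (d n)\<^sup>2)) \<longlonglongrightarrow> 0"
    using tendsto_mult_left[OF q, of "K\<^sup>2"] by (simp only: mult_zero_right)
qed

lemma \<delta>_le_1: "\<delta> \<le> 1"
proof (rule ccontr)
  assume "\<not> \<delta> \<le> 1"
  have "AE z in N. f0 z = 0"
    by (rule eventually_mono[OF bounds]) (use \<open>\<not> \<delta> \<le> 1\<close> in auto)
  then have "(\<integral>z. f0 z \<partial>N) = 0" by (rule integral_eq_zero_AE)
  then show False by (simp add: f0_integral)
qed

text \<open>As \<open>phi\<close> has conditional mean 1, \<open>phi * resid - rmean\<close> splits
  into the centered multiplier process \<open>phi * k\<close>, bounded by contraction, and
  \<open>rmean * (phi - 1)\<close>, whose scalar factor is at most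
  \<open>sqrt (v n)\<close>.\<close>

lemma multiplier_outer_null:
  assumes \<epsilon>: "0 < \<epsilon>"
  shows "outer_null S (\<lambda>n. {x\<in>space S. ess_gt Prior \<epsilon>
    (\<lambda>\<eta>. indicator (H n) \<eta> * ((\<Sum>i<n. phi (x i) * resid \<eta> (fst (x i)) - rmean \<eta>) / sqrt n))})"
proof (rule outer_null_mono)
  \<comment> \<open>Makes the level \<open>16 * C * t\<close> of \<open>ess_multiplier_le\<close>,
    with \<open>C = 1 / \<delta>\<close> and \<open>t = sqrt n * s\<close>, equal to
    \<open>sqrt n * (\<epsilon> / 2)\<close>.\<close>
  define s where "s = \<epsilon> * \<delta> / 32"
  have s: "0 < s" using \<epsilon> \<delta>_pos by (simp add: s_def)
  let ?B1 = "\<lambda>n. {x\<in>space S. ess_gt Prior (16 * (1 / \<delta>) * (sqrt n * s))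
    (\<lambda>\<eta>. \<Sum>i<n. phi (x i) * k n \<eta> (x i) - (\<integral>x. phi x * k n \<eta> x \<partial>P0))}"
  let ?B2 = "\<lambda>n. {x\<in>space S. \<not> \<bar>sqrt (v n) * (\<Sum>i<n. phi (x i) - 1)\<bar> \<le> sqrt n * (\<epsilon> / 2)}"
  have B1: "outer_null S ?B1"
  proof (rule P.outer_null_measure_le)
    show "\<forall>\<^sub>F n in sequentially. ?B1 n \<in> sets S \<and>
        measure S (?B1 n) \<le> 32 * centered_class.tau P0 Prior (k n) (sqrt n * s) n"
      using class_eventually[OF s]
    proof eventually_elim
      case (elim n)
      interpret centered_class P0 Prior "k n" "v n" "sqrt n * s" n by fact
      show ?case using ess_multiplier_sets[OF phi_measurable] ess_multiplier_le[OF phi_measurable AE_phi] \<delta>_pos by simp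
    qed
    show "(\<lambda>n. 32 * centered_class.tau P0 Prior (k n) (sqrt n * s) n) \<longlonglongrightarrow> 0"
      using tendsto_mult_right[OF tau_tendsto[OF s], of 32] by simp
  qed
  have phi1: "integrable P0 phi" "(\<integral>x. phi x \<partial>P0) = 1"
    using phi_integral[of "\<lambda>_. 1" 1] by (simp_all add: f0_integral)
  have B2: "outer_null S ?B2"
  proof (rule sample_mean_outer_null[where K = "1 / \<delta>"])
    show "AE x in P0. \<bar>phi x - 1\<bar> \<le> 1 / \<delta>"
      using AE_phi
    proof eventually_elim
      case (elim x)
      moreover have "1 \<le> 1 / \<delta>" using \<delta>_pos \<delta>_le_1 by simp
      ultimately show ?case by linarith
    qed
    show "(\<integral>x. phi x - 1 \<partial>P0) = 0" using phi1 P0.prob_space by simp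
    show "(\<lambda>n. n * (sqrt (v n))\<^sup>2 / (sqrt n * (\<epsilon> / 2))\<^sup>2) \<longlonglongrightarrow> 0"
    proof (rule Lim_transform_eventually)
      show "(\<lambda>n. v n * (4 / \<epsilon>\<^sup>2)) \<longlonglongrightarrow> 0" using tendsto_mult_right[OF v_tendsto, of "4 / \<epsilon>\<^sup>2"] by (simp only: mult_zero_left)
      show "\<forall>\<^sub>F n in sequentially. v n * (4 / \<epsilon>\<^sup>2) = n * (sqrt (v n))\<^sup>2 / (sqrt n * (\<epsilon> / 2))\<^sup>2"
        using eventually_gt_at_top[of "0 :: nat"]
        by eventually_elim (use \<epsilon> v_nonneg in \<open>simp add: field_simps power2_eq_square\<close>)
    qed
  qed (use \<epsilon> in auto)
  show "outer_null S (\<lambda>n. ?B1 n \<union> ?B2 n)" by (rule outer_null_Un[OF B1 B2])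
  show "\<forall>\<^sub>F n in sequentially. {x\<in>space S. ess_gt Prior \<epsilon>
      (\<lambda>\<eta>. indicator (H n) \<eta> * ((\<Sum>i<n. phi (x i) * resid \<eta> (fst (x i)) - rmean \<eta>) / sqrt n))} \<subseteq> ?B1 n \<union> ?B2 n"
    using eventually_gt_at_top[of "0 :: nat"]
  proof eventually_elim
    case (elim n)
    have sn: "0 < sqrt n" using elim by simp
    show ?case
    proof (rule subsetI, rule ccontr)
      fix x assume x: "x \<in> {x\<in>space S. ess_gt Prior \<epsilon>
        (\<lambda>\<eta>. indicator (H n) \<eta> * ((\<Sum>i<n. phi (x i) * resid \<eta> (fst (x i)) - rmean \<eta>) / sqrt n))}"
        and nx: "x \<notin> ?B1 n \<union> ?B2 n"
      have 1: "AE \<eta> in Prior. \<bar>\<Sum>i<n. phi (x i) * k n \<eta> (x i) - (\<integral>x. phi x * k n \<eta> x \<partial>P0)\<bar> \<le> sqrt n * (\<epsilon> / 2)"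
      proof -
        have es: "16 * (1 / \<delta>) * (sqrt n * s) = sqrt n * (\<epsilon> / 2)" using \<delta>_pos by (simp add: s_def)
        have "\<not> ess_gt Prior (16 * (1 / \<delta>) * (sqrt n * s))
            (\<lambda>\<eta>. \<Sum>i<n. phi (x i) * k n \<eta> (x i) - (\<integral>x. phi x * k n \<eta> x \<partial>P0))"
          using x nx by auto
        then show ?thesis unfolding es ess_gt_def by simp
      qed
      have 2: "\<bar>sqrt (v n) * (\<Sum>i<n. phi (x i) - 1)\<bar> \<le> sqrt n * (\<epsilon> / 2)" using x nx by auto
      have "AE \<eta> in Prior. \<bar>indicator (H n) \<eta> * ((\<Sum>i<n. phi (x i) * resid \<eta> (fst (x i)) - rmean \<eta>) / sqrt n)\<bar> \<le> \<epsilon>"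
        using 1 AE_space
      proof eventually_elim
        case (elim \<eta>)
        show ?case
        proof (cases "\<eta> \<in> H n")
          case True
          note r = phi_integral[OF resid_measurable[OF elim(2)] AE_resid]
          have "(\<integral>x. phi x * k n \<eta> x \<partial>P0) = (\<integral>x. phi x * resid \<eta> (fst x) - rmean \<eta> * phi x \<partial>P0)"
            using True by (simp add: k_def algebra_simps)
          also have "\<dots> = 0" using r phi1 rmean_eq(1)[OF elim(2)] by simp
          finally have z: "(\<integral>x. phi x * k n \<eta> x \<partial>P0) = 0" .
          have "(\<Sum>i<n. phi (x i) * resid \<eta> (fst (x i)) - rmean \<eta>)
              = (\<Sum>i<n. phi (x i) * k n \<eta> (x i)) + rmean \<eta> * (\<Sum>i<n. phi (x i) - 1)"
            unfolding sum_distrib_left sum.distrib[symmetric] using True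
            by (intro sum.cong) (simp_all add: k_def algebra_simps)
          moreover have "\<bar>rmean \<eta> * (\<Sum>i<n. phi (x i) - 1)\<bar> \<le> sqrt n * (\<epsilon> / 2)"
          proof -
            have "\<bar>rmean \<eta>\<bar> \<le> sqrt (v n)"
              by (rule real_le_rsqrt) (use rmean_sq_le[OF True] in simp)
            then have "\<bar>rmean \<eta> * (\<Sum>i<n. phi (x i) - 1)\<bar> \<le> sqrt (v n) * \<bar>\<Sum>i<n. phi (x i) - 1\<bar>"
              unfolding abs_mult by (intro mult_right_mono) auto
            also have "\<dots> = \<bar>sqrt (v n) * (\<Sum>i<n. phi (x i) - 1)\<bar>" using v_nonneg by (simp add: abs_mult)
            finally show ?thesis using 2 by linarith
          qed
          ultimately have "\<bar>\<Sum>i<n. phi (x i) * resid \<eta> (fst (x i)) - rmean \<eta>\<bar> \<le> sqrt n * \<epsilon>"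
            using elim(1) unfolding z by simp
          then show ?thesis using True sn by (simp add: abs_divide pos_divide_le_eq mult.commute)
        qed (use \<epsilon> in simp)
      qed
      then show False using x by (simp add: ess_gt_def)
    qed
  qed
qed

text \<open>Replacing \<open>par_b\<close> by \<open>b0\<close> in the Bernoulli variance costs at
  most the absolute residual, whose empirical mean is bounded through the sum of squares of
  \<open>k\<close>. With \<open>b0\<close> in place, Chebyshev's inequality gives a law of large
  numbers with limit \<open>V1\<close>.\<close>

lemma quadratic_outer_null:
  assumes \<epsilon>: "0 < \<epsilon>"
  shows "outer_null S (\<lambda>n. {x\<in>space S. ess_gt Prior \<epsilon>
    (\<lambda>\<eta>. indicator (H n) \<eta> * ((\<Sum>i<n. phi (x i) * a0 (fst (x i)) * (par_b \<eta> (fst (x i)) * (1 - par_b \<eta> (fst (x i))))) / n - V1))})"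
proof (rule outer_null_mono)
  \<comment> \<open>With the sum of squares at most \<open>32 * n * s\<^sup>2\<close> and
    \<open>\<bar>rmean \<eta>\<bar>\<close> at most \<open>s\<close>, the residuals add up to at
    most \<open>35 / 2 * n * s\<close>. Rounding 35/2 up to 18 and multiplying by
    \<open>1 / \<delta>\<^sup>2\<close> gives \<open>n * (\<epsilon> / 2)\<close>.\<close>
  define s where "s = \<epsilon> * \<delta>\<^sup>2 / 36"
  have s: "0 < s" using \<epsilon> \<delta>_pos by (simp add: s_def)
  define q0 where "q0 z = b0 z * (1 - b0 z)" for z
  let ?B1 = "\<lambda>n. {x\<in>space S. ess_gt Prior (32 * (sqrt n * s)\<^sup>2) (\<lambda>\<eta>. \<Sum>i<n. (k n \<eta> (x i))\<^sup>2)}"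
  let ?B2 = "\<lambda>n. {x\<in>space S. \<not> \<bar>1 * (\<Sum>i<n. phi (x i) * (a0 (fst (x i)) * q0 (fst (x i))) - V1)\<bar> \<le> n * (\<epsilon> / 2)}"
  let ?B3 = "\<lambda>n. {x\<in>space S. \<not> (\<forall>i. good_obs (x i))}"
  have B1: "outer_null S ?B1"
  proof (rule P.outer_null_measure_le)
    show "\<forall>\<^sub>F n in sequentially. ?B1 n \<in> sets S \<and>
        measure S (?B1 n) \<le> 48 * centered_class.tau P0 Prior (k n) (sqrt n * s) n"
      using class_eventually[OF s]
    proof eventually_elim
      case (elim n)
      interpret centered_class P0 Prior "k n" "v n" "sqrt n * s" n by fact
      show ?case using ess_sum_squares_sets ess_sum_squares_le by simp
    qed
    show "(\<lambda>n. 48 * centered_class.tau P0 Prior (k n) (sqrt n * s) n) \<longlonglongrightarrow> 0"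
      using tendsto_mult_right[OF tau_tendsto[OF s], of 48] by simp
  qed
  have q0: "AE z in N. \<bar>q0 z\<bar> \<le> 1"
    using b0_01
  proof eventually_elim
    case (elim z)
    then have "b0 z * (1 - b0 z) \<le> 1 * 1" by (intro mult_mono) auto
    then show ?case using elim by (simp add: q0_def)
  qed
  have [measurable]: "q0 \<in> borel_measurable N" unfolding q0_def by measurable
  have aq: "AE z in N. \<bar>a0 z * q0 z\<bar> \<le> 1 / \<delta>"
    using q0 good_bounds
  proof eventually_elim
    case (elim z)
    have "\<bar>a0 z\<bar> * \<bar>q0 z\<bar> \<le> 1 / \<delta> * 1" using elim \<delta>_pos by (intro mult_mono) auto
    then show ?case by (simp add: abs_mult)
  qed
  note pq = phi_integral[OF _ aq, simplified]
  have fN: "fst \<in> measurable P0 N"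
    by (simp add: measurable_cong_sets[OF sets_obs_law refl] obs_space_def)
  have V1_eq: "(\<integral>x. phi x * (a0 (fst x) * q0 (fst x)) \<partial>P0) = V1"
    using pq(2) by (simp add: V1_def q0_def mult.assoc)
  have B2: "outer_null S ?B2"
  proof (rule sample_mean_outer_null[where K = "1 / \<delta> * (1 / \<delta>) + \<bar>V1\<bar>"])
    show "(\<lambda>x. phi x * (a0 (fst x) * q0 (fst x)) - V1) \<in> borel_measurable P0"
      using fN by measurable
    show "AE x in P0. \<bar>phi x * (a0 (fst x) * q0 (fst x)) - V1\<bar> \<le> 1 / \<delta> * (1 / \<delta>) + \<bar>V1\<bar>"
      using AE_phi AE_good_obs
    proof eventually_elim
      case (elim x)
      obtain z r w where x: "x = (z, r, w)" by (cases x) auto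
      have b: "0 \<le> b0 z" "b0 z \<le> 1" "0 \<le> a0 z" "a0 z \<le> 1 / \<delta>"
        using elim(2) \<delta>_pos by (auto simp: x good_obs_def)
      have "q0 z \<le> 1 * 1" "0 \<le> q0 z"
        unfolding q0_def using b by (intro mult_mono mult_nonneg_nonneg; simp)+
      then have "a0 z * q0 z \<le> 1 / \<delta> * 1" "0 \<le> a0 z * q0 z"
        using b \<delta>_pos by (intro mult_mono mult_nonneg_nonneg; simp)+
      then have "phi x * (a0 z * q0 z) \<le> 1 / \<delta> * (1 / \<delta>)" "0 \<le> phi x * (a0 z * q0 z)"
        using elim(1) \<delta>_pos mult_mono[of "phi x" "1 / \<delta>" "a0 z * q0 z" "1 / \<delta>"]
          mult_nonneg_nonneg[of "phi x" "a0 z * q0 z"] by simp_all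
      then show ?case by (simp add: x)
    qed
    show "(\<integral>x. phi x * (a0 (fst x) * q0 (fst x)) - V1 \<partial>P0) = 0"
      using pq(1) V1_eq P0.prob_space by simp
    have l: "(\<lambda>n. (4 / \<epsilon>\<^sup>2) * (1 / real n)) \<longlonglongrightarrow> 0"
      using tendsto_mult_left[OF lim_const_over_n[of 1], of "4 / \<epsilon>\<^sup>2"] by (simp only: mult_zero_right of_nat_1)
    have "\<forall>\<^sub>F n in sequentially. (4 / \<epsilon>\<^sup>2) * (1 / real n) = real n * 1\<^sup>2 / (n * (\<epsilon> / 2))\<^sup>2"
      using eventually_gt_at_top[of "0 :: nat"]
      by eventually_elim (use \<epsilon> in \<open>simp add: field_simps power2_eq_square\<close>)
    with l show "(\<lambda>n. n * 1\<^sup>2 / (n * (\<epsilon> / 2))\<^sup>2) \<longlonglongrightarrow> 0"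
      by (rule Lim_transform_eventually)
  qed (use \<epsilon> in auto)
  have B3: "outer_null S ?B3" by (rule outer_null_AE[OF AE_S_good])
  show "outer_null S (\<lambda>n. ?B1 n \<union> ?B2 n \<union> ?B3 n)" by (intro outer_null_Un B1 B2 B3)
  have "0 < s\<^sup>2" using s by simp
  show "\<forall>\<^sub>F n in sequentially. {x\<in>space S. ess_gt Prior \<epsilon>
    (\<lambda>\<eta>. indicator (H n) \<eta> * ((\<Sum>i<n. phi (x i) * a0 (fst (x i)) * (par_b \<eta> (fst (x i)) * (1 - par_b \<eta> (fst (x i))))) / n - V1))}
    \<subseteq> ?B1 n \<union> ?B2 n \<union> ?B3 n"
    using eventually_gt_at_top[of "0 :: nat"] order_tendstoD(2)[OF v_tendsto \<open>0 < s\<^sup>2\<close>]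
  proof eventually_elim
    case (elim n)
    note n = \<open>0 < n\<close> and vs = \<open>v n < s\<^sup>2\<close>
    show ?case
    proof (rule subsetI, rule ccontr)
      let ?G = "\<lambda>x \<eta>. indicator (H n) \<eta> * ((\<Sum>i<n. phi (x i) * a0 (fst (x i)) * (par_b \<eta> (fst (x i)) * (1 - par_b \<eta> (fst (x i))))) / n - V1)"
      fix x assume x: "x \<in> {x\<in>space S. ess_gt Prior \<epsilon> (?G x)}" and nx: "x \<notin> ?B1 n \<union> ?B2 n \<union> ?B3 n"
      have 1: "AE \<eta> in Prior. \<bar>\<Sum>i<n. (k n \<eta> (x i))\<^sup>2\<bar> \<le> 32 * (sqrt n * s)\<^sup>2"
        using x nx by (auto simp: ess_gt_def)
      have 2: "\<bar>\<Sum>i<n. phi (x i) * (a0 (fst (x i)) * q0 (fst (x i))) - V1\<bar> \<le> n * (\<epsilon> / 2)" using x nx by auto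
      have good: "good_obs (x i)" for i using x nx by auto
      have "AE \<eta> in Prior. \<bar>?G x \<eta>\<bar> \<le> \<epsilon>"
        using 1
      proof eventually_elim
        case (elim \<eta>)
        show ?case
        proof (cases "\<eta> \<in> H n")
          case True
          let ?z = "\<lambda>i. fst (x i)"
          let ?q = "\<lambda>z. par_b \<eta> z * (1 - par_b \<eta> z)"
          have rm: "\<bar>rmean \<eta>\<bar> \<le> s"
          proof -
            have "\<bar>rmean \<eta>\<bar>\<^sup>2 \<le> s\<^sup>2" using rmean_sq_le[OF True] vs by simp
            then show ?thesis using s by (simp add: abs_le_square_iff[symmetric])
          qed
          \<comment> \<open>The arithmetic-geometric mean inequality at scale \<open>s\<close>
            bounds the residual by its centered square, the quantity controlled by
            \<open>1\<close>.\<close>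
          have res: "\<bar>resid \<eta> (?z i)\<bar> \<le> (k n \<eta> (x i))\<^sup>2 / (2 * s) + 3 / 2 * s" for i
          proof -
            have "0 \<le> (\<bar>k n \<eta> (x i)\<bar> - s)\<^sup>2 / (2 * s)" using s by simp
            also have "\<dots> = (k n \<eta> (x i))\<^sup>2 / (2 * s) + s / 2 - \<bar>k n \<eta> (x i)\<bar>"
              using s by (simp add: power2_diff field_simps power2_eq_square)
            finally have "\<bar>k n \<eta> (x i)\<bar> \<le> (k n \<eta> (x i))\<^sup>2 / (2 * s) + s / 2" by simp
            moreover have "resid \<eta> (?z i) = k n \<eta> (x i) + rmean \<eta>" using True by (simp add: k_def)
            ultimately show ?thesis using rm by linarith
          qed
          have diff: "\<bar>phi (x i) * a0 (?z i) * ?q (?z i) - phi (x i) * (a0 (?z i) * q0 (?z i))\<bar>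
              \<le> 1 / \<delta>\<^sup>2 * \<bar>resid \<eta> (?z i)\<bar>" for i
          proof -
            obtain z r w where xi: "x i = (z, r, w)" by (cases "x i") auto
            have g: "r \<in> {0, 1}" "1 \<le> a0 z" "a0 z \<le> 1 / \<delta>" "0 \<le> b0 z" "b0 z \<le> 1"
              using good[of i] \<delta>_pos by (auto simp: xi good_obs_def)
            have p: "0 \<le> phi (x i)" "phi (x i) \<le> 1 / \<delta>" using g \<delta>_pos by (auto simp: xi phi_def)
            \<comment> \<open>The difference of the two Bernoulli variances factors as
              \<open>resid \<eta> z * (1 - par_b \<eta> z - b0 z)\<close>, and the second factor is
              at most 1 in absolute value.\<close>
            have "phi (x i) * a0 z * ?q z - phi (x i) * (a0 z * q0 z)
                = (phi (x i) * a0 z) * (resid \<eta> z * (1 - par_b \<eta> z - b0 z))"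
              by (simp add: q0_def resid_def algebra_simps)
            also have "\<bar>\<dots>\<bar> = (phi (x i) * a0 z) * (\<bar>resid \<eta> z\<bar> * \<bar>1 - par_b \<eta> z - b0 z\<bar>)"
              using p g by (simp add: abs_mult)
            also have "\<dots> \<le> (1 / \<delta> * (1 / \<delta>)) * (\<bar>resid \<eta> z\<bar> * 1)"
              using p g par_b_01[of \<eta> z] \<delta>_pos by (intro mult_mono) (auto simp: abs_le_iff)
            finally show ?thesis by (simp add: xi power2_eq_square)
          qed
          have "\<bar>(\<Sum>i<n. phi (x i) * a0 (?z i) * ?q (?z i)) - (\<Sum>i<n. phi (x i) * (a0 (?z i) * q0 (?z i)))\<bar>
              \<le> (\<Sum>i<n. 1 / \<delta>\<^sup>2 * \<bar>resid \<eta> (?z i)\<bar>)"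
            unfolding sum_subtractf[symmetric] by (intro order_trans[OF sum_abs] sum_mono diff)
          also have "\<dots> \<le> (\<Sum>i<n. 1 / \<delta>\<^sup>2 * ((k n \<eta> (x i))\<^sup>2 / (2 * s) + 3 / 2 * s))"
            by (intro sum_mono mult_left_mono res) simp
          also have "\<dots> = 1 / \<delta>\<^sup>2 * ((\<Sum>i<n. (k n \<eta> (x i))\<^sup>2) / (2 * s) + n * (3 / 2 * s))"
            by (simp add: sum_distrib_left[symmetric] sum.distrib sum_divide_distrib[symmetric])
          also have "\<dots> \<le> 1 / \<delta>\<^sup>2 * (32 * (sqrt n * s)\<^sup>2 / (2 * s) + n * (3 / 2 * s))"
            using elim s by (intro mult_left_mono add_right_mono divide_right_mono) auto
          also have "\<dots> = 1 / \<delta>\<^sup>2 * (n * (35 / 2 * s))"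
            using s by (simp add: power_mult_distrib power2_eq_square field_simps)
          also have "\<dots> \<le> 1 / \<delta>\<^sup>2 * (n * (18 * s))"
            using s by (intro mult_left_mono) auto
          also have "\<dots> = n * (\<epsilon> / 2)" using \<delta>_pos by (simp add: s_def)
          finally have 3: "\<bar>(\<Sum>i<n. phi (x i) * a0 (?z i) * ?q (?z i)) - (\<Sum>i<n. phi (x i) * (a0 (?z i) * q0 (?z i)))\<bar>
              \<le> n * (\<epsilon> / 2)" .
          have "\<bar>(\<Sum>i<n. phi (x i) * (a0 (?z i) * q0 (?z i))) - n * V1\<bar> \<le> n * (\<epsilon> / 2)"
            using 2 by (simp add: sum_subtractf)
          with 3 have "\<bar>(\<Sum>i<n. phi (x i) * a0 (?z i) * ?q (?z i)) - n * V1\<bar> \<le> n * (\<epsilon> / 2) + n * (\<epsilon> / 2)"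
            by linarith
          then have "\<bar>(\<Sum>i<n. phi (x i) * a0 (?z i) * ?q (?z i)) - n * V1\<bar> \<le> n * \<epsilon>" by (simp add: mult.commute)
          moreover have "(\<Sum>i<n. phi (x i) * a0 (?z i) * ?q (?z i)) / n - V1
              = ((\<Sum>i<n. phi (x i) * a0 (?z i) * ?q (?z i)) - n * V1) / n"
            using n by (simp add: field_simps)
          ultimately have "\<bar>(\<Sum>i<n. phi (x i) * a0 (?z i) * ?q (?z i)) / n - V1\<bar> \<le> \<epsilon>"
            using n by (simp add: abs_divide pos_divide_le_eq mult.commute)
          then show ?thesis using True by simp
        qed (use \<epsilon> in simp)
      qed
      then show False using x by (simp add: ess_gt_def)
    qed
  qed
qed

end

subsection \<open>Posteriors and tilted likelihood ratios\<close>

text \<open>On \<open>Hn\<close>, \<open>L'\<close> is \<open>L * exp (t * Y - c)\<close> up to a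
  factor between \<open>exp (- \<epsilon>)\<close> and \<open>exp \<epsilon>\<close>. A ratio near 1
  therefore says that the Laplace transform of \<open>Y\<close> under the normalized weight
  \<open>L\<close> on \<open>Hn\<close> is near \<open>exp c\<close>.\<close>

lemma mgf_near_of_tilted_ratio:
  fixes L L' Y :: "'p \<Rightarrow> real"
  assumes Hs: "Hn \<in> sets \<Theta>"
    and L: "L \<in> borel_measurable \<Theta>" "\<forall>\<eta>\<in>space \<Theta>. 0 \<le> L \<eta>"
    and Y: "Y \<in> borel_measurable \<Theta>"
    and \<epsilon>: "0 < \<epsilon>" "\<epsilon> \<le> 1 / 2"
    and ratio: "\<bar>(LINT \<eta>:Hn|\<Theta>. L' \<eta>) / (LINT \<eta>:Hn|\<Theta>. L \<eta>) - 1\<bar> \<le> \<epsilon>"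
    and B: "0 < (LINT \<eta>:Hn|\<Theta>. L \<eta>)"
    and near: "AE \<eta> in \<Theta>. \<eta> \<in> Hn \<longrightarrow>
      L \<eta> * exp (t * Y \<eta> - c - \<epsilon>) \<le> L' \<eta> \<and> L' \<eta> \<le> L \<eta> * exp (t * Y \<eta> - c + \<epsilon>)"
  shows "integrable \<Theta> (\<lambda>\<eta>. indicator Hn \<eta> * L \<eta> * exp (t * Y \<eta>))"
    and "\<bar>(\<integral>\<eta>. indicator Hn \<eta> * L \<eta> * exp (t * Y \<eta>) \<partial>\<Theta>) / (LINT \<eta>:Hn|\<Theta>. L \<eta>) - exp c\<bar> \<le> 5 * \<epsilon> * exp c"
proof -
  define A where "A = (LINT \<eta>:Hn|\<Theta>. L' \<eta>)"
  define B where "B = (LINT \<eta>:Hn|\<Theta>. L \<eta>)"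
  define X where "X \<eta> = indicator Hn \<eta> * L \<eta> * exp (t * Y \<eta>)" for \<eta>
  have Bp: "0 < B" using B by (simp add: B_def)
  have AB: "\<bar>A / B - 1\<bar> \<le> \<epsilon>" using ratio by (simp add: A_def B_def)
  \<comment> \<open>The integral of a function that is not integrable is 0 by convention. A ratio
    near 1 excludes this, and so integrability of \<open>L'\<close> on \<open>Hn\<close> is
    obtained.\<close>
  have "A \<noteq> 0" using AB \<epsilon> by auto
  then have iA: "integrable \<Theta> (\<lambda>\<eta>. indicator Hn \<eta> * L' \<eta>)"
    using not_integrable_integral_eq[of \<Theta> "\<lambda>\<eta>. indicator Hn \<eta> *\<^sub>R L' \<eta>"]
    by (auto simp: A_def set_lebesgue_integral_def)
  have A_eq: "A = (\<integral>\<eta>. indicator Hn \<eta> * L' \<eta> \<partial>\<Theta>)" by (simp add: A_def set_lebesgue_integral_def)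
  have lo: "AE \<eta> in \<Theta>. X \<eta> \<le> exp (c + \<epsilon>) * (indicator Hn \<eta> * L' \<eta>)"
    using near
  proof eventually_elim
    case (elim \<eta>)
    show ?case
    proof (cases "\<eta> \<in> Hn")
      case True
      have "L \<eta> * exp (t * Y \<eta>) = exp (c + \<epsilon>) * (L \<eta> * exp (t * Y \<eta> - c - \<epsilon>))"
        by (simp add: exp_add exp_diff)
      also have "\<dots> \<le> exp (c + \<epsilon>) * L' \<eta>" using elim True by (intro mult_left_mono) auto
      finally show ?thesis using True by (simp add: X_def)
    qed (simp add: X_def)
  qed
  have hi: "AE \<eta> in \<Theta>. exp (c - \<epsilon>) * (indicator Hn \<eta> * L' \<eta>) \<le> X \<eta>"
    using near
  proof eventually_elim
    case (elim \<eta>)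
    show ?case
    proof (cases "\<eta> \<in> Hn")
      case True
      have "exp (c - \<epsilon>) * L' \<eta> \<le> exp (c - \<epsilon>) * (L \<eta> * exp (t * Y \<eta> - c + \<epsilon>))"
        using elim True by (intro mult_left_mono) auto
      also have "\<dots> = L \<eta> * exp (t * Y \<eta>)" by (simp add: exp_add exp_diff)
      finally show ?thesis using True by (simp add: X_def)
    qed (simp add: X_def)
  qed
  have Xpos: "0 \<le> X \<eta>" if "\<eta> \<in> space \<Theta>" for \<eta> using L(2) that by (simp add: X_def)
  have iX: "integrable \<Theta> X"
  proof (rule Bochner_Integration.integrable_bound)
    show "integrable \<Theta> (\<lambda>\<eta>. exp (c + \<epsilon>) * (indicator Hn \<eta> * L' \<eta>))" using iA by simp
    show "X \<in> borel_measurable \<Theta>" unfolding X_def using Hs L(1) Y by measurable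
    show "AE \<eta> in \<Theta>. norm (X \<eta>) \<le> norm (exp (c + \<epsilon>) * (indicator Hn \<eta> * L' \<eta>))"
      using lo AE_space by eventually_elim (use Xpos in auto)
  qed
  then show "integrable \<Theta> (\<lambda>\<eta>. indicator Hn \<eta> * L \<eta> * exp (t * Y \<eta>))" by (simp add: X_def[abs_def])
  have up: "(\<integral>\<eta>. X \<eta> \<partial>\<Theta>) \<le> exp (c + \<epsilon>) * A"
    using integral_mono_AE[OF iX _ lo] iA by (simp add: A_eq)
  have dn: "exp (c - \<epsilon>) * A \<le> (\<integral>\<eta>. X \<eta> \<partial>\<Theta>)"
    using integral_mono_AE[OF _ iX hi] iA by (simp add: A_eq)
  have ee: "exp \<epsilon> \<le> 1 + 2 * \<epsilon>" "1 - \<epsilon> \<le> exp (- \<epsilon>)"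
    using exp_bound_lemma[of \<epsilon>] exp_ge_add_one_self[of "- \<epsilon>"] \<epsilon> by auto
  have AB': "A / B \<le> 1 + \<epsilon>" "1 - \<epsilon> \<le> A / B" using AB unfolding abs_le_iff by linarith+
  have "(\<integral>\<eta>. X \<eta> \<partial>\<Theta>) / B \<le> exp (c + \<epsilon>) * A / B" using up Bp by (intro divide_right_mono) auto
  also have "\<dots> = exp c * (exp \<epsilon> * (A / B))" by (simp add: exp_add)
  also have "\<dots> \<le> exp c * ((1 + 2 * \<epsilon>) * (1 + \<epsilon>))"
    using ee AB' \<epsilon> by (intro mult_left_mono mult_mono) auto
  also have "\<dots> \<le> exp c * (1 + 5 * \<epsilon>)"
  proof (rule mult_left_mono)
    have "\<epsilon> * \<epsilon> \<le> \<epsilon> * (1 / 2)" using \<epsilon> by (intro mult_left_mono) auto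
    then show "(1 + 2 * \<epsilon>) * (1 + \<epsilon>) \<le> 1 + 5 * \<epsilon>" using \<epsilon> by (simp add: algebra_simps)
  qed simp
  finally have 1: "(\<integral>\<eta>. X \<eta> \<partial>\<Theta>) / B \<le> exp c * (1 + 5 * \<epsilon>)" .
  have "exp c * (1 - 5 * \<epsilon>) \<le> exp c * ((1 - \<epsilon>) * (1 - \<epsilon>))"
    using \<epsilon> by (intro mult_left_mono) (auto simp: algebra_simps)
  also have "\<dots> \<le> exp c * (exp (- \<epsilon>) * (A / B))"
    using ee AB' \<epsilon> by (intro mult_left_mono mult_mono) auto
  also have "\<dots> = exp (c - \<epsilon>) * A / B" by (simp add: exp_diff exp_minus field_simps)
  also have "\<dots> \<le> (\<integral>\<eta>. X \<eta> \<partial>\<Theta>) / B" using dn Bp by (intro divide_right_mono) auto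
  finally have 2: "exp c * (1 - 5 * \<epsilon>) \<le> (\<integral>\<eta>. X \<eta> \<partial>\<Theta>) / B" .
  show "\<bar>(\<integral>\<eta>. indicator Hn \<eta> * L \<eta> * exp (t * Y \<eta>) \<partial>\<Theta>) / (LINT \<eta>:Hn|\<Theta>. L \<eta>) - exp c\<bar> \<le> 5 * \<epsilon> * exp c"
    using 1 2 unfolding X_def[symmetric] B_def[symmetric] abs_le_iff by (simp add: algebra_simps)
qed

text \<open>Conditioning on a set of posterior mass at least \<open>1 - \<epsilon>\<close> costs at
  most \<open>2 * \<epsilon>\<close>, once for the discarded mass and once for the renormalization.
  The likelihood ratio is controlled only on \<open>Hn\<close>, so Laplace transforms are computed
  under the conditional law \<open>\<nu>\<close>.\<close>

lemma posterior_conditional_bl_dist: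
  fixes L Y :: "'p \<Rightarrow> real" and \<Theta> :: "'p measure" and Hn :: "'p set"
  defines "P \<equiv> density \<Theta> (\<lambda>\<eta>. ennreal (L \<eta> / (\<integral>\<eta>'. L \<eta>' \<partial>\<Theta>)))"
  defines "B \<equiv> (LINT \<eta>:Hn|\<Theta>. L \<eta>)"
  defines "\<nu> \<equiv> distr (density \<Theta> (\<lambda>\<eta>. ennreal (indicator Hn \<eta> * L \<eta> / B))) borel Y"
  assumes Hs[measurable]: "Hn \<in> sets \<Theta>"
    and L[measurable]: "L \<in> borel_measurable \<Theta>" and nonneg: "\<forall>\<eta>\<in>space \<Theta>. 0 \<le> L \<eta>"
    and Y[measurable]: "Y \<in> borel_measurable \<Theta>"
    and post: "\<bar>measure P Hn - 1\<bar> \<le> \<epsilon>" and \<epsilon>: "\<epsilon> < 1"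
    and G: "real_distribution G"
  shows "0 < B" "real_distribution \<nu>" "real_distribution (distr P borel Y)" "bl_dist (distr P borel Y) G \<le> bl_dist \<nu> G + 2 * \<epsilon>"
    and "\<And>t. integrable \<Theta> (\<lambda>\<eta>. indicator Hn \<eta> * L \<eta> * exp (t * Y \<eta>)) \<Longrightarrow>
        integrable \<nu> (\<lambda>x. exp (t * x)) \<and>
        (\<integral>x. exp (t * x) \<partial>\<nu>) = (\<integral>\<eta>. indicator Hn \<eta> * L \<eta> * exp (t * Y \<eta>) \<partial>\<Theta>) / B"
proof -
  have Lpos: "\<And>\<eta>. \<eta> \<in> space \<Theta> \<Longrightarrow> 0 \<le> L \<eta>" using nonneg by blast
  define c where "c = (\<integral>\<eta>'. L \<eta>' \<partial>\<Theta>)"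
  \<comment> \<open>\<open>c\<close> would be 0 for a likelihood that vanishes almost everywhere
    and, by convention, for one that is not integrable. The posterior would then be the null
    measure, against \<open>post\<close>.\<close>
  have c0: "c \<noteq> 0"
  proof
    assume "c = 0"
    then have "measure P Hn = 0" unfolding P_def c_def[symmetric] by (simp add: measure_def emeasure_density)
    then show False using post \<epsilon> by simp
  qed
  have iL: "integrable \<Theta> L" using c0 not_integrable_integral_eq unfolding c_def by blast
  have cpos: "0 < c"
    using c0 integral_nonneg_AE[of L \<Theta>] Lpos by (fastforce simp: c_def)
  have iHL: "integrable \<Theta> (\<lambda>\<eta>. indicator Hn \<eta> * L \<eta>)"
    using integrable_real_mult_indicator[OF Hs iL] by (simp add: mult.commute)
  have B_eq: "B = (\<integral>\<eta>. indicator Hn \<eta> * L \<eta> \<partial>\<Theta>)" by (simp add: B_def set_lebesgue_integral_def)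
  have PH: "measure P Hn = B / c"
  proof -
    have "emeasure P Hn = (\<integral>\<^sup>+\<eta>. ennreal (indicator Hn \<eta> * L \<eta> / c) \<partial>\<Theta>)"
      unfolding P_def c_def[symmetric] using Hs
      by (subst emeasure_density) (auto intro!: nn_integral_cong split: split_indicator)
    also have "\<dots> = ennreal (\<integral>\<eta>. indicator Hn \<eta> * L \<eta> / c \<partial>\<Theta>)"
      using iHL Lpos cpos by (intro nn_integral_eq_integral) (auto intro!: AE_I2 divide_nonneg_pos)
    finally show ?thesis
      using Lpos cpos by (simp add: measure_def B_eq enn2real_ennreal integral_nonneg_AE)
  qed
  have "1 - \<epsilon> \<le> B / c" using post unfolding PH abs_le_iff by linarith
  then have "0 < B / c" using \<epsilon> by linarith
  then show Bpos: "0 < B" using cpos by (simp add: zero_less_divide_iff)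
  have Ble: "B \<le> c"
    unfolding B_eq c_def by (rule integral_mono[OF iHL iL]) (use Lpos in \<open>auto split: split_indicator\<close>)
  let ?Q = "density \<Theta> (\<lambda>\<eta>. ennreal (indicator Hn \<eta> * L \<eta> / B))"
  have wpos: "AE \<eta> in \<Theta>. 0 \<le> indicator Hn \<eta> * L \<eta> / B" using Lpos Bpos by (auto intro!: AE_I2)
  have Qm: "Y \<in> borel_measurable ?Q" by simp
  have "prob_space ?Q"
  proof (rule prob_spaceI)
    have "emeasure ?Q (space ?Q) = (\<integral>\<^sup>+\<eta>. ennreal (indicator Hn \<eta> * L \<eta> / B) \<partial>\<Theta>)"
      by (simp add: emeasure_density cong: nn_integral_cong)
    also have "\<dots> = ennreal (\<integral>\<eta>. indicator Hn \<eta> * L \<eta> / B \<partial>\<Theta>)"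
      using iHL wpos by (intro nn_integral_eq_integral) auto
    also have "\<dots> = 1" using Bpos by (simp add: B_eq[symmetric])
    finally show "emeasure ?Q (space ?Q) = 1" .
  qed
  then interpret Q: prob_space ?Q .
  show \<nu>: "real_distribution \<nu>"
    unfolding \<nu>_def by (rule Q.real_distribution_distr[OF Qm])
  interpret P: prob_space P
  proof (rule prob_spaceI)
    have "emeasure P (space P) = (\<integral>\<^sup>+\<eta>. ennreal (L \<eta> / c) \<partial>\<Theta>)"
      unfolding P_def c_def[symmetric] by (simp add: emeasure_density cong: nn_integral_cong)
    also have "\<dots> = ennreal (\<integral>\<eta>. L \<eta> / c \<partial>\<Theta>)"
      using iL Lpos cpos by (intro nn_integral_eq_integral) (auto intro!: AE_I2)
    also have "\<dots> = 1" using cpos by (simp add: c_def[symmetric])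
    finally show "emeasure P (space P) = 1" .
  qed
  have Pm: "Y \<in> borel_measurable P" by (simp add: P_def)
  show "real_distribution (distr P borel Y)" by (rule P.real_distribution_distr[OF Pm])
  interpret G: real_distribution G by (rule G)
  interpret \<nu>: real_distribution \<nu> by (rule \<nu>)
  show "bl_dist (distr P borel Y) G \<le> bl_dist \<nu> G + 2 * \<epsilon>"
  proof (rule bl_dist_le)
    fix h :: "real \<Rightarrow> real" assume h: "\<And>x. \<bar>h x\<bar> \<le> 1" "1-lipschitz_on UNIV h"
    have hm[measurable]: "h \<in> borel_measurable borel" using h(2) by (rule borel_measurable_lipschitz)
    have iLh: "integrable \<Theta> (\<lambda>\<eta>. L \<eta> * h (Y \<eta>))"
      by (rule Bochner_Integration.integrable_bound[OF iL])
        (use h(1) in \<open>auto simp: abs_mult intro!: mult_left_le\<close>)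
    have iHLh: "integrable \<Theta> (\<lambda>\<eta>. indicator Hn \<eta> * (L \<eta> * h (Y \<eta>)))"
      using integrable_real_mult_indicator[OF Hs iLh] by (simp add: mult.commute)
    have e1: "(\<integral>x. h x \<partial>distr P borel Y) = (\<integral>\<eta>. L \<eta> * h (Y \<eta>) \<partial>\<Theta>) / c"
    proof -
      have "(\<integral>x. h x \<partial>distr P borel Y) = (\<integral>\<eta>. h (Y \<eta>) \<partial>P)" by (rule integral_distr[OF Pm hm])
      also have "\<dots> = (\<integral>\<eta>. (L \<eta> / c) *\<^sub>R h (Y \<eta>) \<partial>\<Theta>)"
        unfolding P_def c_def[symmetric] using Lpos cpos by (intro integral_density) (auto intro!: AE_I2)
      finally show ?thesis by simp
    qed
    have e2: "(\<integral>x. h x \<partial>\<nu>) = (\<integral>\<eta>. indicator Hn \<eta> * (L \<eta> * h (Y \<eta>)) \<partial>\<Theta>) / B"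
    proof -
      have "(\<integral>x. h x \<partial>\<nu>) = (\<integral>\<eta>. h (Y \<eta>) \<partial>?Q)" unfolding \<nu>_def by (rule integral_distr[OF Qm hm])
      also have "\<dots> = (\<integral>\<eta>. (indicator Hn \<eta> * L \<eta> / B) *\<^sub>R h (Y \<eta>) \<partial>\<Theta>)"
        using wpos by (intro integral_density) auto
      finally show ?thesis by (simp add: mult.assoc)
    qed
    define I1 where "I1 = (\<integral>\<eta>. indicator Hn \<eta> * (L \<eta> * h (Y \<eta>)) \<partial>\<Theta>)"
    have d1: "\<bar>(\<integral>\<eta>. L \<eta> * h (Y \<eta>) \<partial>\<Theta>) - I1\<bar> \<le> c - B"
    proof -
      have "(\<integral>\<eta>. L \<eta> * h (Y \<eta>) \<partial>\<Theta>) - I1 = (\<integral>\<eta>. L \<eta> * h (Y \<eta>) - indicator Hn \<eta> * (L \<eta> * h (Y \<eta>)) \<partial>\<Theta>)"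
        unfolding I1_def using iLh iHLh by simp
      then have "\<bar>(\<integral>\<eta>. L \<eta> * h (Y \<eta>) \<partial>\<Theta>) - I1\<bar> \<le> (\<integral>\<eta>. \<bar>L \<eta> * h (Y \<eta>) - indicator Hn \<eta> * (L \<eta> * h (Y \<eta>))\<bar> \<partial>\<Theta>)"
        by (simp only: integral_abs_bound)
      also have "\<dots> \<le> (\<integral>\<eta>. L \<eta> - indicator Hn \<eta> * L \<eta> \<partial>\<Theta>)"
      proof (rule integral_mono)
        fix \<eta> assume "\<eta> \<in> space \<Theta>"
        then show "\<bar>L \<eta> * h (Y \<eta>) - indicator Hn \<eta> * (L \<eta> * h (Y \<eta>))\<bar> \<le> L \<eta> - indicator Hn \<eta> * L \<eta>"
          using Lpos h(1) by (auto simp: abs_mult intro!: mult_left_le split: split_indicator)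
      qed (use iL iHL iLh iHLh in auto)
      also have "\<dots> = c - B" using iL iHL by (simp add: c_def B_eq)
      finally show ?thesis .
    qed
    have d2: "\<bar>I1\<bar> \<le> B"
    proof -
      have "\<bar>I1\<bar> \<le> (\<integral>\<eta>. \<bar>indicator Hn \<eta> * (L \<eta> * h (Y \<eta>))\<bar> \<partial>\<Theta>)" unfolding I1_def by (rule integral_abs_bound)
      also have "\<dots> \<le> (\<integral>\<eta>. indicator Hn \<eta> * L \<eta> \<partial>\<Theta>)"
      proof (rule integral_mono)
        fix \<eta> assume "\<eta> \<in> space \<Theta>"
        then show "\<bar>indicator Hn \<eta> * (L \<eta> * h (Y \<eta>))\<bar> \<le> indicator Hn \<eta> * L \<eta>"
          using Lpos h(1) by (auto simp: abs_mult intro!: mult_left_le split: split_indicator)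
      qed (use iHL iHLh in auto)
      finally show ?thesis by (simp add: B_eq)
    qed
    \<comment> \<open>The first summand is the contribution off \<open>Hn\<close>, the second the
      change of normalization from \<open>c\<close> to \<open>B\<close>; each is at most
      \<open>(c - B) / c\<close>.\<close>
    have "(\<integral>x. h x \<partial>distr P borel Y) - (\<integral>x. h x \<partial>\<nu>)
        = ((\<integral>\<eta>. L \<eta> * h (Y \<eta>) \<partial>\<Theta>) - I1) / c + (I1 / B) * ((B - c) / c)"
      unfolding e1 e2 I1_def[symmetric] using Bpos cpos by (simp add: field_simps)
    also have "\<bar>\<dots>\<bar> \<le> (c - B) / c + 1 * ((c - B) / c)"
    proof (rule order_trans[OF abs_triangle_ineq add_mono])
      show "\<bar>((\<integral>\<eta>. L \<eta> * h (Y \<eta>) \<partial>\<Theta>) - I1) / c\<bar> \<le> (c - B) / c"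
        using d1 cpos by (simp add: abs_divide divide_right_mono)
      have "\<bar>I1 / B\<bar> \<le> 1" using d2 Bpos by (simp add: abs_divide)
      moreover have "\<bar>(B - c) / c\<bar> = (c - B) / c" using Ble cpos by (simp add: abs_divide)
      ultimately show "\<bar>(I1 / B) * ((B - c) / c)\<bar> \<le> 1 * ((c - B) / c)"
        unfolding abs_mult using Ble cpos by (metis abs_ge_zero mult_right_mono)
    qed
    also have "\<dots> \<le> 2 * \<epsilon>"
    proof -
      have "(c - B) / c = 1 - B / c" using cpos by (simp add: diff_divide_distrib)
      then show ?thesis using \<open>1 - \<epsilon> \<le> B / c\<close> by simp
    qed
    finally have a: "\<bar>(\<integral>x. h x \<partial>distr P borel Y) - (\<integral>x. h x \<partial>\<nu>)\<bar> \<le> 2 * \<epsilon>" .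
    have "\<bar>(\<integral>x. h x \<partial>\<nu>) - (\<integral>x. h x \<partial>G)\<bar> \<le> bl_dist \<nu> G"
      unfolding bl_dist_def
    proof (rule cSUP_upper)
      show "h \<in> {h :: real \<Rightarrow> real. (\<forall>x. \<bar>h x\<bar> \<le> 1) \<and> 1-lipschitz_on UNIV h}" using h by simp
      show "bdd_above ((\<lambda>h. \<bar>(\<integral>x. h x \<partial>\<nu>) - (\<integral>x. h x \<partial>G)\<bar>) ` {h :: real \<Rightarrow> real. (\<forall>x. \<bar>h x\<bar> \<le> 1) \<and> 1-lipschitz_on UNIV h})"
        by (rule bl_class_bdd_above[OF \<nu> G])
    qed
    with a show "\<bar>(\<integral>x. h x \<partial>distr P borel Y) - (\<integral>x. h x \<partial>G)\<bar> \<le> bl_dist \<nu> G + 2 * \<epsilon>" by linarith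
  qed
  fix t assume i: "integrable \<Theta> (\<lambda>\<eta>. indicator Hn \<eta> * L \<eta> * exp (t * Y \<eta>))"
  have i': "integrable \<Theta> (\<lambda>\<eta>. (indicator Hn \<eta> * L \<eta> / B) *\<^sub>R exp (t * Y \<eta>))"
    using i by simp
  have em: "(\<lambda>x. exp (t * x)) \<in> borel_measurable borel" by simp
  have "integrable ?Q (\<lambda>\<eta>. exp (t * Y \<eta>))"
    using i' wpos by (subst integrable_density) auto
  then have "integrable \<nu> (\<lambda>x. exp (t * x))"
    unfolding \<nu>_def by (subst integrable_distr_eq[OF Qm em])
  moreover have "(\<integral>x. exp (t * x) \<partial>\<nu>) = (\<integral>\<eta>. exp (t * Y \<eta>) \<partial>?Q)"
    unfolding \<nu>_def by (rule integral_distr[OF Qm em])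
  moreover have "\<dots> = (\<integral>\<eta>. (indicator Hn \<eta> * L \<eta> / B) *\<^sub>R exp (t * Y \<eta>) \<partial>\<Theta>)"
    using wpos by (intro integral_density) auto
  ultimately show "integrable \<nu> (\<lambda>x. exp (t * x)) \<and>
        (\<integral>x. exp (t * x) \<partial>\<nu>) = (\<integral>\<eta>. indicator Hn \<eta> * L \<eta> * exp (t * Y \<eta>) \<partial>\<Theta>) / B"
    by simp
qed

subsection \<open>The posterior expansion and the Bernstein--von Mises theorem\<close>

text \<open>Pure algebra, with \<open>q\<close> for \<open>sqrt n\<close>. Besides the main term
  five errors appear: the expansion of the estimator, the multiplier process, the cross term
  \<open>E4\<close>, and one variance error each for \<open>V1\<close> and
  \<open>V2\<close>.\<close>

lemma expansion_identity:
  fixes q t A Bs Q vf V1 V2 mf c0 rm E4 chat :: real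
  assumes "0 < q"
  shows "- (t / q) * A + (t / q) * Bs + q\<^sup>2 * ((t / q) * (mf - c0)) - (t / q)\<^sup>2 / 2 * Q - q\<^sup>2 * ((t / q)\<^sup>2 / 2 * vf)
    = (t * (q * (mf + rm + E4 - chat)) - t\<^sup>2 / 2 * (V1 + V2))
      + t * (q * (chat - (c0 + A / q\<^sup>2))) + t * ((Bs - q\<^sup>2 * rm) / q) - t * (q * E4)
      - t\<^sup>2 / 2 * (Q / q\<^sup>2 - V1) - t\<^sup>2 / 2 * (vf - V2)"
proof -
  have "q\<^sup>2 / q = q" "(t / q)\<^sup>2 = t\<^sup>2 / q\<^sup>2" "q\<^sup>2 * (t / q) = t * q" "q / q\<^sup>2 = 1 / q"
    using assms by (simp_all add: power2_eq_square)
  then show ?thesis using assms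
    by (simp add: field_simps power2_eq_square)
qed

locale bvm_full = bvm_setting N a0 b0 f0 \<delta> Prior H
  for N :: "'z measure" and a0 b0 f0 :: "'z \<Rightarrow> real" and \<delta> :: real and Prior :: "'z param measure"
    and H :: "nat \<Rightarrow> 'z param set" +
  fixes chihat :: "nat \<Rightarrow> (nat \<Rightarrow> 'z obs) \<Rightarrow> real"
  assumes efficient: "asymp_efficient N a0 b0 f0 chihat"
    and H_post: "tendsto_outer_prob (data_law N a0 b0 f0)
          (\<lambda>n x. measure (posterior N Prior n x) (H n)) 1"
    and H_f: "(\<lambda>n. SUP \<eta>\<in>H n. l1_norm N (\<lambda>z. par_f N \<eta> z - f0 z)) \<longlonglongrightarrow> 0"
    and H_bf: "(\<lambda>n. SUP \<eta>\<in>H n.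
          \<bar>sqrt (real n) * (\<integral>z. (par_b \<eta> z - b0 z) * (par_f N \<eta> z - f0 z) \<partial>N)\<bar>) \<longlonglongrightarrow> 0"
    and ratio: "\<And>t. tendsto_outer_prob (data_law N a0 b0 f0)
          (\<lambda>n x. (LINT \<eta>:H n|Prior. likelihood N n x (eta_t N a0 b0 f0 n t \<eta>))
                 / (LINT \<eta>:H n|Prior. likelihood N n x \<eta>)) 1"
begin

lemma p_dens_measurable:
  assumes "y \<in> space (obs_space N)"
  shows "(\<lambda>\<eta>. p_dens N \<eta> y) \<in> borel_measurable Prior"
proof -
  obtain z r w where y: "y = (z, r, w)" by (cases y) auto
  have z: "z \<in> space N" using assms by (simp add: y obs_space_def space_pair_measure)
  have [measurable]: "(\<lambda>\<eta>. fst \<eta> z) \<in> borel_measurable Prior" "(\<lambda>\<eta>. par_b \<eta> z) \<in> borel_measurable Prior"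
    "(\<lambda>\<eta>. par_f N \<eta> z) \<in> borel_measurable Prior"
    using section_measurable(2)[OF eta_a_joint z] section_measurable(2)[OF par_b_joint z]
      section_measurable(2)[OF par_f_joint z] by auto
  show ?thesis unfolding y p_dens_def par_a_def prod.case by measurable
qed

lemma p_dens_nonneg:
  assumes "\<eta> \<in> space Prior"
  shows "0 \<le> p_dens N \<eta> y"
proof -
  obtain z r w where y: "y = (z, r, w)" by (cases y) auto
  have "0 \<le> 1 / par_a \<eta> z" "0 \<le> 1 - 1 / par_a \<eta> z"
    using Psi_pos[of "fst \<eta> z"] Psi_less_1[of "fst \<eta> z"] by (simp_all add: par_a_def)
  moreover have "0 \<le> par_b \<eta> z" "0 \<le> 1 - par_b \<eta> z" using par_b_01[of \<eta> z] by simp_all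
  ultimately show ?thesis
    unfolding y p_dens_def prod.case using par_f_density(3)[OF assms, of z]
    by (intro mult_nonneg_nonneg zero_le_power) simp_all
qed

lemma likelihood_measurable:
  assumes "x \<in> space S"
  shows "likelihood N n x \<in> borel_measurable Prior"
proof -
  have "x i \<in> space (obs_space N)" for i using assms by (auto simp: space_PiM PiE_iff)
  then show ?thesis unfolding likelihood_def [abs_def]
    by (intro borel_measurable_prod p_dens_measurable)
qed

lemma likelihood_nonneg: "\<eta> \<in> space Prior \<Longrightarrow> 0 \<le> likelihood N n x \<eta>"
  unfolding likelihood_def by (intro prod_nonneg p_dens_nonneg) auto

lemma likelihood_eta_t:
  assumes \<eta>: "\<eta> \<in> space Prior" and s: "s = t / sqrt (real n)" "\<bar>s\<bar> \<le> 1 / 2" and x: "\<And>i. good_obs (x i)"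
  shows "likelihood N n x (eta_t N a0 b0 f0 n t \<eta>) = likelihood N n x \<eta> * exp (\<Sum>i<n. log_ratio s \<eta> (x i))"
  unfolding likelihood_def p_dens_eta_t[OF \<eta> s x] by (simp add: prod.distrib exp_sum)

definition Y :: "nat \<Rightarrow> (nat \<Rightarrow> 'z obs) \<Rightarrow> 'z param \<Rightarrow> real" where
  "Y n x \<eta> = sqrt (real n) * (chi N (par_b \<eta>) (par_f N \<eta>) - chihat n x)"

lemma Y_measurable[measurable]: "Y n x \<in> borel_measurable Prior"
proof -
  have "(\<lambda>p. (case p of (\<eta>, z) \<Rightarrow> par_b \<eta> z) * (case p of (\<eta>, z) \<Rightarrow> par_f N \<eta> z)) \<in> borel_measurable (Prior \<Otimes>\<^sub>M N)"
    by (intro borel_measurable_times par_b_joint par_f_joint)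
  then have "(\<lambda>(\<eta>, z). par_b \<eta> z * par_f N \<eta> z) \<in> borel_measurable (Prior \<Otimes>\<^sub>M N)" by (simp add: split_beta')
  from N.borel_measurable_lebesgue_integral[OF this]
  have "(\<lambda>\<eta>. chi N (par_b \<eta>) (par_f N \<eta>)) \<in> borel_measurable Prior" by (simp add: chi_def)
  then show ?thesis unfolding Y_def [abs_def] by measurable
qed

definition cross :: "'z param \<Rightarrow> real" where
  "cross \<eta> = (\<integral>z. resid \<eta> z * (par_f N \<eta> z - f0 z) \<partial>N)"

lemma abs_b0_le: "AE z in N. \<bar>b0 z\<bar> \<le> 1"
  by (rule eventually_mono[OF good_bounds]) simp

text \<open>Integrates \<open>b * f = b0 * f + (b - b0) * f0 + (b - b0) * (f - f0)\<close>. The last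
  term is the second order bias that \<open>H_bf\<close> keeps below the scale
  \<open>1 / sqrt n\<close>.\<close>

lemma chi_decomposition:
  assumes \<eta>: "\<eta> \<in> space Prior"
  shows "chi N (par_b \<eta>) (par_f N \<eta>) = chi N b0 (par_f N \<eta>) + rmean \<eta> + cross \<eta>"
proof -
  note r = resid_measurable[OF \<eta>]
  have i1: "integrable N (\<lambda>z. par_f N \<eta> z * resid \<eta> z)" by (rule integrable_par_f[OF \<eta> r AE_resid])
  have i2: "integrable N (\<lambda>z. f0 z * resid \<eta> z)" by (rule integrable_weighted[OF r AE_resid])
  have i3: "integrable N (\<lambda>z. par_f N \<eta> z * b0 z)" by (rule integrable_par_f[OF \<eta> b0_meas abs_b0_le])
  have "cross \<eta> = (\<integral>z. par_f N \<eta> z * resid \<eta> z - f0 z * resid \<eta> z \<partial>N)"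
    unfolding cross_def by (simp add: algebra_simps)
  also have "\<dots> = (\<integral>z. par_f N \<eta> z * resid \<eta> z \<partial>N) - rmean \<eta>"
    using i1 i2 rmean_eq(1)[OF \<eta>] by simp
  finally have "chi N b0 (par_f N \<eta>) + rmean \<eta> + cross \<eta>
      = (\<integral>z. par_f N \<eta> z * b0 z \<partial>N) + (\<integral>z. par_f N \<eta> z * resid \<eta> z \<partial>N)"
    by (simp add: chi_def mult.commute)
  also have "\<dots> = (\<integral>z. par_f N \<eta> z * b0 z + par_f N \<eta> z * resid \<eta> z \<partial>N)" using i1 i3 by simp
  also have "\<dots> = chi N (par_b \<eta>) (par_f N \<eta>)"
    unfolding chi_def resid_def by (simp add: algebra_simps)
  finally show ?thesis by simp
qed

lemma cross_small:
  assumes \<epsilon>: "0 < \<epsilon>"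
  shows "\<forall>\<^sub>F n in sequentially. \<forall>\<eta>\<in>H n. \<bar>sqrt (real n) * cross \<eta>\<bar> \<le> \<epsilon>"
  using order_tendstoD(2)[OF H_bf \<epsilon>]
proof eventually_elim
  case (elim n)
  let ?g = "\<lambda>\<eta>. \<bar>sqrt (real n) * (\<integral>z. (par_b \<eta> z - b0 z) * (par_f N \<eta> z - f0 z) \<partial>N)\<bar>"
  have bd: "\<bar>cross \<eta>\<bar> \<le> 2" if \<eta>: "\<eta> \<in> space Prior" for \<eta>
  proof -
    note r = resid_measurable[OF \<eta>]
    have i: "integrable N (\<lambda>z. par_f N \<eta> z * resid \<eta> z)" "integrable N (\<lambda>z. f0 z * resid \<eta> z)"
      by (rule integrable_par_f[OF \<eta> r AE_resid]) (rule integrable_weighted[OF r AE_resid])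
    have "\<bar>cross \<eta>\<bar> \<le> (\<integral>z. \<bar>resid \<eta> z * (par_f N \<eta> z - f0 z)\<bar> \<partial>N)"
      unfolding cross_def by (rule integral_abs_bound)
    also have "\<dots> \<le> (\<integral>z. par_f N \<eta> z + f0 z \<partial>N)"
    proof (rule integral_mono_AE)
      have "integrable N (\<lambda>z. par_f N \<eta> z * resid \<eta> z - f0 z * resid \<eta> z)" using i by simp
      then show "integrable N (\<lambda>z. \<bar>resid \<eta> z * (par_f N \<eta> z - f0 z)\<bar>)"
        by (intro integrable_abs) (simp add: algebra_simps)
      show "AE z in N. \<bar>resid \<eta> z * (par_f N \<eta> z - f0 z)\<bar> \<le> par_f N \<eta> z + f0 z"
        using AE_resid[of \<eta>] good_bounds
      proof eventually_elim
        case (elim z)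
        have "\<bar>resid \<eta> z\<bar> * \<bar>par_f N \<eta> z - f0 z\<bar> \<le> 1 * (par_f N \<eta> z + f0 z)"
          using elim par_f_density(3)[OF \<eta>, of z] by (intro mult_mono) auto
        then show ?case by (simp add: abs_mult)
      qed
    qed (use par_f_density[OF \<eta>] in simp)
    also have "\<dots> = 2" using par_f_density[OF \<eta>] by (simp add: f0_integral)
    finally show ?thesis .
  qed
  show ?case
  proof
    fix \<eta> assume \<eta>: "\<eta> \<in> H n"
    have "?g \<eta> \<le> (SUP \<eta>\<in>H n. ?g \<eta>)"
    proof (rule cSUP_upper[OF \<eta>])
      show "bdd_above (?g ` H n)"
        using bd H_space by (intro bdd_aboveI2[where M = "sqrt (real n) * 2"])
          (auto simp: abs_mult cross_def resid_def intro!: mult_left_mono)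
    qed
    then show "\<bar>sqrt (real n) * cross \<eta>\<bar> \<le> \<epsilon>" using elim by (simp add: cross_def resid_def)
  qed
qed

lemma V2_eq: "V2 = (\<integral>z. f0 z * (b0 z)\<^sup>2 \<partial>N) - (\<integral>z. f0 z * b0 z \<partial>N)\<^sup>2"
proof -
  define c0 where "c0 = (\<integral>z. f0 z * b0 z \<partial>N)"
  have c0: "chi N b0 f0 = c0" by (simp add: chi_def c0_def mult.commute)
  have i1: "integrable N (\<lambda>z. f0 z * b0 z)" by (rule integrable_weighted[OF b0_meas abs_b0_le])
  have i2: "integrable N (\<lambda>z. f0 z * (b0 z)\<^sup>2)"
    by (rule integrable_weighted[where K = 1]) (use eventually_mono[OF abs_b0_le] in \<open>auto simp: abs_square_le_1\<close>)
  have "V2 = (\<integral>z. f0 z * (b0 z)\<^sup>2 - 2 * c0 * (f0 z * b0 z) + c0\<^sup>2 * f0 z \<partial>N)"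
    unfolding V2_def c0 by (rule Bochner_Integration.integral_cong) (simp_all add: power2_diff algebra_simps)
  also have "\<dots> = (\<integral>z. f0 z * (b0 z)\<^sup>2 \<partial>N) - 2 * c0 * c0 + c0\<^sup>2"
    using i1 i2 f0_integral by (simp add: c0_def[symmetric])
  finally show ?thesis by (simp add: c0_def[symmetric] power2_eq_square)
qed

text \<open>\<open>V2\<close> is the variance of \<open>b0\<close> under \<open>f0\<close>, and
  \<open>b0\<close> is bounded by 1, so the difference is at most 3 times the L1 distance: once for
  the second moment and twice for the squared mean.\<close>

lemma var_f_small:
  assumes \<epsilon>: "0 < \<epsilon>"
  shows "\<forall>\<^sub>F n in sequentially. \<forall>\<eta>\<in>H n. \<bar>var_f \<eta> - V2\<bar> \<le> \<epsilon>"
proof -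
  have "0 < \<epsilon> / 3" using \<epsilon> by simp
  from order_tendstoD(2)[OF H_f this] show ?thesis
  proof eventually_elim
    case (elim n)
    let ?l = "\<lambda>\<eta>. l1_norm N (\<lambda>z. par_f N \<eta> z - f0 z)"
    have iabs: "integrable N (\<lambda>z. \<bar>par_f N \<eta> z - f0 z\<bar>)" if "\<eta> \<in> space Prior" for \<eta>
      using par_f_density(1)[OF that] by simp
    have l2: "?l \<eta> \<le> 2" if \<eta>: "\<eta> \<in> space Prior" for \<eta>
    proof -
      have "?l \<eta> \<le> (\<integral>z. par_f N \<eta> z + f0 z \<partial>N)" unfolding l1_norm_def
      proof (rule integral_mono_AE[OF iabs[OF \<eta>]])
        show "AE z in N. \<bar>par_f N \<eta> z - f0 z\<bar> \<le> par_f N \<eta> z + f0 z"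
          using good_bounds
        proof eventually_elim
          case (elim z)
          then show ?case using par_f_density(3)[OF \<eta>, of z] by linarith
        qed
      qed (use par_f_density[OF \<eta>] in simp)
      then show ?thesis using par_f_density[OF \<eta>] by (simp add: f0_integral)
    qed
    show ?case
    proof
      fix \<eta> assume \<eta>: "\<eta> \<in> H n"
      note \<eta>' = H_space[OF \<eta>]
      have "?l \<eta> \<le> (SUP \<eta>\<in>H n. ?l \<eta>)"
        by (rule cSUP_upper[OF \<eta>]) (use l2 H_space in \<open>auto intro!: bdd_aboveI2[where M = "2 :: real"]\<close>)
      then have l: "?l \<eta> \<le> \<epsilon> / 3" using elim by linarith
      have d: "\<bar>(\<integral>z. par_f N \<eta> z * g z \<partial>N) - (\<integral>z. f0 z * g z \<partial>N)\<bar> \<le> ?l \<eta>"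
        if g: "g \<in> borel_measurable N" "AE z in N. \<bar>g z\<bar> \<le> 1" for g
      proof -
        have i: "integrable N (\<lambda>z. par_f N \<eta> z * g z)" "integrable N (\<lambda>z. f0 z * g z)"
          by (rule integrable_par_f[OF \<eta>' g]) (rule integrable_weighted[OF g])
        have "(\<integral>z. par_f N \<eta> z * g z \<partial>N) - (\<integral>z. f0 z * g z \<partial>N) = (\<integral>z. par_f N \<eta> z * g z - f0 z * g z \<partial>N)"
          using i by simp
        then have "\<bar>(\<integral>z. par_f N \<eta> z * g z \<partial>N) - (\<integral>z. f0 z * g z \<partial>N)\<bar> \<le> (\<integral>z. \<bar>par_f N \<eta> z * g z - f0 z * g z\<bar> \<partial>N)"
          by (simp only: integral_abs_bound)
        also have "\<dots> \<le> ?l \<eta>" unfolding l1_norm_def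
        proof (rule integral_mono_AE[OF _ iabs[OF \<eta>']])
          show "AE z in N. \<bar>par_f N \<eta> z * g z - f0 z * g z\<bar> \<le> \<bar>par_f N \<eta> z - f0 z\<bar>"
            using g(2) by eventually_elim (simp add: left_diff_distrib[symmetric] abs_mult mult_left_le)
        qed (use i in simp)
        finally show ?thesis .
      qed
      have d1: "\<bar>(\<integral>z. par_f N \<eta> z * b0 z \<partial>N) - (\<integral>z. f0 z * b0 z \<partial>N)\<bar> \<le> ?l \<eta>"
        by (rule d[OF b0_meas abs_b0_le])
      have d2: "\<bar>(\<integral>z. par_f N \<eta> z * (b0 z)\<^sup>2 \<partial>N) - (\<integral>z. f0 z * (b0 z)\<^sup>2 \<partial>N)\<bar> \<le> ?l \<eta>"
        by (rule d) (use eventually_mono[OF abs_b0_le] in \<open>auto simp: abs_square_le_1\<close>)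
      define u where "u = (\<integral>z. par_f N \<eta> z * b0 z \<partial>N)"
      define w where "w = (\<integral>z. f0 z * b0 z \<partial>N)"
      have u: "\<bar>u\<bar> \<le> 1"
      proof -
        have "\<bar>u\<bar> \<le> (\<integral>z. \<bar>par_f N \<eta> z * b0 z\<bar> \<partial>N)" unfolding u_def by (rule integral_abs_bound)
        also have "\<dots> \<le> (\<integral>z. par_f N \<eta> z \<partial>N)"
        proof (rule integral_mono_AE)
          show "AE z in N. \<bar>par_f N \<eta> z * b0 z\<bar> \<le> par_f N \<eta> z"
            using abs_b0_le
            by eventually_elim (use par_f_density(3)[OF \<eta>'] in \<open>simp add: abs_mult mult_left_le less_imp_le\<close>)
        qed (use integrable_par_f[OF \<eta>' b0_meas abs_b0_le] par_f_density[OF \<eta>'] in auto)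
        finally show ?thesis using par_f_density[OF \<eta>'] by simp
      qed
      have w: "\<bar>w\<bar> \<le> 1" using chi0_bounds by (simp add: w_def chi_def mult.commute)
      have uw: "\<bar>u\<^sup>2 - w\<^sup>2\<bar> \<le> 2 * ?l \<eta>"
      proof -
        have "\<bar>u\<^sup>2 - w\<^sup>2\<bar> = \<bar>u + w\<bar> * \<bar>u - w\<bar>" by (simp add: power2_eq_square algebra_simps flip: abs_mult)
        also have "\<dots> \<le> 2 * ?l \<eta>" using u w d1 by (intro mult_mono) (auto simp: u_def w_def abs_le_iff)
        finally show ?thesis .
      qed
      have "var_f \<eta> - V2 = ((\<integral>z. par_f N \<eta> z * (b0 z)\<^sup>2 \<partial>N) - (\<integral>z. f0 z * (b0 z)\<^sup>2 \<partial>N)) - (u\<^sup>2 - w\<^sup>2)"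
        by (simp add: var_f_def V2_eq u_def w_def)
      then show "\<bar>var_f \<eta> - V2\<bar> \<le> \<epsilon>" using d2 uw l by linarith
    qed
  qed
qed

text \<open>The expansion is stated as two-sided bounds on likelihoods, the form that can be
  integrated against the prior.\<close>

lemma tilt_outer_null:
  assumes \<epsilon>: "0 < \<epsilon>"
  shows "outer_null S (\<lambda>n. {x\<in>space S. \<not> (AE \<eta> in Prior. \<eta> \<in> H n \<longrightarrow>
    likelihood N n x \<eta> * exp (t * Y n x \<eta> - t\<^sup>2 / 2 * (V1 + V2) - \<epsilon>) \<le> likelihood N n x (eta_t N a0 b0 f0 n t \<eta>) \<and>
    likelihood N n x (eta_t N a0 b0 f0 n t \<eta>) \<le> likelihood N n x \<eta> * exp (t * Y n x \<eta> - t\<^sup>2 / 2 * (V1 + V2) + \<epsilon>))})"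
    (is "outer_null S (\<lambda>n. {x\<in>space S. \<not> (AE \<eta> in Prior. \<eta> \<in> H n \<longrightarrow> ?ok n x \<eta>)})")
proof (rule outer_null_mono)
  \<comment> \<open>Three errors enter with factor \<open>t\<close> and two with
    \<open>t\<^sup>2 / 2\<close>; the added 1 keeps \<open>d\<close> positive at
    \<open>t = 0\<close>. Together they use up \<open>\<epsilon> / 2\<close>, and the other half is
    left for the Taylor remainder.\<close>
  define d where "d = 3 * \<bar>t\<bar> + t\<^sup>2 + 1"
  define e where "e = \<epsilon> / (2 * d)"
  have d: "0 < d" using zero_le_power2[of t] unfolding d_def by linarith
  have e: "0 < e" using \<epsilon> d by (simp add: e_def)
  have e_sum: "(3 * \<bar>t\<bar> + t\<^sup>2) * e \<le> \<epsilon> / 2"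
  proof -
    have "(3 * \<bar>t\<bar> + t\<^sup>2) * e \<le> d * e" using e by (intro mult_right_mono) (auto simp: d_def)
    also have "\<dots> = \<epsilon> / 2" using d by (simp add: e_def)
    finally show ?thesis .
  qed
  define C where "C = 1 / \<delta> ^ 3 + 3"
  let ?c0 = "chi N b0 f0"
  let ?ct = "chi_tilde N a0 b0 f0"
  let ?E1 = "\<lambda>(n :: nat) (x :: nat \<Rightarrow> 'z obs). sqrt (real n) * (chihat n x - (?c0 + (\<Sum>i<n. ?ct (x i)) / real n))"
  let ?E2 = "\<lambda>(n :: nat) (x :: nat \<Rightarrow> 'z obs) \<eta>. (\<Sum>i<n. phi (x i) * resid \<eta> (fst (x i)) - rmean \<eta>) / sqrt (real n)"
  let ?Q = "\<lambda>(n :: nat) (x :: nat \<Rightarrow> 'z obs) \<eta>. \<Sum>i<n. phi (x i) * a0 (fst (x i)) * (par_b \<eta> (fst (x i)) * (1 - par_b \<eta> (fst (x i))))"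
  let ?B1 = "\<lambda>n. {x\<in>space S. \<bar>?E1 n x - 0\<bar> > e}"
  let ?B2 = "\<lambda>n. {x\<in>space S. ess_gt Prior e (\<lambda>\<eta>. indicator (H n) \<eta> * ?E2 n x \<eta>)}"
  let ?B3 = "\<lambda>n. {x\<in>space S. ess_gt Prior e (\<lambda>\<eta>. indicator (H n) \<eta> * (?Q n x \<eta> / real n - V1))}"
  let ?B4 = "\<lambda>n. {x\<in>space S. \<not> (\<forall>i. good_obs (x i))}"
  have "outer_null S ?B1"
    using efficient e unfolding asymp_efficient_def tendsto_outer_prob_iff data_law_eq by blast
  moreover have "outer_null S ?B2" by (rule multiplier_outer_null[OF e])
  moreover have "outer_null S ?B3" by (rule quadratic_outer_null[OF e])
  moreover have "outer_null S ?B4" by (rule outer_null_AE[OF AE_S_good])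
  ultimately show "outer_null S (\<lambda>n. ?B1 n \<union> ?B2 n \<union> ?B3 n \<union> ?B4 n)" by (intro outer_null_Un)
  have lim1: "(\<lambda>n. \<bar>t\<bar> / sqrt (real n)) \<longlonglongrightarrow> 0" by real_asymp
  have "(\<lambda>n. \<bar>t\<bar> ^ 3 * C * (1 / sqrt (real n))) \<longlonglongrightarrow> \<bar>t\<bar> ^ 3 * C * 0"
    by (intro tendsto_mult_left) real_asymp
  then have lim2: "(\<lambda>n. \<bar>t\<bar> ^ 3 * C * (1 / sqrt (real n))) \<longlonglongrightarrow> 0" by simp
  have half: "0 < (1 / 2 :: real)" "0 < \<epsilon> / 2" using \<epsilon> by auto
  show "\<forall>\<^sub>F n in sequentially. {x\<in>space S. \<not> (AE \<eta> in Prior. \<eta> \<in> H n \<longrightarrow> ?ok n x \<eta>)}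
      \<subseteq> ?B1 n \<union> ?B2 n \<union> ?B3 n \<union> ?B4 n"
    using eventually_gt_at_top[of "0 :: nat"] order_tendstoD(2)[OF lim1 half(1)] order_tendstoD(2)[OF lim2 half(2)]
      cross_small[OF e] var_f_small[OF e]
  proof eventually_elim
    case (elim n)
    note n = elim(1) and ts = elim(2) and rem = elim(3) and cr = elim(4) and vf = elim(5)
    define q where "q = sqrt (real n)"
    have q: "0 < q" "q\<^sup>2 = real n" using n by (simp_all add: q_def)
    define s where "s = t / q"
    have s: "s = t / sqrt (real n)" "\<bar>s\<bar> \<le> 1 / 2"
      using ts q by (simp_all add: s_def q_def abs_divide)
    show ?case
    proof (rule subsetI, rule ccontr)
      fix x assume x: "x \<in> {x\<in>space S. \<not> (AE \<eta> in Prior. \<eta> \<in> H n \<longrightarrow> ?ok n x \<eta>)}"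
        and nx: "x \<notin> ?B1 n \<union> ?B2 n \<union> ?B3 n \<union> ?B4 n"
      have 1: "\<bar>?E1 n x\<bar> \<le> e" and good: "\<And>i. good_obs (x i)" using x nx by auto
      have 2: "AE \<eta> in Prior. \<bar>indicator (H n) \<eta> * ?E2 n x \<eta>\<bar> \<le> e"
        and 3: "AE \<eta> in Prior. \<bar>indicator (H n) \<eta> * (?Q n x \<eta> / real n - V1)\<bar> \<le> e"
        using x nx by (auto simp only: ess_gt_def mem_Collect_eq Un_iff simp_thms)
      have "AE \<eta> in Prior. \<eta> \<in> H n \<longrightarrow> ?ok n x \<eta>"
        using 2 3
      proof eventually_elim
        case (elim \<eta>)
        show ?case
        proof
          assume \<eta>: "\<eta> \<in> H n"
          note \<eta>' = H_space[OF \<eta>]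
          have 2: "\<bar>?E2 n x \<eta>\<bar> \<le> e" and 3: "\<bar>?Q n x \<eta> / real n - V1\<bar> \<le> e" using elim \<eta> by simp_all
          have 4: "\<bar>q * cross \<eta>\<bar> \<le> e" and 5: "\<bar>var_f \<eta> - V2\<bar> \<le> e"
            using cr vf \<eta> by (auto simp: q_def)
          define R where "R = (\<Sum>i<n. log_ratio s \<eta> (x i))"
          define A where "A = (\<Sum>i<n. ?ct (x i))"
          define Bs where "Bs = (\<Sum>i<n. phi (x i) * resid \<eta> (fst (x i)))"
          define mf where "mf = chi N b0 (par_f N \<eta>)"
          let ?main = "\<lambda>i. - s * ?ct (x i) + s * (phi (x i) * resid \<eta> (fst (x i))) + s * (mf - ?c0)
            - s\<^sup>2 / 2 * (phi (x i) * a0 (fst (x i)) * (par_b \<eta> (fst (x i)) * (1 - par_b \<eta> (fst (x i))))) - s\<^sup>2 / 2 * var_f \<eta>"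
          have each: "\<bar>log_ratio s \<eta> (x i) - ?main i\<bar> \<le> \<bar>s\<bar> ^ 3 * C" for i
          proof -
            obtain z r w where xi: "x i = (z, r, w)" by (cases "x i") auto
            show ?thesis
              using log_ratio_expansion[OF \<eta>' s(2), of z r w] good[of i]
              by (simp add: xi C_def mf_def phi_def power2_eq_square mult.assoc)
          qed
          have "\<bar>R - (\<Sum>i<n. ?main i)\<bar> \<le> (\<Sum>i<n. \<bar>s\<bar> ^ 3 * C)"
            unfolding R_def sum_subtractf[symmetric] by (intro order_trans[OF sum_abs] sum_mono each)
          also have "\<dots> = \<bar>t\<bar> ^ 3 * C * (1 / sqrt (real n))"
          proof -
            \<comment> \<open>The sum of \<open>n\<close> cubic remainders in
              \<open>t / sqrt n\<close> is of order \<open>1 / sqrt n\<close>.\<close>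
            have ns: "real n * \<bar>s\<bar> ^ 3 = \<bar>t\<bar> ^ 3 * (1 / q)"
              unfolding q(2)[symmetric] s_def using q(1) by (simp add: abs_divide power_divide eval_nat_numeral)
            have "(\<Sum>i<n. \<bar>s\<bar> ^ 3 * C) = real n * \<bar>s\<bar> ^ 3 * C" by simp
            then show ?thesis unfolding ns by (simp add: q_def)
          qed
          finally have Rm: "\<bar>R - (\<Sum>i<n. ?main i)\<bar> \<le> \<epsilon> / 2" using rem by linarith
          have "(\<Sum>i<n. ?main i) = - s * A + s * Bs + real n * (s * (mf - ?c0)) - s\<^sup>2 / 2 * ?Q n x \<eta> - real n * (s\<^sup>2 / 2 * var_f \<eta>)"
            unfolding A_def Bs_def sum_distrib_left by (simp add: sum.distrib sum_subtractf sum_negf)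
          also have "\<dots> = (t * (q * (mf + rmean \<eta> + cross \<eta> - chihat n x)) - t\<^sup>2 / 2 * (V1 + V2))
            + t * (q * (chihat n x - (?c0 + A / real n))) + t * ((Bs - real n * rmean \<eta>) / q) - t * (q * cross \<eta>)
            - t\<^sup>2 / 2 * (?Q n x \<eta> / real n - V1) - t\<^sup>2 / 2 * (var_f \<eta> - V2)"
            unfolding s_def q(2)[symmetric] by (rule expansion_identity[OF q(1)])
          also have "t * (q * (mf + rmean \<eta> + cross \<eta> - chihat n x)) = t * Y n x \<eta>"
            by (simp add: Y_def q_def chi_decomposition[OF \<eta>'] mf_def)
          also have "(Bs - real n * rmean \<eta>) / q = ?E2 n x \<eta>"
            by (simp add: Bs_def q_def sum_subtractf)
          also have "q * (chihat n x - (?c0 + A / real n)) = ?E1 n x" by (simp add: q_def A_def)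
          finally have main: "(\<Sum>i<n. ?main i) = t * Y n x \<eta> - t\<^sup>2 / 2 * (V1 + V2)
            + t * ?E1 n x + t * ?E2 n x \<eta> - t * (q * cross \<eta>)
            - t\<^sup>2 / 2 * (?Q n x \<eta> / real n - V1) - t\<^sup>2 / 2 * (var_f \<eta> - V2)" .
          have m1: "\<bar>t * u\<bar> \<le> \<bar>t\<bar> * e" if "\<bar>u\<bar> \<le> e" for u
            unfolding abs_mult using that by (intro mult_left_mono) auto
          have m2: "\<bar>t\<^sup>2 / 2 * u\<bar> \<le> t\<^sup>2 / 2 * e" if "\<bar>u\<bar> \<le> e" for u
            unfolding abs_mult using that by (intro mult_mono) auto
          have "\<bar>(\<Sum>i<n. ?main i) - (t * Y n x \<eta> - t\<^sup>2 / 2 * (V1 + V2))\<bar> \<le> (3 * \<bar>t\<bar> + t\<^sup>2) * e"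
          proof -
            have "\<bar>(a + x1 + x2 - x3 - x4 - x5) - a\<bar> \<le> 3 * b + 2 * d"
              if "\<bar>x1\<bar> \<le> b" "\<bar>x2\<bar> \<le> b" "\<bar>x3\<bar> \<le> b" "\<bar>x4\<bar> \<le> d" "\<bar>x5\<bar> \<le> d"
              for a x1 x2 x3 x4 x5 b d :: real
              using that by linarith
            from this[OF m1[OF 1] m1[OF 2] m1[OF 4] m2[OF 3] m2[OF 5]]
            have "\<bar>(\<Sum>i<n. ?main i) - (t * Y n x \<eta> - t\<^sup>2 / 2 * (V1 + V2))\<bar> \<le> 3 * (\<bar>t\<bar> * e) + 2 * (t\<^sup>2 / 2 * e)"
              unfolding main .
            then show ?thesis by (simp add: distrib_right)
          qed
          with Rm e_sum have Rfin: "\<bar>R - (t * Y n x \<eta> - t\<^sup>2 / 2 * (V1 + V2))\<bar> \<le> \<epsilon>" by linarith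
          have lik: "likelihood N n x (eta_t N a0 b0 f0 n t \<eta>) = likelihood N n x \<eta> * exp R"
            unfolding R_def by (rule likelihood_eta_t[OF \<eta>' s good])
          show "?ok n x \<eta>"
            unfolding lik using Rfin likelihood_nonneg[OF \<eta>', of n x]
            by (auto intro!: mult_left_mono simp: abs_le_iff)
        qed
      qed
      then show False using x by simp
    qed
  qed
qed

theorem BvM: "semiparametric_BvM N a0 b0 f0 Prior chihat"
  unfolding semiparametric_BvM_def tendsto_outer_prob_iff data_law_eq
proof (intro allI impI)
  fix \<epsilon> :: real assume \<epsilon>: "0 < \<epsilon>"
  define V where "V = eff_var N a0 b0 f0"
  have V: "0 < V" "V = V1 + V2" using eff_var_pos eff_var_eq by (simp_all add: V_def)
  define G where "G = density lborel (\<lambda>u. ennreal (normal_density 0 (sqrt V) u))"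
  have G: "real_distribution G"
    unfolding G_def real_distribution_def real_distribution_axioms_def
    using prob_space_normal_density[of "sqrt V" 0] V by simp
  have "0 < sqrt V" "0 < \<epsilon> / 2" using V \<epsilon> by auto
  from bl_dist_normal_le_of_mgf[OF this] obtain T \<kappa> where T: "finite T" "0 < \<kappa>"
    and near: "\<And>\<nu>. real_distribution \<nu> \<Longrightarrow>
      (\<forall>t\<in>T. integrable \<nu> (\<lambda>x. exp (t * x)) \<and> \<bar>(\<integral>x. exp (t * x) \<partial>\<nu>) - exp (t\<^sup>2 * (sqrt V)\<^sup>2 / 2)\<bar> \<le> \<kappa>) \<Longrightarrow>
      bl_dist \<nu> G \<le> \<epsilon> / 2"
    unfolding G_def by blast
  define c where "c t = t\<^sup>2 / 2 * (V1 + V2)" for t :: real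
  \<comment> \<open>The relative error \<open>5 * e t\<close> at the limit \<open>exp (c t)\<close>
    has to stay within the absolute tolerance \<open>\<kappa>\<close>; the cap 1/2 is required by
    \<open>mgf_near_of_tilted_ratio\<close>.\<close>
  define e where "e t = min (1 / 2) (\<kappa> / (5 * exp (c t)))" for t
  have e: "0 < e t" "e t \<le> 1 / 2" "5 * e t * exp (c t) \<le> \<kappa>" for t
  proof -
    show "0 < e t" "e t \<le> 1 / 2" using T by (auto simp: e_def)
    have "e t \<le> \<kappa> / (5 * exp (c t))" by (simp add: e_def)
    then show "5 * e t * exp (c t) \<le> \<kappa>" by (simp add: field_simps)
  qed
  define e1 where "e1 = min (1 / 2) (\<epsilon> / 4)"
  have e1: "0 < e1" "e1 < 1" "2 * e1 \<le> \<epsilon> / 2" using \<epsilon> by (auto simp: e1_def)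
  let ?A = "\<lambda>t n x. (LINT \<eta>:H n|Prior. likelihood N n x (eta_t N a0 b0 f0 n t \<eta>))"
  let ?B = "\<lambda>n x. (LINT \<eta>:H n|Prior. likelihood N n x \<eta>)"
  let ?C1 = "\<lambda>n. {x\<in>space S. \<bar>measure (posterior N Prior n x) (H n) - 1\<bar> > e1}"
  let ?C2 = "\<lambda>t n. {x\<in>space S. \<bar>?A t n x / ?B n x - 1\<bar> > e t}"
  let ?C3 = "\<lambda>t n. {x\<in>space S. \<not> (AE \<eta> in Prior. \<eta> \<in> H n \<longrightarrow>
    likelihood N n x \<eta> * exp (t * Y n x \<eta> - t\<^sup>2 / 2 * (V1 + V2) - e t) \<le> likelihood N n x (eta_t N a0 b0 f0 n t \<eta>) \<and>
    likelihood N n x (eta_t N a0 b0 f0 n t \<eta>) \<le> likelihood N n x \<eta> * exp (t * Y n x \<eta> - t\<^sup>2 / 2 * (V1 + V2) + e t))}"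
  have C1: "outer_null S ?C1"
    using H_post e1 unfolding tendsto_outer_prob_iff data_law_eq by blast
  have C2: "outer_null S (?C2 t)" for t
    using ratio[of t] e(1)[of t] unfolding tendsto_outer_prob_iff data_law_eq by blast
  have C3: "outer_null S (?C3 t)" for t by (rule tilt_outer_null[OF e(1)])
  have C: "outer_null S (\<lambda>n. ?C1 n \<union> (\<Union>t\<in>T. ?C2 t n \<union> ?C3 t n))"
    using T(1) by (intro outer_null_Un C1 outer_null_finite_UN C2 C3)
  \<comment> \<open>Off finitely many bad events the argument is deterministic, for each
    \<open>n\<close> and each sample.\<close>
  have "{x\<in>space S. \<bar>bl_dist (distr (posterior N Prior n x) borel
          (\<lambda>\<eta>. sqrt (real n) * (chi N (par_b \<eta>) (par_f N \<eta>) - chihat n x))) G - 0\<bar> > \<epsilon>}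
      \<subseteq> ?C1 n \<union> (\<Union>t\<in>T. ?C2 t n \<union> ?C3 t n)" for n
  proof (rule subsetI, rule ccontr)
    fix x assume x: "x \<in> {x\<in>space S. \<bar>bl_dist (distr (posterior N Prior n x) borel
          (\<lambda>\<eta>. sqrt (real n) * (chi N (par_b \<eta>) (par_f N \<eta>) - chihat n x))) G - 0\<bar> > \<epsilon>}"
      and nx: "x \<notin> ?C1 n \<union> (\<Union>t\<in>T. ?C2 t n \<union> ?C3 t n)"
    have xS: "x \<in> space S" using x by simp
    let ?L = "likelihood N n x"
    note Lm = likelihood_measurable[OF xS, of n] and Ym = Y_measurable[of n x]
    have Lp: "\<forall>\<eta>\<in>space Prior. 0 \<le> ?L \<eta>" by (simp add: likelihood_nonneg)
    have post: "\<bar>measure (posterior N Prior n x) (H n) - 1\<bar> \<le> e1" using x nx by auto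
    define \<nu> where "\<nu> = distr (density Prior (\<lambda>\<eta>. ennreal (indicator (H n) \<eta> * ?L \<eta> / ?B n x))) borel (Y n x)"
    note pc = posterior_conditional_bl_dist[OF H_sets Lm Lp Ym post[unfolded posterior_def] e1(2) G,
        folded \<nu>_def posterior_def]
    have near_t: "integrable \<nu> (\<lambda>y. exp (t * y)) \<and> \<bar>(\<integral>y. exp (t * y) \<partial>\<nu>) - exp (t\<^sup>2 * (sqrt V)\<^sup>2 / 2)\<bar> \<le> \<kappa>"
      if t: "t \<in> T" for t
    proof -
      have r: "\<bar>?A t n x / ?B n x - 1\<bar> \<le> e t" using x nx t by auto
      have ae: "AE \<eta> in Prior. \<eta> \<in> H n \<longrightarrow>
          ?L \<eta> * exp (t * Y n x \<eta> - c t - e t) \<le> likelihood N n x (eta_t N a0 b0 f0 n t \<eta>) \<and>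
          likelihood N n x (eta_t N a0 b0 f0 n t \<eta>) \<le> ?L \<eta> * exp (t * Y n x \<eta> - c t + e t)"
        using nx t xS unfolding c_def by blast
      note m = mgf_near_of_tilted_ratio[OF H_sets Lm Lp Ym e(1,2) r pc(1) ae]
      have "exp (t\<^sup>2 * (sqrt V)\<^sup>2 / 2) = exp (c t)" using V by (simp add: c_def)
      then show ?thesis using pc(5)[OF m(1)] m(2) e(3)[of t] by simp
    qed
    have "bl_dist \<nu> G \<le> \<epsilon> / 2" using near[OF pc(2)] near_t by blast
    then have "bl_dist (distr (posterior N Prior n x) borel (Y n x)) G \<le> \<epsilon>"
      using pc(4) e1 by linarith
    moreover have "0 \<le> bl_dist (distr (posterior N Prior n x) borel (Y n x)) G"
      by (rule bl_dist_nonneg[OF pc(3) G])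
    ultimately show False using x by (simp add: Y_def[abs_def])
  qed
  then show "outer_null S (\<lambda>n. {x\<in>space S. \<bar>bl_dist (distr (posterior N Prior n x) borel
          (\<lambda>\<eta>. sqrt (real n) * (chi N (par_b \<eta>) (par_f N \<eta>) - chihat n x)))
        (density lborel (\<lambda>u. ennreal (normal_density 0 (sqrt (eff_var N a0 b0 f0)) u))) - 0\<bar> > \<epsilon>})"
    unfolding G_def V_def by (intro outer_null_mono[OF C] always_eventually allI)
qed

end

theorem theorem3:
  fixes N :: "'z measure"
    and a0 b0 f0 :: "'z \<Rightarrow> real"
    and Prior :: "'z param measure"
    and H :: "nat \<Rightarrow> 'z param set"
    and chihat :: "nat \<Rightarrow> (nat \<Rightarrow> 'z obs) \<Rightarrow> real"
  assumes truth: "regular_truth N a0 b0 f0"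
    and prior: "is_prior N Prior"
    and efficient: "asymp_efficient N a0 b0 f0 chihat"
    and H_sets: "\<And>n. H n \<in> sets Prior"
    and H_post: "tendsto_outer_prob (data_law N a0 b0 f0)
          (\<lambda>n x. measure (posterior N Prior n x) (H n)) 1"
    and H_b: "(\<lambda>n. SUP \<eta>\<in>H n. l2_norm (density N (\<lambda>z. ennreal (f0 z)))
          (\<lambda>z. par_b \<eta> z - b0 z)) \<longlonglongrightarrow> 0"
    and H_f: "(\<lambda>n. SUP \<eta>\<in>H n. l1_norm N (\<lambda>z. par_f N \<eta> z - f0 z)) \<longlonglongrightarrow> 0"
    and H_emp: "tendsto_outer_prob (data_law N a0 b0 f0)
          (\<lambda>n x. SUP \<eta>\<in>H n.
             \<bar>emp_process (obs_law N a0 b0 f0) n (\<lambda>(z, r, w). par_b \<eta> z - b0 z) x\<bar>) 0"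
    and H_bf: "(\<lambda>n. SUP \<eta>\<in>H n.
          \<bar>sqrt (real n) * (\<integral>z. (par_b \<eta> z - b0 z) * (par_f N \<eta> z - f0 z) \<partial>N)\<bar>) \<longlonglongrightarrow> 0"
    and ratio: "\<And>t. tendsto_outer_prob (data_law N a0 b0 f0)
          (\<lambda>n x. (LINT \<eta>:H n|Prior. likelihood N n x (eta_t N a0 b0 f0 n t \<eta>))
                 / (LINT \<eta>:H n|Prior. likelihood N n x \<eta>)) 1"
  shows "semiparametric_BvM N a0 b0 f0 Prior chihat"
proof -
  obtain \<delta>1 where \<delta>1: "0 < \<delta>1" "AE z in N. \<delta>1 \<le> 1 / a0 z \<and> 1 / a0 z \<le> 1 - \<delta>1"
    using truth unfolding regular_truth_def by blast
  obtain \<delta>2 where \<delta>2: "0 < \<delta>2" "AE z in N. \<delta>2 \<le> b0 z \<and> b0 z \<le> 1 - \<delta>2"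
    using truth unfolding regular_truth_def by blast
  obtain \<delta>3 K where \<delta>3: "0 < \<delta>3" "AE z in N. \<delta>3 \<le> f0 z \<and> f0 z \<le> K"
    using truth unfolding regular_truth_def by blast
  \<comment> \<open>One constant for the three bounds, each of which only weakens when its constant
    is lowered.\<close>
  define \<delta> where "\<delta> = min \<delta>1 (min \<delta>2 \<delta>3)"
  have \<delta>: "0 < \<delta>" "\<delta> \<le> \<delta>1" "\<delta> \<le> \<delta>2" "\<delta> \<le> \<delta>3" using \<delta>1 \<delta>2 \<delta>3 by (auto simp: \<delta>_def)
  have "AE z in N. 1 \<le> a0 z \<and> a0 z \<le> 1 / \<delta> \<and> \<delta> \<le> b0 z \<and> b0 z \<le> 1 - \<delta> \<and> \<delta> \<le> f0 z"
    using \<delta>1(2) \<delta>2(2) \<delta>3(2)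
  proof eventually_elim
    case (elim z)
    have a: "\<delta> \<le> 1 / a0 z" "1 / a0 z \<le> 1" using elim \<delta> by linarith+
    then have "0 < 1 / a0 z" using \<delta> by linarith
    then have "0 < a0 z" by simp
    with a \<delta> have "1 \<le> a0 z" "a0 z \<le> 1 / \<delta>" by (simp_all add: field_simps)
    then show ?case using elim \<delta> by auto
  qed
  then interpret bvm_full N a0 b0 f0 \<delta> Prior H chihat
    using truth \<delta>(1) assms unfolding regular_truth_def by unfold_locales auto
  show ?thesis by (rule BvM)
qed

end
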